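(* Let $\mathbb{K}$ be a field of characteristic zero. The Terao conjecture is true in the class $PB_3$: if $\mathcal{A}$ and $\mathcal{B}$ are central arrangements in $\mathbb{K}^3$ belonging to $PB_3$ whose intersection lattices $L(\mathcal{A})$ and $L(\mathcal{B})$ are isomorphic, then $\mathcal{A}$ is free if and only if $\mathcal{B}$ is free.
   Context: A central $3$-arrangement is a finite set $\mathcal{A}$ of linear hyperplanes in $V=\mathbb{K}^3$; for $H\in\mathcal{A}$ let $\alpha_H$ be a linear form with kernel $H$. Let $S$ be the polynomial ring in three variables and $\mathrm{Der}(S)$ the module of $\mathbb{K}$-linear derivations of $S$. $\mathcal{A}$ is free if $D(\mathcal{A})=\{\theta\in\mathrm{Der}(S)\mid\theta(\alpha_H)\in S\alpha_H\ \text{for all } H\in\mathcal{A}\}$ is a free $S$-module. The intersection lattice $L(\mathcal{A})$ is the set of all intersections of subsets of $\mathcal{A}$ (including $V$ as the empty intersection), ordered by reverse inclusion; the Möbius function is $\mu(V)=1$, $\mu(X)=-\sum_{X\subsetneq Y}\mu(Y)$ for $X\neq V$, and the characteristic polynomial is $\chi(\mathcal{A},t)=\sum_{X\in L(\mathcal{A})}\mu(X)t^{\dim X}$. The Terao conjecture asserts that freeness of an arrangement depends only on its intersection lattice. For $H_0\in\mathcal{A}$, the Ziegler restriction of $\mathcal{A}$ with respect to $H_0$ is $(\mathcal{A}\cap H_0,m_0)$, where $\mathcal{A}\cap H_0=\{H\cap H_0\mid H\in\mathcal{A}\setminus\{H_0\}\}$ and $m_0(K)=|\{H\in\mathcal{A}\setminus\{H_0\}\mid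 H\cap H_0=K\}|$. It is balanced if $m_0(K)\le\sum_{H\in(\mathcal{A}\cap H_0)\setminus\{K\}}m_0(H)$ for every $K\in\mathcal{A}\cap H_0$. $PB_3$ is the class of central $3$-arrangements $\mathcal{A}$ such that every Ziegler restriction of $\mathcal{A}$ (i.e. with respect to every $H_0\in\mathcal{A}$) is balanced, and such that there exists $H_0\in\mathcal{A}$ with $\chi(\mathcal{A},t)=(t-1)(t-d)(t-d')$ for some $d,d'\in\mathbb{Z}$ satisfying $|d-d'|\ge h-3$, where $h=|\mathcal{A}\cap H_0|$. *)

theory Defs
  imports
    "HOL-Analysis.Analysis"
    "HOL-Library.Poly_Mapping"
    "HOL-Library.Function_Algebras"
    "HOL-Computational_Algebra.Polynomial"
begin

text \<open>The vector space \<open>V = K\<^sup>3\<close> is the type \<open>'k ^ 3\<close>; its linear algebra has the prefix \<open>vec\<close>.\<close>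

definition hyperplane :: "('k::field ^ 3) set \<Rightarrow> bool" where
  "hyperplane H \<longleftrightarrow> vec.subspace H \<and> vec.dim H = 2"

definition arrangement :: "('k::field ^ 3) set set \<Rightarrow> bool" where
  "arrangement \<A> \<longleftrightarrow> finite \<A> \<and> (\<forall>H\<in>\<A>. hyperplane H)"

text \<open>\<open>\<Inter>{} = UNIV\<close>, so the whole space \<open>V\<close> belongs to the lattice.\<close>

definition intersection_lattice :: "('k::field ^ 3) set set \<Rightarrow> ('k ^ 3) set set" where
  "intersection_lattice \<A> = {\<Inter>\<B> | \<B>. \<B> \<subseteq> \<A>}"

lemma finite_intersection_lattice: "finite \<A> \<Longrightarrow> finite (intersection_lattice \<A>)"
  unfolding intersection_lattice_def by simp

text \<open>An isomorphism of posets for reverse inclusion; isomorphisms of lattices are the same thing.\<close>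

definition lattice_isomorphic ::
    "('k::field ^ 3) set set \<Rightarrow> ('k ^ 3) set set \<Rightarrow> bool" where
  "lattice_isomorphic L M \<longleftrightarrow>
     (\<exists>\<phi>. bij_betw \<phi> L M \<and> (\<forall>X\<in>L. \<forall>Y\<in>L. X \<supseteq> Y \<longleftrightarrow> \<phi> X \<supseteq> \<phi> Y))"

text \<open>The finiteness guard only serves to make the recursion well-founded.\<close>

function moebius :: "('k::field ^ 3) set set \<Rightarrow> ('k ^ 3) set \<Rightarrow> int" where
  "moebius \<A> X =
     (if \<not> finite \<A> then 0
      else if X = UNIV then 1
      else - (\<Sum>Y\<in>{Y \<in> intersection_lattice \<A>. X \<subset> Y}. moebius \<A> Y))"
  by pat_completeness auto
termination
proof (relation "Wellfounded.measure (\<lambda>(\<A>, X). card {Y \<in> intersection_lattice \<A>. X \<subset> Y})", goal_cases)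
  case (2 \<A> X Y)
  have "{Z \<in> intersection_lattice \<A>. Y \<subset> Z} \<subset> {Z \<in> intersection_lattice \<A>. X \<subset> Z}"
    using 2 by auto
  moreover have "finite {Z \<in> intersection_lattice \<A>. X \<subset> Z}"
    using 2 by (simp add: finite_intersection_lattice)
  ultimately show ?case by (simp add: psubset_card_mono)
qed auto

declare moebius.simps [simp del]

definition characteristic_poly :: "('k::field ^ 3) set set \<Rightarrow> int poly" where
  "characteristic_poly \<A> = (\<Sum>X\<in>intersection_lattice \<A>. monom (moebius \<A> X) (vec.dim X))"

text \<open>
  \<open>S = K[x\<^sub>1, x\<^sub>2, x\<^sub>3]\<close>: finitely supported maps from exponent vectors (finitely supported maps
  from the three-element index type to \<open>nat\<close>) to coefficients, with the convolution product.
\<close>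

type_synonym 'k poly3 = "(3 \<Rightarrow>\<^sub>0 nat) \<Rightarrow>\<^sub>0 'k"

definition Const3 :: "'k::field \<Rightarrow> 'k poly3" where
  "Const3 c = Poly_Mapping.single 0 c"

definition Var3 :: "3 \<Rightarrow> 'k::field poly3" where
  "Var3 i = Poly_Mapping.single (Poly_Mapping.single i 1) 1"

text \<open>
  A vector \<open>a\<close> encodes the linear form \<open>a\<^sub>1 x\<^sub>1 + a\<^sub>2 x\<^sub>2 + a\<^sub>3 x\<^sub>3\<close>, as an element of \<open>S\<close> in
  \<open>linear_form\<close> and as a functional on \<open>V\<close> in \<open>form_kernel\<close>.
\<close>

definition linear_form :: "'k::field ^ 3 \<Rightarrow> 'k poly3" where
  "linear_form a = (\<Sum>i\<in>UNIV. Const3 (a $ i) * Var3 i)"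

definition form_kernel :: "'k::field ^ 3 \<Rightarrow> ('k ^ 3) set" where
  "form_kernel a = {x. (\<Sum>i\<in>UNIV. a $ i * x $ i) = 0}"

definition defining_form :: "('k::field ^ 3) set \<Rightarrow> 'k poly3" where
  "defining_form H = linear_form (SOME a. form_kernel a = H)"

lemma hyperplane_is_form_kernel:
  fixes H :: "('k::field ^ 3) set"
  assumes "hyperplane H"
  shows "\<exists>a. form_kernel a = H"
proof -
  have sub: "vec.subspace H" and dim: "vec.dim H = 2"
    using assms by (auto simp: hyperplane_def)
  obtain B where B: "B \<subseteq> H" "vec.independent B" "H \<subseteq> vec.span B" "card B = vec.dim H"
    using vec.basis_exists by blast
  have spanB: "vec.span B = H"
    using B sub by (metis vec.span_minimal subset_antisym)
  define C where "C = vec.extend_basis B"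
  have C: "B \<subseteq> C" "vec.independent C" "vec.span C = UNIV"
    using B(2) by (auto simp: C_def vec.extend_basis_superset vec.independent_extend_basis
        vec.span_extend_basis)
  have finC: "finite C" using C(2) by (rule vec.finiteI_independent)
  have "card C = 3"
    using C vec.dim_span_eq_card_independent[OF C(2)] by (simp add: card_cart_basis vec.dimension_def)
  hence "card (C - B) = 1"
    using C(1) B(4) dim finC by (simp add: card_Diff_subset finite_subset)
  then obtain c where c: "C - B = {c}" by (auto simp: card_1_singleton_iff)
  define a :: "'k ^ 3" where "a = (\<chi> i. vec.representation C (axis i 1) c)"
  have rep: "(\<Sum>i\<in>UNIV. a $ i * x $ i) = vec.representation C x c" for x
  proof -
    have "vec.representation C x c
        = vec.representation C (\<Sum>i\<in>UNIV. x $ i *s axis i 1) c"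
      by (simp add: basis_expansion)
    also have "\<dots> = (\<Sum>i\<in>UNIV. x $ i * vec.representation C (axis i 1) c)"
      using C by (simp add: vec.representation_sum vec.representation_scale)
    finally show ?thesis by (simp add: a_def mult.commute)
  qed
  have "vec.representation C x c = 0 \<longleftrightarrow> x \<in> vec.span B" for x
  proof
    assume "x \<in> vec.span B"
    hence "vec.representation C x = vec.representation B x"
      using C by (intro vec.representation_extend) auto
    thus "vec.representation C x c = 0"
      using c vec.representation_ne_zero[of B x c] by auto
  next
    assume 0: "vec.representation C x c = 0"
    have "x = (\<Sum>b\<in>C. vec.representation C x b *s b)"
      using C finC by (simp add: vec.sum_representation_eq)
    also have "\<dots> = (\<Sum>b\<in>B. vec.representation C x b *s b)"
      using c 0 C(1) finC by (intro sum.mono_neutral_right) auto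
    also have "\<dots> \<in> vec.span B"
      by (intro vec.span_sum vec.span_scale vec.span_base)
    finally show "x \<in> vec.span B" .
  qed
  hence "form_kernel a = H" by (auto simp: form_kernel_def rep spanB)
  thus ?thesis ..
qed

lemma form_kernel_defining_vector:
  assumes "hyperplane H"
  shows "form_kernel (SOME a. form_kernel a = H) = H"
  using someI_ex[OF hyperplane_is_form_kernel[OF assms]] .

definition derivations :: "('k::field poly3 \<Rightarrow> 'k poly3) set" where
  "derivations = {\<theta>. (\<forall>f g. \<theta> (f + g) = \<theta> f + \<theta> g)
                   \<and> (\<forall>c f. \<theta> (Const3 c * f) = Const3 c * \<theta> f)
                   \<and> (\<forall>f g. \<theta> (f * g) = f * \<theta> g + g * \<theta> f)}"

definition log_derivations ::
    "('k::field ^ 3) set set \<Rightarrow> ('k poly3 \<Rightarrow> 'k poly3) set" where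
  "log_derivations \<A> =
     {\<theta> \<in> derivations. \<forall>H\<in>\<A>. defining_form H dvd \<theta> (defining_form H)}"

text \<open>
  All maps \<open>S \<rightarrow> S\<close> form an \<open>S\<close>-module under pointwise operations; \<open>Der(S)\<close> and \<open>D(\<A>)\<close> are
  submodules of it, so \<open>S\<close>-linear independence and span can be taken there.
\<close>

definition map_scale ::
    "'k::field poly3 \<Rightarrow> ('k poly3 \<Rightarrow> 'k poly3) \<Rightarrow> 'k poly3 \<Rightarrow> 'k poly3" where
  "map_scale p \<theta> = (\<lambda>f. p * \<theta> f)"

global_interpretation S_maps: module "map_scale :: 'k::field poly3 \<Rightarrow> _"
  by unfold_locales (auto simp: map_scale_def fun_eq_iff algebra_simps)

lemma subspace_log_derivations: "S_maps.subspace (log_derivations \<A>)"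
  unfolding S_maps.subspace_def log_derivations_def derivations_def map_scale_def
  by (auto simp: algebra_simps)

definition free_arrangement :: "('k::field ^ 3) set set \<Rightarrow> bool" where
  "free_arrangement \<A> \<longleftrightarrow>
     (\<exists>E. S_maps.independent E \<and> S_maps.span E = log_derivations \<A>)"

definition restriction ::
    "('k::field ^ 3) set set \<Rightarrow> ('k ^ 3) set \<Rightarrow> ('k ^ 3) set set" where
  "restriction \<A> H0 = {H \<inter> H0 | H. H \<in> \<A> - {H0}}"

definition ziegler_mult ::
    "('k::field ^ 3) set set \<Rightarrow> ('k ^ 3) set \<Rightarrow> ('k ^ 3) set \<Rightarrow> nat" where
  "ziegler_mult \<A> H0 K = card {H \<in> \<A> - {H0}. H \<inter> H0 = K}"

definition balanced_restriction ::
    "('k::field ^ 3) set set \<Rightarrow> ('k ^ 3) set \<Rightarrow> bool" where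
  "balanced_restriction \<A> H0 \<longleftrightarrow>
     (\<forall>K\<in>restriction \<A> H0.
        ziegler_mult \<A> H0 K \<le> (\<Sum>H\<in>restriction \<A> H0 - {K}. ziegler_mult \<A> H0 H))"

definition PB3 :: "('k::field ^ 3) set set set" where
  "PB3 = {\<A>. arrangement \<A>
            \<and> (\<forall>H0\<in>\<A>. balanced_restriction \<A> H0)
            \<and> (\<exists>H0\<in>\<A>. \<exists>d d' :: int.
                  characteristic_poly \<A> = [:-1, 1:] * [:-d, 1:] * [:-d', 1:]
                  \<and> \<bar>d - d'\<bar> \<ge> int (card (restriction \<A> H0)) - 3)}"

end

theory Submission
  imports Defs
begin

text \<open>
  Every arrangement in \<open>PB\<^sub>3\<close> is free, whatever its lattice. Choose coordinates with \<open>H\<^sub>0 = {z = 0}\<close>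
  and the other \<open>n\<close> lines \<open>x - p\<^sub>i y + c\<^sub>i z = 0\<close>, the \<open>c\<^sub>i\<close> pairwise distinct, and let \<open>D\<^sub>k\<close> be the space
  of logarithmic derivations of degree \<open>k\<close> that kill \<open>z\<close>.

  Lower bound: by Terao's polynomial, adding a line that meets the previous \<open>j + 1\<close> lines in \<open>r\<close> points
  lowers \<open>dim D\<^sub>k\<close> by at most \<open>k - j + r\<close>. The numbers \<open>r\<close> add up to the linear
  coefficient of the characteristic polynomial, so for \<open>k \<ge> n\<close> the dimension of \<open>D\<^sub>k\<close> is at least that of a
  free module with exponents \<open>d, d'\<close>.

  Upper bound: at \<open>z = 0\<close>, \<open>D\<^sub>j\<close> maps into the logarithmic derivations \<open>M\<^sub>j\<close> of the Ziegler restriction, with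
  kernel \<open>z D\<^bsub>j-1\<^esub>\<close>. A nonzero \<open>(f, g) \<in> M\<^sub>e\<close> with nonzero Wronskian \<open>f' g - f g'\<close> satisfies
  \<open>n - h \<le> 2 e - 2\<close>, since the Wronskian is divisible by each form to the power (multiplicity - 1); if the
  Wronskian vanishes, \<open>(f, g)\<close> is a multiple of a constant vector, and balancedness gives \<open>n \<le> 2 e\<close>. With
  \<open>\<bar>d - d'\<bar> \<ge> h - 3\<close> this means \<open>e \<ge> min d d'\<close>, so \<open>dim M\<^sub>j\<close> is at most the dimension for exponents \<open>d, d'\<close>.

  Hence all inequalities are equalities: two generators of the Ziegler restriction, of degrees \<open>d\<close> and \<open>d'\<close>,
  lift to derivations of the arrangement, and together with the Euler derivation they form a basis.
\<close>

subsection \<open>Dimension of subspaces\<close>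

text \<open>The coordinates of \<open>x\<close> with respect to \<open>C\<close> are supported in
  \<open>A\<close> and also in \<open>B\<close>, hence vanish.\<close>

lemma (in vector_space) span_disjoint_independent:
  assumes "independent C" "A \<subseteq> C" "B \<subseteq> C" "A \<inter> B = {}" "x \<in> span A" "x \<in> span B"
  shows "x = 0"
proof -
  have "representation C x = representation A x" "representation C x = representation B x"
    using assms by (auto intro: representation_extend)
  hence "representation C x b = 0" for b
    using representation_ne_zero[of A x b] representation_ne_zero[of B x b] assms(4) by auto
  moreover have "x \<in> span C" using assms span_mono by blast
  ultimately show ?thesis
    using sum_nonzero_representation_eq[of C x] assms(1) by simp
qed

context vector_space_pair
begin

text \<open>A basis \<open>A\<close> of the kernel extends to a basis \<open>C\<close> of
  \<open>W\<close>, and \<open>f\<close> maps \<open>C - A\<close> to a basis of the image. The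
  finite spanning set makes these bases finite.\<close>

lemma rank_nullity:
  assumes f: "Vector_Spaces.linear s1 s2 f"
    and W: "vs1.subspace W" "W \<subseteq> vs1.span B" "finite B"
  shows "vs1.dim W = vs1.dim {w \<in> W. f w = 0} + vs2.dim (f ` W)"
proof -
  interpret f: Vector_Spaces.linear s1 s2 f by (rule f)
  define N where "N = {w \<in> W. f w = 0}"
  obtain A where A: "A \<subseteq> N" "vs1.independent A" "N \<subseteq> vs1.span A"
    using vs1.maximal_independent_subset by blast
  have AW: "A \<subseteq> W" using A(1) by (auto simp: N_def)
  obtain C where C: "A \<subseteq> C" "C \<subseteq> W" "vs1.independent C" "W \<subseteq> vs1.span C"
    using vs1.maximal_independent_subset_extend[OF AW A(2)] by blast
  have finC: "finite C"
    using vs1.independent_span_bound[OF W(3) C(3)] C(2) W(2) by blast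
  have indD: "vs1.independent (C - A)" using C(3) vs1.independent_mono by blast
  have fA: "f x = 0" if "x \<in> A" for x using that A(1) by (auto simp: N_def)
  have sub: "vs1.span (C - A) \<subseteq> W"
    using C(2) W(1) by (intro vs1.span_minimal) auto
  \<comment> \<open>Independence of \<open>C\<close> makes the span of \<open>C - A\<close> meet the
    kernel only in 0.\<close>
  have ker: "x = 0" if x: "x \<in> vs1.span (C - A)" "f x = 0" for x
  proof -
    have "x \<in> vs1.span A" using x sub A(3) by (auto simp: N_def)
    thus ?thesis
      using vs1.span_disjoint_independent[OF C(3), of A "C - A" x] C(1) x(1) by blast
  qed
  have inj: "inj_on f (vs1.span (C - A))"
    by (rule inj_onI) (metis ker f.diff right_minus_eq vs1.span_diff)
  have ind: "vs2.independent (f ` (C - A))"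
    by (rule linear_independent_injective_image[OF f indD inj])
  have "f ` W \<subseteq> f ` vs1.span C" using C(4) by blast
  also have "\<dots> = vs2.span (f ` C)" by (rule f.span_image[symmetric])
  also have "f ` C \<subseteq> insert 0 (f ` (C - A))" using fA by auto
  hence "vs2.span (f ` C) \<subseteq> vs2.span (f ` (C - A))"
    by (metis vs2.span_insert_0 vs2.span_mono)
  finally have "vs2.dim (f ` W) = card (f ` (C - A))"
    using C(2) ind by (intro vs2.basis_card_eq_dim[symmetric]) auto
  also have "\<dots> = card (C - A)"
    using inj by (intro card_image) (meson inj_on_subset vs1.span_superset)
  finally have "vs2.dim (f ` W) = card C - card A"
    using C(1) finC by (simp add: card_Diff_subset finite_subset)
  moreover have "vs1.dim W = card C" using C by (intro vs1.basis_card_eq_dim[symmetric]) auto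
  moreover have "vs1.dim N = card A" using A by (intro vs1.basis_card_eq_dim[symmetric]) auto
  moreover have "card A \<le> card C" using C(1) finC by (rule card_mono[rotated])
  ultimately show ?thesis by (simp add: N_def)
qed

lemma dim_inj_image:
  assumes f: "Vector_Spaces.linear s1 s2 f"
    and W: "vs1.subspace W" "W \<subseteq> vs1.span B" "finite B"
    and "\<And>w. w \<in> W \<Longrightarrow> f w = 0 \<Longrightarrow> w = 0"
  shows "vs2.dim (f ` W) = vs1.dim W"
proof -
  have "f 0 = 0"
    using f by (rule linear_0)
  hence "{w \<in> W. f w = 0} = {0}"
    using assms vs1.subspace_0 by auto
  moreover have "vs1.dim {0} = 0"
    by (metis card.empty vs1.dim_span_eq_card_independent vs1.independent_empty vs1.span_empty)
  ultimately show ?thesis using rank_nullity[OF f W] by simp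
qed

end

context vector_space
begin

text \<open>Dimension is the cardinality of a basis and would be 0 for an infinite one; hence the
  finite spanning set.\<close>

lemma dim_subspace_le:
  assumes "V \<subseteq> W" "W \<subseteq> span B" "finite B"
  shows "dim V \<le> dim W"
proof -
  obtain A where A: "A \<subseteq> V" "independent A" "V \<subseteq> span A"
    using maximal_independent_subset by blast
  obtain C where C: "A \<subseteq> C" "C \<subseteq> W" "independent C" "W \<subseteq> span C"
    using maximal_independent_subset_extend[of A W] A assms(1) by blast
  have "finite C" using independent_span_bound[OF assms(3) C(3)] C(2) assms(2) by blast
  hence "card A \<le> card C" using C(1) by (rule card_mono)
  thus ?thesis using A C by (metis basis_card_eq_dim)
qed

text \<open>Turns an equality of dimensions into surjectivity of the restriction to
  \<open>z = 0\<close>.\<close>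

lemma subspace_eq_if_dim_le:
  assumes "subspace V" "V \<subseteq> W" "W \<subseteq> span B" "finite B" "dim W \<le> dim V"
  shows "V = W"
proof -
  obtain A where A: "A \<subseteq> V" "independent A" "V \<subseteq> span A"
    using maximal_independent_subset by blast
  obtain C where C: "A \<subseteq> C" "C \<subseteq> W" "independent C" "W \<subseteq> span C"
    using maximal_independent_subset_extend[of A W] A assms(2) by blast
  have fin: "finite C" using independent_span_bound[OF assms(4) C(3)] C(2) assms(3) by blast
  have "card C \<le> card A" using A C assms(5) by (metis basis_card_eq_dim)
  hence "A = C" using C(1) fin by (metis card_seteq)
  hence "W \<subseteq> span V" using C A(1) span_mono by blast
  thus ?thesis using assms(1,2) by (metis span_eq_iff subset_antisym)
qed

end

subsection \<open>Polynomials in two variables and total degree\<close>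

text \<open>\<open>coeff (coeff f i) j\<close> belongs to \<open>x^i z^j\<close>. These are the
  homogeneous polynomials of degree \<open>k\<close> in \<open>x, y, z\<close>, dehomogenized at
  \<open>y = 1\<close>.\<close>

definition bideg_le :: "nat \<Rightarrow> 'a::zero poly poly \<Rightarrow> bool" where
  "bideg_le k f \<longleftrightarrow> (\<forall>i j. k < i + j \<longrightarrow> coeff (coeff f i) j = 0)"

lemma bideg_leD: "bideg_le k f \<Longrightarrow> k < i + j \<Longrightarrow> coeff (coeff f i) j = 0"
  by (auto simp: bideg_le_def)

lemma bideg_le_0 [simp]: "bideg_le k 0"
  by (simp add: bideg_le_def)

lemma bideg_le_add: "bideg_le k f \<Longrightarrow> bideg_le k g \<Longrightarrow> bideg_le k (f + g)"
  for f :: "'a::comm_monoid_add poly poly"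
  by (simp add: bideg_le_def)

lemma bideg_le_diff: "bideg_le k f \<Longrightarrow> bideg_le k g \<Longrightarrow> bideg_le k (f - g)"
  for f :: "'a::ab_group_add poly poly"
  by (simp add: bideg_le_def)

lemma bideg_le_smult_const: "bideg_le k f \<Longrightarrow> bideg_le k (smult [:c:] f)"
  for f :: "'a::comm_ring_1 poly poly"
  by (simp add: bideg_le_def)

lemma bideg_le_mono: "bideg_le k f \<Longrightarrow> k \<le> l \<Longrightarrow> bideg_le l f"
  by (simp add: bideg_le_def)

lemma bideg_le_mult:
  fixes f g :: "'a::comm_ring_1 poly poly"
  assumes "bideg_le k f" "bideg_le l g"
  shows "bideg_le (k + l) (f * g)"
proof -
  have "coeff (coeff f a * coeff g (i - a)) j = 0" if "k + l < i + j" "a \<le> i" for i j a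
    unfolding coeff_mult
  proof (rule sum.neutral, safe)
    fix b assume "b \<le> j"
    have "k < a + b \<or> l < (i - a) + (j - b)" using that \<open>b \<le> j\<close> by linarith
    thus "coeff (coeff f a) b * coeff (coeff g (i - a)) (j - b) = 0"
      using assms by (auto simp: bideg_le_def)
  qed
  thus ?thesis
    by (auto simp: bideg_le_def coeff_mult[of f g] coeff_sum intro!: sum.neutral)
qed

lemma bideg_le_degree_coeff: "bideg_le k f \<Longrightarrow> degree (coeff f i) \<le> k - i"
  by (auto simp: bideg_le_def intro!: degree_le)

lemma bideg_le_degree: "bideg_le k f \<Longrightarrow> degree f \<le> k"
  by (auto simp: bideg_le_def poly_eq_iff intro!: degree_le)

text \<open>The divisor is monic in \<open>x\<close> and of total degree one, so each coefficient of
  \<open>q\<close> comes from the product and the next higher coefficient of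
  \<open>q\<close>.\<close>

lemma bideg_le_quotient:
  fixes q :: "'a::comm_ring_1 poly poly"
  assumes "bideg_le k ([:- [:p, c:], 1:] * q)" "k \<le> i + j"
  shows "coeff (coeff q i) j = 0"
proof -
  \<comment> \<open>Downward induction on \<open>i\<close>: \<open>m\<close> is its distance from
    \<open>Suc (degree q)\<close>, where the coefficient of \<open>q\<close> is 0.\<close>
  have "k \<le> i + j \<Longrightarrow> coeff (coeff q i) j = 0" if "m + i = Suc (degree q)" for m j i
    using that
  proof (induction m arbitrary: i j)
    case 0
    thus ?case by (simp add: coeff_eq_0)
  next
    case (Suc m)
    have "coeff ([:- a, 1:] * q) (Suc i) = coeff q i - a * coeff q (Suc i)" for a
      by simp
    hence "coeff ([:- [:p, c:], 1:] * q) (Suc i) = coeff q i - [:p, c:] * coeff q (Suc i)" .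
    moreover have "coeff (coeff ([:- [:p, c:], 1:] * q) (Suc i)) j = 0"
      by (rule bideg_leD[OF assms(1)]) (use Suc.prems in linarith)
    moreover have "coeff ([:p, c:] * coeff q (Suc i)) j = 0"
      using Suc.IH[of "Suc i" j] Suc.IH[of "Suc i" "j - 1"] Suc.prems
      by (cases j) (auto simp: mult_pCons_left coeff_pCons)
    ultimately show ?case by (metis coeff_0 coeff_diff diff_zero)
  qed
  from this[of "Suc (degree q) - i" i j] assms(2) show ?thesis
    by (cases "i \<le> Suc (degree q)") (auto simp: coeff_eq_0)
qed

text \<open>The substituted polynomial has degree at most one in \<open>z\<close>, so total degree
  bounds the degree in \<open>z\<close>.\<close>

lemma degree_poly_bideg_le:
  fixes f :: "'a::comm_ring_1 poly poly"
  assumes "bideg_le k f"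
  shows "degree (poly f [:p, c:]) \<le> k"
proof -
  have "degree (coeff f i * [:p, c:] ^ i) \<le> k" if "i \<le> degree f" for i
  proof -
    have "degree (coeff f i * [:p, c:] ^ i) \<le> (k - i) + 1 * i"
    proof (intro order_trans[OF degree_mult_le] add_mono bideg_le_degree_coeff[OF assms])
      have "degree [:p, c:] * i \<le> 1 * i" by (intro mult_right_mono) auto
      thus "degree ([:p, c:] ^ i) \<le> 1 * i" using degree_power_le[of "[:p, c:]" i] by linarith
    qed
    thus ?thesis using that bideg_le_degree[OF assms] by simp
  qed
  thus ?thesis unfolding poly_altdef by (intro degree_sum_le) auto
qed

section \<open>Restriction to the line \<open>z = 0\<close>\<close>

definition at0 :: "'a::comm_ring_1 poly poly \<Rightarrow> 'a poly" where
  "at0 f = map_poly (\<lambda>q. coeff q 0) f"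

lemma coeff_at0 [simp]: "coeff (at0 f) i = coeff (coeff f i) 0"
  by (simp add: at0_def coeff_map_poly)

lemma at0_0 [simp]: "at0 0 = 0"
  by (simp add: poly_eq_iff)

lemma at0_add [simp]: "at0 (f + g) = at0 f + at0 g"
  by (simp add: poly_eq_iff)

lemma at0_diff [simp]: "at0 (f - g) = at0 f - at0 g"
  by (simp add: poly_eq_iff)

lemma at0_mult [simp]: "at0 (f * g) = at0 f * at0 g"
  by (simp add: poly_eq_iff coeff_mult coeff_sum)

lemma at0_smult [simp]: "at0 (smult q f) = smult (coeff q 0) (at0 f)"
  by (simp add: poly_eq_iff coeff_mult)

lemma at0_1 [simp]: "at0 1 = 1"
  by (simp add: at0_def map_poly_1)

lemma at0_prod [simp]: "at0 (\<Prod>i\<in>A. f i) = (\<Prod>i\<in>A. at0 (f i))"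
  by (induction A rule: infinite_finite_induct) auto

lemma at0_pCons [simp]: "at0 (pCons q f) = pCons (coeff q 0) (at0 f)"
  by (simp add: poly_eq_iff coeff_pCons split: nat.splits)

lemma degree_at0: "bideg_le k f \<Longrightarrow> degree (at0 f) \<le> k"
  by (auto simp: bideg_le_def intro!: degree_le)

text \<open>A section of \<open>at0\<close>: polynomials on \<open>z = 0\<close> are extended
  constantly in \<open>z\<close>.\<close>

definition lift0 :: "'a::comm_ring_1 poly \<Rightarrow> 'a poly poly" where
  "lift0 f = map_poly (\<lambda>c. [:c:]) f"

lemma coeff_lift0 [simp]: "coeff (lift0 f) i = [:coeff f i:]"
  by (simp add: lift0_def coeff_map_poly)

lemma at0_lift0 [simp]: "at0 (lift0 f) = f"
  by (simp add: poly_eq_iff)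

lemma lift0_add [simp]: "lift0 (a + b) = lift0 a + lift0 b"
  by (simp add: poly_eq_iff)

lemma lift0_0 [simp]: "lift0 0 = 0"
  by (simp add: poly_eq_iff)

lemma bideg_le_lift0: "degree f \<le> k \<Longrightarrow> bideg_le k (lift0 f)"
  by (auto simp: bideg_le_def coeff_pCons coeff_eq_0 split: nat.splits)

text \<open>Shifting every coefficient divides by \<open>z\<close>. The last conclusion covers
  degree 0, where a quotient would have negative degree.\<close>

lemma at0_eq_0_imp:
  assumes "at0 f = 0"
  obtains f' where "f = smult [:0, 1:] f'" "\<And>k. bideg_le (Suc k) f \<Longrightarrow> bideg_le k f'" 
    "bideg_le 0 f \<Longrightarrow> f = 0"
proof
  define f' where "f' = map_poly (poly_shift 1) f"
  have 0: "coeff (coeff f i) 0 = 0" for i using assms by (metis coeff_at0 coeff_0)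
  have co: "coeff (coeff f' i) j = coeff (coeff f i) (Suc j)" for i j
    by (simp add: f'_def coeff_map_poly coeff_poly_shift)
  show "f = smult [:0, 1:] f'"
    by (intro poly_eqI) (simp add: coeff_pCons co 0 split: nat.splits)
  show "bideg_le k f'" if "bideg_le (Suc k) f" for k
    using that by (auto simp: bideg_le_def co)
  show "f = 0" if "bideg_le 0 f"
    using that 0 by (intro poly_eqI) (metis add_gr_0 bideg_le_def coeff_0 not_gr_zero)
qed

lemma bideg_le_smult_var: "bideg_le k f \<Longrightarrow> bideg_le (Suc k) (smult [:0, 1:] f)"
  by (auto simp: bideg_le_def coeff_pCons split: nat.splits)

text \<open>Applied over the domain \<open>K[z]\<close>: evaluation at \<open>a j\<close> leaves the
  nonzero factor \<open>a j - a i\<close>, so the cofactor vanishes at \<open>a j\<close>.\<close>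

lemma prod_roots_dvd:
  fixes E :: "'a::idom poly"
  assumes "finite J" "inj_on a J" "\<And>j. j \<in> J \<Longrightarrow> poly E (a j) = 0"
  shows "(\<Prod>j\<in>J. [:- a j, 1:]) dvd E"
  using assms
proof (induction J arbitrary: E)
  case (insert i J)
  obtain E' where E: "E = [:- a i, 1:] * E'"
    using insert.prems(2)[of i] by (auto simp: poly_eq_0_iff_dvd)
  have "poly E' (a j) = 0" if "j \<in> J" for j
  proof -
    have "a j \<noteq> a i" using insert that by (auto simp: inj_on_def)
    thus ?thesis using insert.prems(2)[of j] that by (auto simp: E)
  qed
  hence "(\<Prod>j\<in>J. [:- a j, 1:]) dvd E'" using insert by auto
  moreover have "(\<Prod>j\<in>insert i J. [:- a j, 1:]) = [:- a i, 1:] * (\<Prod>j\<in>J. [:- a j, 1:])"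
    using insert.hyps by (rule prod.insert)
  ultimately show ?case unfolding E by (simp only: mult_dvd_mono dvd_refl)
qed auto

lemma prod_powers_dvd:
  fixes q :: "'a::idom poly"
  assumes "finite Z" "\<And>z. z \<in> Z \<Longrightarrow> [:- z, 1:] ^ e z dvd q"
  shows "(\<Prod>z\<in>Z. [:- z, 1:] ^ e z) dvd q"
  using assms
proof (induction Z)
  case (insert x Z)
  obtain r where r: "q = (\<Prod>z\<in>Z. [:- z, 1:] ^ e z) * r" using insert by auto
  \<comment> \<open>The product over the other roots has order 0 at \<open>x\<close>, so the whole
    power must divide the cofactor.\<close>
  have "poly (\<Prod>z\<in>Z. [:- z, 1:] ^ e z) x \<noteq> 0"
    using insert.hyps by (auto simp: poly_prod)
  hence "order x (\<Prod>z\<in>Z. [:- z, 1:] ^ e z) = 0" by (rule order_0I)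
  hence "[:- x, 1:] ^ e x dvd r"
    using insert.prems[of x] \<open>poly _ x \<noteq> 0\<close>
    by (cases "q = 0") (auto simp: order_divides order_mult r)
  thus ?case using insert.hyps by (simp add: r mult.commute[of "[:- x, 1:] ^ e x"] mult_dvd_mono)
qed auto

lemma degree_prod_powers:
  fixes e :: "'a::idom \<Rightarrow> nat"
  shows "degree (\<Prod>z\<in>Z. [:- z, 1:] ^ e z) = (\<Sum>z\<in>Z. e z)"
  by (subst degree_prod_eq_sum_degree) (auto simp: degree_power_eq)

subsection \<open>Dehomogenized logarithmic derivations\<close>

definition scale_pair :: "'k::field \<Rightarrow> 'k \<times> 'k \<Rightarrow> 'k \<times> 'k" where
  "scale_pair c = map_prod ((*) c) ((*) c)"

definition scale_poly_pair :: "'k::field \<Rightarrow> 'k poly \<times> 'k poly \<Rightarrow> 'k poly \<times> 'k poly" where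
  "scale_poly_pair c = map_prod (smult c) (smult c)"

definition scale_poly2_pair ::
    "'k::field \<Rightarrow> 'k poly poly \<times> 'k poly poly \<Rightarrow> 'k poly poly \<times> 'k poly poly" where
  "scale_poly2_pair c = map_prod (smult [:c:]) (smult [:c:])"

global_interpretation vs0: vector_space scale_pair
  by unfold_locales (auto simp: scale_pair_def algebra_simps)

global_interpretation vsp: vector_space "smult :: 'k::field \<Rightarrow> _"
  by unfold_locales (auto simp: smult_add_left smult_add_right)

global_interpretation vs1: vector_space scale_poly_pair
  by unfold_locales (auto simp: scale_poly_pair_def smult_add_left smult_add_right)

global_interpretation vs2: vector_space scale_poly2_pair
  by unfold_locales
    (auto simp: scale_poly2_pair_def smult_add_left smult_add_right mult.commute
      simp flip: one_pCons smult_add_left[of "[:_:]" "[:_:]", simplified])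

global_interpretation vs10: vector_space_pair scale_poly_pair scale_pair ..
global_interpretation vs21: vector_space_pair scale_poly2_pair scale_poly_pair ..
global_interpretation vs22: vector_space_pair scale_poly2_pair scale_poly2_pair ..
global_interpretation vs2p: vector_space_pair scale_poly2_pair smult ..

text \<open>Finite spanning sets, so that \<open>dim\<close> never takes its junk value on the spaces below.\<close>

definition mons1 :: "nat \<Rightarrow> ('k::field poly \<times> 'k poly) set" where
  "mons1 k = (\<lambda>i. (monom 1 i, 0)) ` {..k} \<union> (\<lambda>i. (0, monom 1 i)) ` {..k}"

lemma finite_mons1: "finite (mons1 k)"
  by (simp add: mons1_def)

lemma span_mons1:
  assumes "degree f \<le> k" "degree g \<le> k"
  shows "(f, g) \<in> vs1.span (mons1 k)"
proof -
  have sums: "f = (\<Sum>i\<le>k. smult (coeff f i) (monom 1 i))" "g = (\<Sum>i\<le>k. smult (coeff g i) (monom 1 i))"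
    using assms by (simp_all add: smult_monom poly_as_sum_of_monoms')
  have "(f, g) = (\<Sum>i\<le>k. scale_poly_pair (coeff f i) (monom 1 i, 0))
      + (\<Sum>i\<le>k. scale_poly_pair (coeff g i) (0, monom 1 i))"
    by (subst (1) sums(1), subst (1) sums(2)) (simp add: prod_eq_iff fst_sum snd_sum scale_poly_pair_def)
  also have "\<dots> \<in> vs1.span (mons1 k)"
    by (intro vs1.span_add vs1.span_sum vs1.span_scale vs1.span_base) (auto simp: mons1_def)
  finally show ?thesis .
qed

definition mons2 :: "nat \<Rightarrow> ('k::field poly poly \<times> 'k poly poly) set" where
  "mons2 k = (\<lambda>(i, j). (monom (monom 1 j) i, 0)) ` ({..k} \<times> {..k})
     \<union> (\<lambda>(i, j). (0, monom (monom 1 j) i)) ` ({..k} \<times> {..k})"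

lemma finite_mons2: "finite (mons2 k)"
  by (simp add: mons2_def)

lemma bideg_le_sum_monoms:
  fixes f :: "'k::field poly poly"
  assumes "bideg_le k f"
  shows "f = (\<Sum>i\<le>k. \<Sum>j\<le>k. smult [:coeff (coeff f i) j:] (monom (monom 1 j) i))"
proof -
  have "coeff f i = (\<Sum>j\<le>k. smult (coeff (coeff f i) j) (monom 1 j))" for i
    using bideg_le_degree_coeff[OF assms, of i]
    by (simp add: smult_monom poly_as_sum_of_monoms')
  hence "(\<Sum>j\<le>k. smult [:coeff (coeff f i) j:] (monom (monom 1 j) i)) = monom (coeff f i) i" for i
    by (simp add: smult_monom flip: monom_sum)
  thus ?thesis
    using bideg_le_degree[OF assms] by (simp add: poly_as_sum_of_monoms')
qed

lemma span_mons2: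
  assumes "bideg_le k f" "bideg_le k g"
  shows "(f, g) \<in> vs2.span (mons2 k)"
proof -
  have "(f, g) = (\<Sum>i\<le>k. \<Sum>j\<le>k. scale_poly2_pair (coeff (coeff f i) j) (monom (monom 1 j) i, 0))
      + (\<Sum>i\<le>k. \<Sum>j\<le>k. scale_poly2_pair (coeff (coeff g i) j) (0, monom (monom 1 j) i))"
    by (subst (1) bideg_le_sum_monoms[OF assms(1)], subst (1) bideg_le_sum_monoms[OF assms(2)])
      (simp add: prod_eq_iff fst_sum snd_sum scale_poly2_pair_def)
  also have "\<dots> \<in> vs2.span (mons2 k)"
    by (intro vs2.span_add vs2.span_sum vs2.span_scale vs2.span_base) (auto simp: mons2_def)
  finally show ?thesis .
qed

locale affine_lines =
  fixes p c :: "'i \<Rightarrow> 'k::field_char_0"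
begin

text \<open>
  The pair \<open>(f, g)\<close> stands for the derivation \<open>f \<partial>\<^sub>x + g \<partial>\<^sub>y\<close>, homogeneous of degree \<open>k\<close> and dehomogenized
  at \<open>y = 1\<close>; polynomials in \<open>x\<close> have coefficients in \<open>K[z]\<close>. The \<open>i\<close>-th line is
  \<open>x - p\<^sub>i y + c\<^sub>i z = 0\<close>, and \<open>z = 0\<close> is a further line of the arrangement.
\<close>

definition dlog :: "'i set \<Rightarrow> nat \<Rightarrow> ('k poly poly \<times> 'k poly poly) set" where
  "dlog J k = {(f, g). bideg_le k f \<and> bideg_le k g \<and>
     (\<forall>i\<in>J. poly f [:p i, - c i:] = [:p i:] * poly g [:p i, - c i:])}"

text \<open>Line \<open>i\<close> meets \<open>z = 0\<close> in the point \<open>x = p i\<close>,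
  and the exponent counts the lines through it: these are the logarithmic derivations of the Ziegler
  restriction.\<close>

definition mlog :: "'i set \<Rightarrow> nat \<Rightarrow> ('k poly \<times> 'k poly) set" where
  "mlog J k = {(f, g). degree f \<le> k \<and> degree g \<le> k \<and>
     (\<forall>i\<in>J. [:- p i, 1:] ^ card {j \<in> J. p j = p i} dvd f - smult (p i) g)}"

definition at0_pair :: "'k poly poly \<times> 'k poly poly \<Rightarrow> 'k poly \<times> 'k poly" where
  "at0_pair = map_prod at0 at0"

text \<open>In degree \<open>i\<close> this is the value at the point \<open>x = 1, y = 0\<close> of
  the line \<open>z = 0\<close>.\<close>

definition lead_pair :: "nat \<Rightarrow> 'k poly \<times> 'k poly \<Rightarrow> 'k \<times> 'k" where
  "lead_pair i = map_prod (\<lambda>f. coeff f i) (\<lambda>g. coeff g i)"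

text \<open>The parameters \<open>z\<close> at which line \<open>i\<close> meets the lines of
  \<open>J\<close>; the value 0 is its meeting with \<open>z = 0\<close>.\<close>

definition line_points :: "'i \<Rightarrow> 'i set \<Rightarrow> 'k set" where
  "line_points i J = insert 0 ((\<lambda>j. (p i - p j) / (c i - c j)) ` J)"

lemma subspace_dlog: "vs2.subspace (dlog J k)"
  unfolding vs2.subspace_def dlog_def scale_poly2_pair_def
  by (auto simp: bideg_le_add bideg_le_smult_const zero_prod_def algebra_simps)

lemma subspace_mlog: "vs1.subspace (mlog J k)"
proof -
  have "d dvd (f + f') - smult a (g + g')" if "d dvd f - smult a g" "d dvd f' - smult a g'"
    for d f f' g g' :: "'k poly" and a
    using dvd_add[OF that] by (simp add: algebra_simps smult_add_right)
  moreover have "d dvd smult b f - smult a (smult b g)" if "d dvd f - smult a g"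
    for d f g :: "'k poly" and a b
    using dvd_smult[OF that, of b] by (simp add: smult_diff_right mult.commute)
  ultimately show ?thesis
    unfolding vs1.subspace_def mlog_def scale_poly_pair_def zero_prod_def
    by (auto intro: degree_add_le order_trans[OF degree_smult_le])
qed

lemma dlog_span: "dlog J k \<subseteq> vs2.span (mons2 k)"
  by (auto simp: dlog_def intro: span_mons2)

lemma mlog_span: "mlog J k \<subseteq> vs1.span (mons1 k)"
  by (auto simp: mlog_def intro: span_mons1)

text \<open>
  The points of the \<open>i\<close>-th line are parametrized by \<open>z\<close>. Let \<open>\<alpha>\<close> be its form and \<open>h\<close> the value of the derivation
  on \<open>\<alpha>\<close>. For \<open>\<zeta> \<noteq> 0\<close> the combination \<open>(\<zeta> - z) h - \<zeta> g \<alpha>\<close> vanishes on every other line through the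
  point \<open>z = \<zeta>\<close>; restricting it to the \<open>i\<close>-th line leaves \<open>(\<zeta> - z) h\<close>, which costs one factor.
  At \<open>z = 0\<close> no factor is lost, because the line \<open>z = 0\<close> also passes through the point.
\<close>

lemma point_factor:
  assumes "inj_on c (insert i J)" "i \<notin> J" "(f, g) \<in> dlog J k"
  shows "[:- \<zeta>, 1:] ^ (card {j \<in> J. p i - p j = \<zeta> * (c i - c j)} - (if \<zeta> = 0 then 0 else 1))
    dvd poly f [:p i, - c i:] - [:p i:] * poly g [:p i, - c i:]"
proof (cases "finite {j \<in> J. p i - p j = \<zeta> * (c i - c j)}")
  case False
  thus ?thesis by simp
next
  case fin: True
  define J' where "J' = {j \<in> J. p i - p j = \<zeta> * (c i - c j)}"
  define a where "a j = [:p j, - c j:]" for j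
  define h where "h = f - smult [:p i:] g"
  define E where "E = (if \<zeta> = 0 then h
     else smult [:\<zeta>, - 1:] h - smult [:\<zeta>:] (g * [:- a i, 1:]))"
  \<comment> \<open>Restricted to line \<open>i\<close>, the form of a line through the point
    \<open>z = \<zeta>\<close> is a multiple of \<open>z - \<zeta>\<close>.\<close>
  have ai: "a i - a j = smult (- (c i - c j)) [:- \<zeta>, 1:]" if "j \<in> J'" for j
    using that by (simp add: a_def J'_def algebra_simps)
  have pj: "p j = p i - \<zeta> * (c i - c j)" if "j \<in> J'" for j
    using that by (simp add: J'_def algebra_simps)
  have "poly E (a j) = 0" if j: "j \<in> J'" for j
  proof -
    have f: "poly f (a j) = [:p j:] * poly g (a j)"
      using assms(3) j by (auto simp: dlog_def J'_def a_def)
    have "poly h (a j) = [:p j - p i:] * poly g (a j)"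
      by (simp add: h_def f flip: smult_diff_left)
    hence h: "poly h (a j) = [:- (\<zeta> * (c i - c j)):] * poly g (a j)"
      by (simp add: pj[OF j])
    show ?thesis
    proof (cases "\<zeta> = 0")
      case True
      thus ?thesis by (simp add: E_def h)
    next
      case False
      have sgn: "A - B * (C * (x - y)) = A + B * (C * (y - x))" for A B C x y :: "'k poly"
        by (simp add: algebra_simps)
      have dist: "A * (B * G) + C * (G * D) = G * (A * B + C * D)" for A B C D G :: "'k poly"
        by (simp add: algebra_simps)
      have lin: "poly [:- x, 1:] y = y - x" for x y :: "'k poly" by simp
      have "poly E (a j) = [:\<zeta>, - 1:] * ([:- (\<zeta> * (c i - c j)):] * poly g (a j))
          - [:\<zeta>:] * (poly g (a j) * (a j - a i))"
        using False by (simp only: E_def h if_False poly_diff poly_smult poly_mult lin)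
      also have "\<dots> = [:\<zeta>, - 1:] * ([:- (\<zeta> * (c i - c j)):] * poly g (a j))
          + [:\<zeta>:] * (poly g (a j) * (a i - a j))"
        by (rule sgn)
      also have "\<dots> = poly g (a j) * ([:\<zeta>, - 1:] * [:- (\<zeta> * (c i - c j)):]
          + [:\<zeta>:] * smult (- (c i - c j)) [:- \<zeta>, 1:])"
        unfolding ai[OF j] by (rule dist)
      also have "[:\<zeta>, - 1:] * [:- (\<zeta> * (c i - c j)):]
          + [:\<zeta>:] * smult (- (c i - c j)) [:- \<zeta>, 1:] = 0"
        by (simp add: algebra_simps)
      finally show ?thesis by simp
    qed
  qed
  moreover have "inj_on a J'"
    using assms(1) by (auto simp: inj_on_def a_def J'_def)
  \<comment> \<open>The \<open>a j\<close> are roots of \<open>E\<close> over \<open>K[z]\<close>,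
    distinct because the \<open>c j\<close> are.\<close>
  ultimately have "(\<Prod>j\<in>J'. [:- a j, 1:]) dvd E"
    using fin by (intro prod_roots_dvd) (auto simp: J'_def)
  hence "poly (\<Prod>j\<in>J'. [:- a j, 1:]) (a i) dvd poly E (a i)"
    by (auto simp: dvd_def)
  moreover have "poly (\<Prod>j\<in>J'. [:- a j, 1:]) (a i) = (\<Prod>j\<in>J'. a i - a j)"
    by (simp add: poly_prod)
  moreover have "\<dots> = smult (\<Prod>j\<in>J'. - (c i - c j)) ([:- \<zeta>, 1:] ^ card J')"
    by (simp only: ai prod_smult prod_constant cong: prod.cong)
  ultimately have "smult (\<Prod>j\<in>J'. - (c i - c j)) ([:- \<zeta>, 1:] ^ card J') dvd poly E (a i)"
    by (simp only:)
  hence dvd: "[:- \<zeta>, 1:] ^ card J' dvd poly E (a i)"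
    by (rule smult_dvd_cancel)
  show ?thesis
  proof (cases "\<zeta> = 0")
    case True
    thus ?thesis using dvd by (simp add: E_def h_def a_def J'_def)
  next
    case False
    \<comment> \<open>The term with \<open>g\<close> contains the form of line \<open>i\<close> and
      vanishes on that line.\<close>
    have "poly E (a i) = - ([:- \<zeta>, 1:] * poly h (a i))"
      using False by (simp add: E_def)
    hence d: "[:- \<zeta>, 1:] ^ card J' dvd [:- \<zeta>, 1:] * poly h (a i)"
      using dvd by (simp only: dvd_minus_iff)
    have "[:- \<zeta>, 1:] ^ (card J' - 1) dvd poly h (a i)"
    proof (cases "card J'")
      case (Suc m)
      thus ?thesis using d by (simp del: mult_pCons_left)
    qed auto
    thus ?thesis using False by (simp add: h_def a_def J'_def)
  qed
qed

text \<open>The map \<open>\<phi>\<close> evaluates a derivation on the new form, restricted to the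
  new line. Its kernel is the space for \<open>insert i J\<close>, and its image consists of
  multiples of Terao's polynomial \<open>B\<close> of degree at most \<open>k\<close>.\<close>

lemma dim_dlog_insert:
  assumes J: "finite J" "inj_on c (insert i J)" "i \<notin> J" "card J \<le> k"
  shows "vs2.dim (dlog J k) + card J \<le> vs2.dim (dlog (insert i J) k) + k + card (line_points i J)"
proof -
  define Z where "Z = line_points i J"
  define m where "m \<zeta> = card {j \<in> J. p i - p j = \<zeta> * (c i - c j)}" for \<zeta>
  define e where "e \<zeta> = m \<zeta> - (if \<zeta> = 0 then 0 else 1)" for \<zeta>
  define B where "B = (\<Prod>\<zeta>\<in>Z. [:- \<zeta>, 1:] ^ e \<zeta>)"
  define \<phi> where "\<phi> = (\<lambda>(f, g). poly f [:p i, - c i:] - [:p i:] * poly g [:p i, - c i:])"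
  have ne: "c i - c j \<noteq> 0" if "j \<in> J" for j
    using J(2,3) that by (auto simp: inj_on_def)
  have finZ: "finite Z" using J by (simp add: Z_def line_points_def)
  have iff: "p i - p j = \<zeta> * (c i - c j) \<longleftrightarrow> (p i - p j) / (c i - c j) = \<zeta>" if "j \<in> J" for j \<zeta>
    using ne[OF that] by (simp add: field_simps)
  have m: "m \<zeta> = card {j \<in> J. (p i - p j) / (c i - c j) = \<zeta>}" for \<zeta>
    unfolding m_def using iff by (intro arg_cong[where f = card]) auto
  have summ: "(\<Sum>\<zeta>\<in>Z. m \<zeta>) = card J"
  proof -
    have "(\<Sum>\<zeta>\<in>Z. m \<zeta>) = (\<Sum>\<zeta>\<in>Z. \<Sum>j\<in>{j \<in> J. (p i - p j) / (c i - c j) = \<zeta>}. 1)"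
      by (simp add: m)
    also have "\<dots> = (\<Sum>j\<in>J. 1)"
      using J(1) finZ by (intro sum.group) (auto simp: Z_def line_points_def)
    finally show ?thesis by simp
  qed
  \<comment> \<open>This makes the subtraction in \<open>e\<close> exact on
    \<open>Z\<close>.\<close>
  have pos: "m \<zeta> \<ge> 1" if "\<zeta> \<in> Z" "\<zeta> \<noteq> 0" for \<zeta>
  proof -
    have "{j \<in> J. (p i - p j) / (c i - c j) = \<zeta>} \<noteq> {}"
      using that by (auto simp: Z_def line_points_def)
    thus ?thesis unfolding m using J(1) by (simp add: Suc_le_eq card_gt_0_iff)
  qed
  have "(\<Sum>\<zeta>\<in>Z. e \<zeta>) + card (Z - {0}) = (\<Sum>\<zeta>\<in>Z. m \<zeta>)"
  proof -
    have "card (Z - {0}) = (\<Sum>\<zeta>\<in>Z. if \<zeta> = 0 then 0 else 1)"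
      using finZ by (simp add: sum.If_cases Int_def Diff_eq)
    hence "(\<Sum>\<zeta>\<in>Z. e \<zeta>) + card (Z - {0}) = (\<Sum>\<zeta>\<in>Z. e \<zeta> + (if \<zeta> = 0 then 0 else 1))"
      by (simp add: sum.distrib)
    also have "\<dots> = (\<Sum>\<zeta>\<in>Z. m \<zeta>)"
      using pos by (intro sum.cong) (auto simp: e_def)
    finally show ?thesis .
  qed
  \<comment> \<open>0 belongs to \<open>Z\<close> and is the only point that loses no
    factor.\<close>
  moreover have "card Z = Suc (card (Z - {0}))"
    using finZ by (intro card.remove) (auto simp: Z_def line_points_def)
  moreover have degB: "degree B = (\<Sum>\<zeta>\<in>Z. e \<zeta>)"
    by (simp add: B_def degree_prod_powers)
  ultimately have deg: "degree B + card Z = card J + 1"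
    using summ by simp
  have cardZ: "card Z \<ge> 1" using \<open>card Z = _\<close> by simp
  have B0: "B \<noteq> 0" using finZ by (auto simp: B_def)
  have lin: "Vector_Spaces.linear scale_poly2_pair smult \<phi>"
    by unfold_locales
      (auto simp: \<phi>_def scale_poly2_pair_def algebra_simps smult_add_right smult_diff_right)
  have img: "\<phi> ` dlog J k \<subseteq> vsp.span ((\<lambda>j. B * monom 1 j) ` {..<k + 1 - degree B})"
  proof safe
    fix f g assume fg: "(f, g) \<in> dlog J k"
    have "B dvd \<phi> (f, g)"
      unfolding B_def \<phi>_def split e_def m_def
      using finZ point_factor[OF J(2,3) fg] by (intro prod_powers_dvd) auto
    then obtain r where r: "\<phi> (f, g) = B * r" by auto
    have "degree (\<phi> (f, g)) \<le> k"
      using fg by (auto simp: \<phi>_def dlog_def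
          intro!: degree_diff_le degree_poly_bideg_le order_trans[OF degree_smult_le])
    \<comment> \<open>If \<open>degree B\<close> exceeds \<open>k\<close>, the truncated difference
      is 0 and only \<open>r = 0\<close> is left.\<close>
    hence "r = 0 \<or> degree r < k + 1 - degree B"
      using B0 by (cases "r = 0") (auto simp: r degree_mult_eq)
    hence "r = (\<Sum>j<k + 1 - degree B. smult (coeff r j) (monom 1 j))"
    proof
      assume "degree r < k + 1 - degree B"
      then obtain m where m: "k + 1 - degree B = Suc m" "degree r \<le> m"
        by (cases "k + 1 - degree B") auto
      thus ?thesis
        unfolding m lessThan_Suc_atMost by (simp add: smult_monom poly_as_sum_of_monoms')
    qed simp
    hence "\<phi> (f, g) = (\<Sum>j<k + 1 - degree B. smult (coeff r j) (B * monom 1 j))"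
      unfolding r by (metis (no_types, lifting) mult_smult_right sum.cong sum_distrib_left)
    also have "\<dots> \<in> vsp.span ((\<lambda>j. B * monom 1 j) ` {..<k + 1 - degree B})"
      by (intro vsp.span_sum vsp.span_scale vsp.span_base) auto
    finally show "\<phi> (f, g) \<in> \<dots>" .
  qed
  have "vsp.dim (\<phi> ` dlog J k) \<le> card ((\<lambda>j. B * monom 1 j) ` {..<k + 1 - degree B})"
    using img by (rule vsp.dim_le_card) auto
  also have "\<dots> \<le> k + 1 - degree B"
    using card_image_le[of "{..<k + 1 - degree B}"] by simp
  finally have "vsp.dim (\<phi> ` dlog J k) \<le> k + 1 - degree B" .
  moreover have "{w \<in> dlog J k. \<phi> w = 0} = dlog (insert i J) k"
    by (auto simp: dlog_def \<phi>_def)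
  \<comment> \<open>Since \<open>degree B \<le> card J \<le> k\<close>, the difference
    \<open>k + 1 - degree B\<close> is not truncated.\<close>
  ultimately show ?thesis
    using vs2p.rank_nullity[OF lin subspace_dlog dlog_span finite_mons2, of J k] deg cardZ J(4)
    by (simp add: Z_def)
qed

end

subsection \<open>The Wronskian bound\<close>

lemma power_dvd_pderiv:
  fixes h :: "'a::idom poly"
  assumes "[:- x, 1:] ^ m dvd h"
  shows "[:- x, 1:] ^ (m - 1) dvd pderiv h"
proof (cases m)
  case (Suc l)
  obtain r where h: "h = [:- x, 1:] ^ Suc l * r" using assms Suc by auto
  have "pderiv h = [:- x, 1:] ^ l * ([:- x, 1:] * pderiv r + smult (of_nat (Suc l)) (r * pderiv [:- x, 1:]))"
    unfolding h pderiv_mult pderiv_power_Suc by (simp add: algebra_simps)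
  thus ?thesis using Suc by simp
qed auto

definition wronskian :: "'a::idom poly \<Rightarrow> 'a poly \<Rightarrow> 'a poly" where
  "wronskian f g = pderiv f * g - f * pderiv g"

lemma wronskian_diff_smult [simp]: "wronskian (f - smult a g) g = wronskian f g"
  by (simp add: wronskian_def pderiv_diff pderiv_smult algebra_simps)

lemma wronskian_swap: "wronskian f g = - wronskian g f"
  by (simp add: wronskian_def algebra_simps)

text \<open>Subtracting a multiple of \<open>g\<close> from \<open>f\<close> keeps the Wronskian,
  and differentiation costs one factor.\<close>

lemma wronskian_dvd:
  fixes f g :: "'a::idom poly"
  assumes "[:- x, 1:] ^ m dvd f - smult a g"
  shows "[:- x, 1:] ^ (m - 1) dvd wronskian f g"
proof -
  have "[:- x, 1:] ^ (m - 1) dvd f - smult a g"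
    using assms by (meson diff_le_self dvd_trans le_imp_power_dvd)
  hence "[:- x, 1:] ^ (m - 1) dvd wronskian (f - smult a g) g"
    using power_dvd_pderiv[OF assms] unfolding wronskian_def by (intro dvd_diff) simp_all
  thus ?thesis by simp
qed

lemma degree_wronskian_aux:
  fixes f g :: "'a::{idom,semiring_char_0} poly"
  assumes "degree f \<le> e - 1" "degree g \<le> e" "wronskian f g \<noteq> 0"
  shows "degree (wronskian f g) + 2 \<le> 2 * e"
proof -
  \<comment> \<open>For \<open>e = 0\<close> both polynomials are constant and the Wronskian is
    0.\<close>
  have e: "e > 0"
    using assms by (cases e) (auto simp: wronskian_def elim!: degree_eq_zeroE)
  have "degree (pderiv f * g) + 2 \<le> 2 * e" if "pderiv f \<noteq> 0"
  proof -
    have "degree f \<noteq> 0" using that by (auto simp: pderiv_eq_0_iff)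
    thus ?thesis using assms(1,2) degree_mult_le[of "pderiv f" g] by (simp add: degree_pderiv)
  qed
  hence "degree (pderiv f * g) \<le> 2 * e - 2" by (cases "pderiv f = 0") auto
  moreover have "degree (f * pderiv g) \<le> 2 * e - 2"
    using assms(1,2) degree_mult_le[of f "pderiv g"] by (simp add: degree_pderiv)
  ultimately have "degree (wronskian f g) \<le> 2 * e - 2"
    unfolding wronskian_def by (intro degree_diff_le)
  thus ?thesis using e by simp
qed

lemma degree_le_pred: "degree f \<le> e \<Longrightarrow> coeff f e = 0 \<Longrightarrow> degree f \<le> e - 1"
  by (cases "degree f = e") auto

text \<open>The obvious bound is \<open>2 * e - 1\<close>. A constant multiple of \<open>g\<close>
  cancels the top coefficient of \<open>f\<close> without changing the Wronskian, which gains one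
  degree.\<close>

lemma degree_wronskian:
  fixes f g :: "'a::field_char_0 poly"
  assumes "degree f \<le> e" "degree g \<le> e" "wronskian f g \<noteq> 0"
  shows "degree (wronskian f g) + 2 \<le> 2 * e"
proof (cases "coeff g e = 0")
  case True
  hence "degree g \<le> e - 1" using assms(2) by (intro degree_le_pred) auto
  thus ?thesis
    using degree_wronskian_aux[of g e f] assms by (simp add: wronskian_swap[of g f])
next
  case False
  define h where "h = f - smult (coeff f e / coeff g e) g"
  have "degree h \<le> e"
    using assms by (auto simp: h_def intro!: degree_diff_le order_trans[OF degree_smult_le])
  hence "degree h \<le> e - 1" using False by (intro degree_le_pred) (auto simp: h_def)
  thus ?thesis
    using degree_wronskian_aux[of h e g] assms by (simp add: h_def)
qed

text \<open>Comparing leading coefficients in \<open>f' g = f g'\<close> gives equal degrees, as the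
  characteristic is zero.\<close>

lemma wronskian_eq_0_degree:
  fixes f g :: "'a::field_char_0 poly"
  assumes "wronskian f g = 0" "f \<noteq> 0" "g \<noteq> 0"
  shows "degree f = degree g"
proof (cases "degree f = 0 \<or> degree g = 0")
  case True
  thus ?thesis
    using assms pderiv_eq_0_iff[of f] pderiv_eq_0_iff[of g] by (auto simp: wronskian_def)
next
  case False
  have "pderiv f * g = f * pderiv g" using assms by (simp add: wronskian_def)
  hence "lead_coeff (pderiv f) * lead_coeff g = lead_coeff f * lead_coeff (pderiv g)"
    by (metis lead_coeff_mult)
  moreover have "lead_coeff (pderiv h) = of_nat (degree h) * lead_coeff h" if "degree h \<noteq> 0"
    for h :: "'a poly"
    using that by (simp add: degree_pderiv coeff_pderiv del: of_nat_Suc)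
  ultimately show ?thesis using False assms by simp
qed

text \<open>Cancel the top coefficient of \<open>f\<close> against \<open>g\<close>: a nonzero
  remainder \<open>h\<close> would have the degree of \<open>g\<close>, although its coefficient
  there is 0.\<close>

lemma wronskian_eq_0:
  fixes f g :: "'a::field_char_0 poly"
  assumes "wronskian f g = 0"
  shows "g = 0 \<or> (\<exists>a. f = smult a g)"
proof (rule ccontr)
  assume neg: "\<not> ?thesis"
  define h where "h = f - smult (coeff f (degree g) / lead_coeff g) g"
  have f: "f \<noteq> 0" using neg by (auto intro: exI[of _ 0])
  have h: "h \<noteq> 0" using neg by (auto simp: h_def)
  have "degree f = degree g" using assms f neg by (intro wronskian_eq_0_degree) auto
  moreover have "degree h = degree g"
    using assms h neg by (intro wronskian_eq_0_degree) (auto simp: h_def)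
  moreover have "coeff h (degree g) = 0" using neg by (simp add: h_def)
  ultimately show False using h by (metis leading_coeff_0_iff)
qed

lemma coeff_mult_top:
  fixes f g :: "'a::comm_semiring_1 poly"
  assumes "degree f \<le> a" "degree g \<le> b"
  shows "coeff (f * g) (a + b) = coeff f a * coeff g b"
proof -
  have "coeff f i * coeff g (a + b - i) = 0" if "i \<le> a + b" "i \<noteq> a" for i
    using assms that by (cases "i < a") (auto simp: coeff_eq_0)
  hence "coeff (f * g) (a + b) = (\<Sum>i\<in>{a}. coeff f i * coeff g (a + b - i))"
    unfolding coeff_mult by (intro sum.mono_neutral_right) auto
  thus ?thesis by simp
qed

context affine_lines
begin

text \<open>The multiplicity of the Ziegler restriction at the point \<open>\<xi>\<close>.\<close>

definition mult_at :: "'i set \<Rightarrow> 'k \<Rightarrow> nat" where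
  "mult_at J \<xi> = card {j \<in> J. p j = \<xi>}"

lemma sum_mult_at: "finite J \<Longrightarrow> (\<Sum>\<xi>\<in>p ` J. mult_at J \<xi>) = card J"
  using sum.group[of J "p ` J" p "\<lambda>_. 1::nat"] by (simp add: mult_at_def)

lemma mlogD:
  assumes "(f, g) \<in> mlog J k" "\<xi> \<in> p ` J"
  shows "[:- \<xi>, 1:] ^ mult_at J \<xi> dvd f - smult \<xi> g"
  using assms by (auto simp: mlog_def mult_at_def)

lemma mlog_degree_bound:
  assumes J: "finite J" and fg: "(f, g) \<in> mlog J e" "(f, g) \<noteq> 0"
    and bal: "\<And>\<xi>. \<xi> \<in> p ` J \<Longrightarrow> 2 * mult_at J \<xi> \<le> card J"
  shows "card J + 2 \<le> 2 * e + card (p ` J) \<or> card J \<le> 2 * e"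
proof (cases "wronskian f g = 0")
  case False
  have deg: "degree f \<le> e" "degree g \<le> e" using fg by (auto simp: mlog_def)
  have "(\<Prod>\<xi>\<in>p ` J. [:- \<xi>, 1:] ^ (mult_at J \<xi> - 1)) dvd wronskian f g"
    using J wronskian_dvd[OF mlogD[OF fg(1)]] by (intro prod_powers_dvd) auto
  from dvd_imp_degree_le[OF this False]
  have "(\<Sum>\<xi>\<in>p ` J. mult_at J \<xi> - 1) \<le> degree (wronskian f g)"
    unfolding degree_prod_powers .
  moreover have "(\<Sum>\<xi>\<in>p ` J. mult_at J \<xi> - 1) + card (p ` J) = (\<Sum>\<xi>\<in>p ` J. mult_at J \<xi>)"
  proof -
    have pos: "mult_at J \<xi> \<ge> 1" if "\<xi> \<in> p ` J" for \<xi>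
      using that J by (auto simp: mult_at_def Suc_le_eq card_gt_0_iff)
    have "(\<Sum>\<xi>\<in>p ` J. (mult_at J \<xi> - 1) + 1) = (\<Sum>\<xi>\<in>p ` J. mult_at J \<xi>)"
      by (intro sum.cong refl le_add_diff_inverse2 pos)
    thus ?thesis unfolding sum.distrib by simp
  qed
  ultimately show ?thesis
    using degree_wronskian[OF deg False] J by (simp add: sum_mult_at)
next
  case True
  \<comment> \<open>A vanishing Wronskian makes \<open>(f, g)\<close> a polynomial \<open>q\<close>
    times a constant vector \<open>(a, b)\<close>.\<close>
  obtain q a b where q: "f = smult a q" "g = smult b q" "q \<noteq> 0" "(a, b) \<noteq> (0, 0)" "degree q \<le> e"
  proof (cases "g = 0")
    case True
    thus ?thesis using that[of 1 f 0] fg by (auto simp: mlog_def zero_prod_def)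
  next
    case False
    then obtain a where "f = smult a g" using wronskian_eq_0[OF \<open>wronskian f g = 0\<close>] by auto
    thus ?thesis using that[of a g 1] fg False by (auto simp: mlog_def)
  qed
  \<comment> \<open>At these points \<open>a - \<xi> * b\<close> is a nonzero constant, so
    \<open>q\<close> carries the full multiplicity.\<close>
  define Z where "Z = {\<xi> \<in> p ` J. a \<noteq> \<xi> * b}"
  have "[:- \<xi>, 1:] ^ mult_at J \<xi> dvd q" if "\<xi> \<in> Z" for \<xi>
  proof -
    have "[:- \<xi>, 1:] ^ mult_at J \<xi> dvd smult (a - \<xi> * b) q"
      using mlogD[OF fg(1), of \<xi>] that by (simp add: Z_def q(1,2) smult_diff_left)
    thus ?thesis using that by (simp add: Z_def dvd_smult_iff)
  qed
  hence "(\<Prod>\<xi>\<in>Z. [:- \<xi>, 1:] ^ mult_at J \<xi>) dvd q"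
    using J by (intro prod_powers_dvd) (auto simp: Z_def)
  from dvd_imp_degree_le[OF this q(3)] have Z: "(\<Sum>\<xi>\<in>Z. mult_at J \<xi>) \<le> e"
    using q(5) unfolding degree_prod_powers by (rule order_trans)
  have "card J \<le> 2 * (\<Sum>\<xi>\<in>Z. mult_at J \<xi>)"
  proof (cases "Z = p ` J")
    case True
    thus ?thesis using J by (simp add: sum_mult_at)
  next
    case False
    then obtain \<xi> where \<xi>: "\<xi> \<in> p ` J" "a = \<xi> * b" by (auto simp: Z_def)
    \<comment> \<open>As \<open>(a, b)\<close> is nonzero, at most one \<open>\<xi>\<close>
      satisfies \<open>a = \<xi> * b\<close>; balancedness bounds the multiplicity lost there by
      half of \<open>card J\<close>.\<close>
    have "Z = p ` J - {\<xi>}" using \<xi> q(4) by (auto simp: Z_def)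
    hence "(\<Sum>\<xi>\<in>Z. mult_at J \<xi>) + mult_at J \<xi> = card J"
      using J \<xi>(1) sum.remove[of "p ` J" \<xi> "mult_at J"] by (simp add: sum_mult_at)
    thus ?thesis using bal[OF \<xi>(1)] by linarith
  qed
  thus ?thesis using Z by linarith
qed

text \<open>As in Saito's criterion: replacing \<open>f\<close> by \<open>f - \<xi> g\<close> and
  \<open>f'\<close> by \<open>f' - \<xi> g'\<close> keeps the determinant and exhibits each power as
  a factor.\<close>

lemma mlog_det_dvd:
  assumes "finite J" "(f, g) \<in> mlog J a" "(f', g') \<in> mlog J b" "f * g' - f' * g \<noteq> 0"
  shows "card J \<le> degree (f * g' - f' * g)"
proof -
  have "[:- \<xi>, 1:] ^ mult_at J \<xi> dvd f * g' - f' * g" if "\<xi> \<in> p ` J" for \<xi>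
  proof -
    have "f * g' - f' * g = (f - smult \<xi> g) * g' - (f' - smult \<xi> g') * g"
      by (simp add: algebra_simps)
    thus ?thesis using mlogD[OF assms(2) that] mlogD[OF assms(3) that] by simp
  qed
  hence "(\<Prod>\<xi>\<in>p ` J. [:- \<xi>, 1:] ^ mult_at J \<xi>) dvd f * g' - f' * g"
    using assms(1) by (intro prod_powers_dvd) auto
  from dvd_imp_degree_le[OF this assms(4)] show ?thesis
    unfolding degree_prod_powers sum_mult_at[OF assms(1)] .
qed

text \<open>The two products differ by the coefficient of degree \<open>a + b\<close> of the
  determinant, so the determinant is nonzero and \<open>mlog_det_dvd\<close> applies.\<close>

lemma mlog_lead_det:
  assumes "finite J" "(f, g) \<in> mlog J a" "(f', g') \<in> mlog J b"
    and "coeff f a * coeff g' b \<noteq> coeff f' b * coeff g a"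
  shows "card J \<le> a + b"
proof -
  have d: "degree f \<le> a" "degree g \<le> a" "degree f' \<le> b" "degree g' \<le> b"
    using assms by (auto simp: mlog_def)
  have "coeff (f * g' - f' * g) (a + b) = coeff f a * coeff g' b - coeff f' b * coeff g a"
    using coeff_mult_top[of f a g' b] coeff_mult_top[of f' b g a] d by (simp add: add.commute)
  hence "f * g' - f' * g \<noteq> 0" using assms(4) by auto
  moreover have "degree (f * g' - f' * g) \<le> a + b"
    using d by (intro degree_diff_le order_trans[OF degree_mult_le]) auto
  ultimately show ?thesis using mlog_det_dvd[OF assms(1-3)] by linarith
qed

subsection \<open>Dimension counts\<close>

lemma linear_at0_pair: "Vector_Spaces.linear scale_poly2_pair scale_poly_pair at0_pair"
  by unfold_locales (auto simp: at0_pair_def scale_poly2_pair_def scale_poly_pair_def)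

lemma linear_lead_pair: "Vector_Spaces.linear scale_poly_pair scale_pair (lead_pair i)"
  by unfold_locales (auto simp: lead_pair_def scale_poly_pair_def scale_pair_def)

text \<open>The kernel of the restriction to \<open>z = 0\<close> is \<open>z\<close> times the
  space one degree lower: \<open>z\<close> cancels in the conditions because \<open>K[z]\<close> is
  a domain.\<close>

lemma dlog_at0_0:
  assumes "(f, g) \<in> dlog J (Suc k)" "at0 f = 0" "at0 g = 0"
  obtains f' g' where "(f', g') \<in> dlog J k" "f = smult [:0, 1:] f'" "g = smult [:0, 1:] g'"
proof -
  obtain f' where f': "f = smult [:0, 1:] f'" "bideg_le (Suc k) f \<Longrightarrow> bideg_le k f'"
    using at0_eq_0_imp[OF assms(2)] by metis
  obtain g' where g': "g = smult [:0, 1:] g'" "bideg_le (Suc k) g \<Longrightarrow> bideg_le k g'"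
    using at0_eq_0_imp[OF assms(3)] by metis
  have "poly f' [:p i, - c i:] = [:p i:] * poly g' [:p i, - c i:]" if "i \<in> J" for i
  proof -
    have "poly f [:p i, - c i:] = [:p i:] * poly g [:p i, - c i:]"
      using assms(1) that by (auto simp: dlog_def)
    hence "[:0, 1:] * poly f' [:p i, - c i:] = [:0, 1:] * ([:p i:] * poly g' [:p i, - c i:])"
      unfolding f'(1) g'(1) poly_smult by (simp only: mult.left_commute)
    thus ?thesis by (subst (asm) mult_left_cancel) auto
  qed
  hence "(f', g') \<in> dlog J k"
    using assms(1) f'(2) g'(2) by (auto simp: dlog_def)
  thus ?thesis using that f'(1) g'(1) by blast
qed

lemma dlog_0_at0_0:
  assumes "(f, g) \<in> dlog J 0" "at0 f = 0" "at0 g = 0"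
  shows "f = 0" "g = 0"
  using assms by (auto simp: dlog_def elim!: at0_eq_0_imp)

text \<open>Rank-nullity for the restriction to \<open>z = 0\<close>, telescoped over the degrees.
  In degree 0 the restriction is injective.\<close>

lemma dim_dlog:
  "vs2.dim (dlog J k) = (\<Sum>j\<le>k. vs1.dim (at0_pair ` dlog J j))"
proof (induction k)
  case 0
  have "w = 0" if "w \<in> dlog J 0" "at0_pair w = 0" for w
    using that dlog_0_at0_0[of "fst w" "snd w" J] by (cases w) (auto simp: at0_pair_def zero_prod_def)
  thus ?case
    using vs21.dim_inj_image[OF linear_at0_pair subspace_dlog dlog_span finite_mons2, of J 0] by simp
next
  case (Suc k)
  define zmul :: "'k poly poly \<times> 'k poly poly \<Rightarrow> 'k poly poly \<times> 'k poly poly"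
    where "zmul = map_prod (smult [:0, 1:]) (smult [:0, 1:])"
  have lin: "Vector_Spaces.linear scale_poly2_pair scale_poly2_pair zmul"
    by unfold_locales (auto simp: zmul_def scale_poly2_pair_def smult_add_right mult.commute)
  have "{w \<in> dlog J (Suc k). at0_pair w = 0} = zmul ` dlog J k"
  proof (intro equalityI subsetI)
    fix w assume w: "w \<in> {w \<in> dlog J (Suc k). at0_pair w = 0}"
    obtain f g where fg: "w = (f, g)" by (cases w)
    obtain f' g' where fg': "(f', g') \<in> dlog J k" "f = smult [:0, 1:] f'" "g = smult [:0, 1:] g'"
      using w dlog_at0_0[of f g J k] by (auto simp: fg at0_pair_def zero_prod_def)
    thus "w \<in> zmul ` dlog J k"
      by (auto simp: zmul_def fg fg'(2,3) image_iff intro!: bexI[OF _ fg'(1)])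
  next
    fix w assume "w \<in> zmul ` dlog J k"
    then obtain f g where fg: "(f, g) \<in> dlog J k" "w = zmul (f, g)" by auto
    have "poly (smult [:0, 1:] f) [:p i, - c i:] = [:p i:] * poly (smult [:0, 1:] g) [:p i, - c i:]"
      if "i \<in> J" for i
    proof -
      have "poly f [:p i, - c i:] = [:p i:] * poly g [:p i, - c i:]"
        using fg that by (auto simp: dlog_def)
      thus ?thesis by (simp only: poly_smult mult.left_commute)
    qed
    moreover have "bideg_le (Suc k) (smult [:0, 1:] f)" "bideg_le (Suc k) (smult [:0, 1:] g)"
      using fg by (auto simp: dlog_def intro!: bideg_le_smult_var simp del: smult_pCons)
    ultimately show "w \<in> {w \<in> dlog J (Suc k). at0_pair w = 0}"
      unfolding fg(2) zmul_def map_prod_simp dlog_def at0_pair_def by (simp add: zero_prod_def)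
  qed
  moreover have "vs2.dim (zmul ` dlog J k) = vs2.dim (dlog J k)"
    by (rule vs22.dim_inj_image[OF lin subspace_dlog dlog_span finite_mons2])
      (auto simp: zmul_def zero_prod_def)
  ultimately show ?case
    using vs21.rank_nullity[OF linear_at0_pair subspace_dlog dlog_span finite_mons2, of J "Suc k"]
      Suc.IH by simp
qed

text \<open>With \<open>y = 1\<close>, division by \<open>y\<close> only lowers the degree
  bound.\<close>

lemma mlog_lead_0:
  assumes "w \<in> mlog J (Suc k)" "lead_pair (Suc k) w = 0"
  shows "w \<in> mlog J k"
  using assms degree_le_pred[of _ "Suc k"]
  by (auto simp: mlog_def lead_pair_def zero_prod_def)

lemma mlog_mono: "k \<le> l \<Longrightarrow> mlog J k \<subseteq> mlog J l"
  by (auto simp: mlog_def)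

lemma mlog_0_lead_0:
  assumes "w \<in> mlog J 0" "lead_pair 0 w = 0"
  shows "w = 0"
  using assms by (auto simp: mlog_def lead_pair_def zero_prod_def elim!: degree_eq_zeroE)

text \<open>The same telescoping one dimension lower, with \<open>y\<close> in the place of
  \<open>z\<close>.\<close>

lemma dim_mlog:
  "vs1.dim (mlog J k) = (\<Sum>i\<le>k. vs0.dim (lead_pair i ` mlog J i))"
proof (induction k)
  case 0
  show ?case
    using vs10.dim_inj_image[OF linear_lead_pair subspace_mlog mlog_span finite_mons1, of J 0 0]
      mlog_0_lead_0 by simp
next
  case (Suc k)
  have "{w \<in> mlog J (Suc k). lead_pair (Suc k) w = 0} = mlog J k"
  proof (intro equalityI subsetI)
    fix w assume "w \<in> mlog J k"
    moreover from this have "lead_pair (Suc k) w = 0"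
      by (cases w) (simp add: mlog_def lead_pair_def zero_prod_def coeff_eq_0)
    ultimately show "w \<in> {w \<in> mlog J (Suc k). lead_pair (Suc k) w = 0}"
      using mlog_mono[of k "Suc k" J] by auto
  qed (use mlog_lead_0 in blast)
  thus ?case
    using vs10.rank_nullity[OF linear_lead_pair subspace_mlog mlog_span finite_mons1,
        of J "Suc k" "Suc k"] Suc.IH by simp
qed

text \<open>Lines through a common point of \<open>z = 0\<close> share \<open>p\<close> but differ
  in \<open>c\<close>, so their forms are distinct over \<open>K[z]\<close>. Their product divides
  \<open>h\<close> and becomes a power at \<open>z = 0\<close>.\<close>

lemma at0_pair_dlog:
  assumes J: "finite J" "inj_on c J"
  shows "at0_pair ` dlog J k \<subseteq> mlog J k"
proof
  fix w assume "w \<in> at0_pair ` dlog J k"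
  then obtain f g where fg: "(f, g) \<in> dlog J k" and w: "w = at0_pair (f, g)" by auto
  have "[:- p i, 1:] ^ card {j \<in> J. p j = p i} dvd at0 f - smult (p i) (at0 g)" if i: "i \<in> J" for i
  proof -
    define J' where "J' = {j \<in> J. p j = p i}"
    define h where "h = f - smult [:p i:] g"
    have "(\<Prod>j\<in>J'. [:- [:p j, - c j:], 1:]) dvd h"
    proof (rule prod_roots_dvd)
      fix j assume "j \<in> J'"
      hence j: "j \<in> J" "p j = p i" by (auto simp: J'_def)
      have "poly f [:p j, - c j:] = [:p j:] * poly g [:p j, - c j:]"
        using fg j(1) by (auto simp: dlog_def)
      thus "poly h [:p j, - c j:] = 0" using j(2) by (simp add: h_def)
    qed (use J in \<open>auto simp: J'_def inj_on_def\<close>)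
    then obtain q where "h = (\<Prod>j\<in>J'. [:- [:p j, - c j:], 1:]) * q" by auto
    hence "at0 h = (\<Prod>j\<in>J'. [:- p j, 1:]) * at0 q" by simp
    moreover have "(\<Prod>j\<in>J'. [:- p j, 1:]) = [:- p i, 1:] ^ card J'"
      by (simp add: J'_def)
    ultimately show ?thesis by (simp add: h_def J'_def)
  qed
  thus "w \<in> mlog J k"
    using fg by (auto simp: w at0_pair_def mlog_def dlog_def degree_at0)
qed

lemma dim_lead_le_2: "vs0.dim (S :: ('k \<times> 'k) set) \<le> 2"
proof -
  have "(a, b) = scale_pair a (1, 0) + scale_pair b (0, 1)" for a b :: 'k
    by (simp add: scale_pair_def)
  hence "S \<subseteq> vs0.span {(1, 0), (0, 1)}"
    by (metis insertI1 insertI2 prod.exhaust subsetI vs0.span_add vs0.span_base vs0.span_scale)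
  hence "vs0.dim S \<le> card {(1 :: 'k, 0 :: 'k), (0, 1)}"
    by (rule vs0.dim_le_card) auto
  thus ?thesis by simp
qed

lemma dim_lead_UNIV: "vs0.dim (UNIV :: ('k \<times> 'k) set) = 2"
proof -
  have eq: "(a, b) = scale_pair a (1, 0) + scale_pair b (0, 1)" for a b :: 'k
    by (simp add: scale_pair_def)
  have "vs0.independent {(1 :: 'k, 0 :: 'k)}"
    by (simp add: vs0.dependent_single zero_prod_def)
  moreover have "(0, 1) \<notin> vs0.span {(1 :: 'k, 0 :: 'k)}"
    by (auto simp: vs0.span_singleton scale_pair_def)
  ultimately have "vs0.independent {(0, 1), (1 :: 'k, 0 :: 'k)}"
    by (rule vs0.independent_insertI[rotated])
  moreover have "(UNIV :: ('k \<times> 'k) set) \<subseteq> vs0.span {(0, 1), (1, 0)}"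
    by (metis eq insertI1 insertI2 prod.exhaust subsetI vs0.span_add vs0.span_base vs0.span_scale)
  ultimately have "card {(0, 1), (1 :: 'k, 0 :: 'k)} = vs0.dim (UNIV :: ('k \<times> 'k) set)"
    by (intro vs0.basis_card_eq_dim) auto
  thus ?thesis by simp
qed

lemma dim_lead_le_1:
  assumes "(a, b) \<noteq> 0" "\<And>x y. (x, y) \<in> S \<Longrightarrow> a * y = x * b"
  shows "vs0.dim (S :: ('k \<times> 'k) set) \<le> 1"
proof -
  have span: "scale_pair t (a, b) \<in> vs0.span {(a, b)}" for t
    by (intro vs0.span_scale vs0.span_base) simp
  have "(x, y) \<in> vs0.span {(a, b)}" if "(x, y) \<in> S" for x y
  proof (cases "a = 0")
    case True
    hence "b \<noteq> 0" "x = 0" using assms that by (force simp: zero_prod_def)+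
    hence "(x, y) = scale_pair (y / b) (a, b)" using True by (simp add: scale_pair_def)
    thus ?thesis using span by simp
  next
    case False
    hence "(x, y) = scale_pair (x / a) (a, b)"
      using assms(2)[OF that] by (simp add: scale_pair_def field_simps)
    thus ?thesis using span by simp
  qed
  hence "S \<subseteq> vs0.span {(a, b)}" by auto
  thus ?thesis using vs0.dim_le_card[of S "{(a, b)}"] by simp
qed

text \<open>Every pair on \<open>z = 0\<close> and every pair of leading coefficients is attained,
  so both filtrations have full graded pieces.\<close>

lemma dim_dlog_empty: "vs2.dim (dlog {} k) = (k + 1) * (k + 2)"
proof -
  have at0: "at0_pair ` dlog {} j = mlog {} j" for j
  proof (intro equalityI subsetI)
    fix w assume "w \<in> mlog {} j"
    hence "(lift0 (fst w), lift0 (snd w)) \<in> dlog {} j"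
      by (auto simp: mlog_def dlog_def bideg_le_lift0)
    moreover have "w = at0_pair (lift0 (fst w), lift0 (snd w))" by (simp add: at0_pair_def)
    ultimately show "w \<in> at0_pair ` dlog {} j" by blast
  qed (use at0_pair_dlog[of "{}" j] in auto)
  have "lead_pair i ` mlog {} i = UNIV" for i
  proof safe
    fix a b :: 'k
    have "(monom a i, monom b i) \<in> mlog {} i" by (simp add: mlog_def degree_monom_le)
    moreover have "(a, b) = lead_pair i (monom a i, monom b i)" by (simp add: lead_pair_def)
    ultimately show "(a, b) \<in> lead_pair i ` mlog {} i" by blast
  qed simp
  hence "vs1.dim (mlog {} j) = 2 * (j + 1)" for j
    by (simp add: dim_mlog dim_lead_UNIV)
  hence "vs2.dim (dlog {} k) = (\<Sum>j\<le>k. 2 * (j + 1))" by (simp add: dim_dlog at0)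
  also have "\<dots> = (k + 1) * (k + 2)" by (induction k) auto
  finally show ?thesis .
qed

text \<open>\<open>e J\<close> stands for the linear coefficient of the characteristic polynomial of
  \<open>J\<close> together with \<open>z = 0\<close>. The lines are added one by one with
  \<open>dim_dlog_insert\<close>.\<close>

lemma dim_dlog_ge:
  assumes e: "e {} = 0"
    "\<And>J i. J \<subseteq> I \<Longrightarrow> i \<in> I \<Longrightarrow> i \<notin> J \<Longrightarrow> e J + card (line_points i J) \<le> (e (insert i J) :: nat)"
    and I: "finite I" "inj_on c I" "card I \<le> k"
  shows "(k + 1) * (k + 2) + (\<Sum>j<card I. j) \<le> vs2.dim (dlog I k) + card I * k + e I"
proof -
  have "(k + 1) * (k + 2) + (\<Sum>j<card J. j) \<le> vs2.dim (dlog J k) + card J * k + e J"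
    if "finite J" "J \<subseteq> I" for J
    using that
  proof (induction J)
    case empty
    thus ?case by (simp add: dim_dlog_empty e(1))
  next
    case (insert i J)
    have "card J \<le> k" using insert.prems I(1,3) card_mono[of I J] by auto
    moreover have "inj_on c (insert i J)" using insert.prems I(2) inj_on_subset by blast
    ultimately have "vs2.dim (dlog J k) + card J
        \<le> vs2.dim (dlog (insert i J) k) + k + card (line_points i J)"
      using insert.hyps by (intro dim_dlog_insert)
    thus ?case using insert e(2)[of J i] by simp
  qed
  thus ?thesis using I(1) by simp
qed

end

text \<open>\<open>rank2_hilb d d' k\<close> is the dimension of \<open>K[x]\<^bsub>\<le> k - d\<^esub> \<times> K[x]\<^bsub>\<le> k - d'\<^esub>\<close>.\<close>

definition rank2_hilb :: "nat \<Rightarrow> nat \<Rightarrow> nat \<Rightarrow> nat" where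
  "rank2_hilb d d' k = (k + 1 - d) + (k + 1 - d')"

text \<open>The disjunctions force a coefficient to be 0 in degrees below its generator, where
  \<open>k - d\<close> would be truncated.\<close>

definition lincomb_deg :: "nat \<Rightarrow> nat \<Rightarrow> nat \<Rightarrow> 'a::comm_ring_1 poly poly \<Rightarrow> 'a poly poly \<Rightarrow> bool" where
  "lincomb_deg d d' k a b \<longleftrightarrow>
     (a = 0 \<or> d \<le> k \<and> bideg_le (k - d) a) \<and> (b = 0 \<or> d' \<le> k \<and> bideg_le (k - d') b)"

lemma lincomb_deg_add:
  "lincomb_deg d d' k a b \<Longrightarrow> lincomb_deg d d' k a' b' \<Longrightarrow> lincomb_deg d d' k (a + a') (b + b')"
  by (auto simp: lincomb_deg_def bideg_le_add)

lemma lincomb_deg_mono: "lincomb_deg d d' k a b \<Longrightarrow> k \<le> l \<Longrightarrow> lincomb_deg d d' l a b"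
  by (auto simp: lincomb_deg_def intro: bideg_le_mono)

lemma lincomb_deg_smult_var:
  "lincomb_deg d d' k a b \<Longrightarrow> lincomb_deg d d' (Suc k) (smult [:0, 1:] a) (smult [:0, 1:] b)"
  by (auto simp: lincomb_deg_def Suc_diff_le bideg_le_smult_var simp del: smult_pCons)

context affine_lines
begin

lemma lead_pair_ne_0:
  assumes "w \<in> mlog J e" "w \<noteq> 0" "\<And>k. k < e \<Longrightarrow> mlog J k \<subseteq> {0}"
  shows "lead_pair e w \<noteq> 0"
proof
  assume lead: "lead_pair e w = 0"
  show False
  proof (cases e)
    case 0
    thus ?thesis using mlog_0_lead_0 assms(1,2) lead by metis
  next
    case (Suc k)
    thus ?thesis using mlog_lead_0[of w J k] assms lead by auto
  qed
qed

lemma sum_le_rank2_hilb: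
  "(\<Sum>i\<le>k. (if a \<le> i then 1 else 0) + (if b \<le> i then 1 else 0 :: nat)) = rank2_hilb a b k"
  by (induction k) (auto simp: rank2_hilb_def)

text \<open>Let \<open>e\<close> be the lowest degree of a nonzero element. Below degree
  \<open>card J - e\<close> all leading pairs are proportional to that of this element by
  \<open>mlog_lead_det\<close>; from there on they span at most the plane.\<close>

lemma dim_mlog_le:
  assumes J: "finite J" "card J = d + d'" "d \<le> d'"
    and low: "\<And>k. k < d \<Longrightarrow> mlog J k \<subseteq> {0}"
  shows "vs1.dim (mlog J k) \<le> rank2_hilb d d' k"
proof (cases "mlog J k \<subseteq> {0}")
  case True
  hence "vs1.dim (mlog J k) \<le> card ({} :: ('k poly \<times> 'k poly) set)"
    by (intro vs1.dim_le_card) auto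
  thus ?thesis by simp
next
  case False
  define e where "e = (LEAST e. \<not> mlog J e \<subseteq> {0})"
  have e: "\<not> mlog J e \<subseteq> {0}"
    using LeastI[of "\<lambda>e. \<not> mlog J e \<subseteq> {0}", OF False] unfolding e_def by blast
  have least: "mlog J i \<subseteq> {0}" if "i < e" for i
    using not_less_Least[of i "\<lambda>e. \<not> mlog J e \<subseteq> {0}"] that by (auto simp: e_def)
  have de: "d \<le> e" using e low by (meson not_le)
  obtain f g where fg: "(f, g) \<in> mlog J e" "(f, g) \<noteq> 0" using e by auto
  have lead: "(coeff f e, coeff g e) \<noteq> 0"
    using lead_pair_ne_0[OF fg least] by (simp add: lead_pair_def)
  have "vs0.dim (lead_pair i ` mlog J i) \<le>
      (if e \<le> i then 1 else 0) + (if max e (card J - e) \<le> i then 1 else 0)" for i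
  proof -
    consider "i < e" | "e \<le> i" "i < card J - e" | "max e (card J - e) \<le> i" by linarith
    thus ?thesis
    proof cases
      case 1
      hence "lead_pair i ` mlog J i \<subseteq> vs0.span {}"
        using least[of i] by (auto simp: lead_pair_def zero_prod_def)
      hence "vs0.dim (lead_pair i ` mlog J i) \<le> card ({} :: ('k \<times> 'k) set)"
        by (intro vs0.dim_le_card) auto
      thus ?thesis by simp
    next
      case 2
      have "coeff f e * y = x * coeff g e" if xy: "(x, y) \<in> lead_pair i ` mlog J i" for x y
      proof (rule ccontr)
        assume ne: "\<not> ?thesis"
        obtain f' g' where "(f', g') \<in> mlog J i" "x = coeff f' i" "y = coeff g' i"
          using xy by (auto simp: lead_pair_def)
        hence "card J \<le> e + i" using mlog_lead_det[OF J(1) fg(1)] ne by auto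
        thus False using 2 by linarith
      qed
      hence "vs0.dim (lead_pair i ` mlog J i) \<le> 1" by (intro dim_lead_le_1[OF lead])
      thus ?thesis using 2 by simp
    next
      case 3
      thus ?thesis using dim_lead_le_2[of "lead_pair i ` mlog J i"] by simp
    qed
  qed
  hence "vs1.dim (mlog J k) \<le> rank2_hilb e (max e (card J - e)) k"
    unfolding dim_mlog sum_le_rank2_hilb[symmetric] by (rule sum_mono)
  \<comment> \<open>\<open>rank2_hilb\<close> is a sum of convex nonincreasing functions of the
    exponents: it does not drop when they are lowered or moved apart with constant sum.\<close>
  also have "\<dots> \<le> rank2_hilb d d' k"
    using de J(2,3) by (auto simp: rank2_hilb_def max_def)
  finally show ?thesis .
qed

section \<open>Generation by two derivations\<close>

lemma dlog_mult:
  assumes "(f, g) \<in> dlog J d" "a = 0 \<or> d \<le> k \<and> bideg_le (k - d) a"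
  shows "(a * f, a * g) \<in> dlog J k"
proof (cases "a = 0")
  case False
  hence k: "k - d + d = k" and a: "bideg_le (k - d) a" using assms(2) by auto
  have "bideg_le k (a * f)" "bideg_le k (a * g)"
    using bideg_le_mult[OF a, of d f] bideg_le_mult[OF a, of d g] assms(1) unfolding k
    by (auto simp: dlog_def)
  thus ?thesis using assms(1) by (auto simp: dlog_def)
qed (auto simp: dlog_def)

lemma dlog_diff: "(f, g) \<in> dlog J k \<Longrightarrow> (f', g') \<in> dlog J k \<Longrightarrow> (f - f', g - g') \<in> dlog J k"
  using vs2.subspace_diff[OF subspace_dlog, of "(f, g)" J k "(f', g')"] by simp

lemma mlog_monom_mult:
  assumes "(f, g) \<in> mlog J d" "s = 0 \<or> d \<le> k"
  shows "(monom s (k - d) * f, monom s (k - d) * g) \<in> mlog J k"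
proof (cases "s = 0")
  case False
  have deg: "degree (monom s (k - d) * h) \<le> k" if "degree h \<le> d" for h
    using degree_mult_le[of "monom s (k - d)" h] degree_monom_le[of s "k - d"] that False assms(2)
    by linarith
  have "q dvd monom s (k - d) * f - smult x (monom s (k - d) * g)" if "q dvd f - smult x g" for q x
    using dvd_mult[OF that, of "monom s (k - d)"] by (simp add: algebra_simps)
  thus ?thesis using assms deg by (auto simp: mlog_def)
qed (auto simp: mlog_def)

lemma coeff_monom_mult_top:
  fixes h :: "'k poly"
  assumes "s = 0 \<or> d \<le> k" "degree h \<le> d"
  shows "coeff (monom s (k - d) * h) k = s * coeff h d"
  using assms coeff_mult_top[of "monom s (k - d)" "k - d" h d] degree_monom_le[of s "k - d"]
  by auto

text \<open>Below degree \<open>d\<close> everything is 0; below \<open>d'\<close> leading pairs are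
  proportional to that of \<open>(f, g)\<close> by \<open>mlog_lead_det\<close>; from
  \<open>d'\<close> on Cramer's rule gives \<open>s\<close> and \<open>t\<close>.\<close>

lemma mlog_reduce_lead:
  assumes low: "\<And>k. k < d \<Longrightarrow> mlog J k \<subseteq> {0}"
    and J: "finite J" "card J = d + d'" "d \<le> d'"
    and u: "(f, g) \<in> mlog J d" "(coeff f d, coeff g d) \<noteq> 0"
    and v: "(f', g') \<in> mlog J d'" "coeff f d * coeff g' d' - coeff f' d' * coeff g d \<noteq> 0"
    and w: "(F, G) \<in> mlog J k"
  obtains s t where "s = 0 \<or> d \<le> k" "t = 0 \<or> d' \<le> k"
    "coeff F k = s * coeff f d + t * coeff f' d'" "coeff G k = s * coeff g d + t * coeff g' d'"
proof -
  consider "k < d" | "d \<le> k" "k < d'" | "d' \<le> k" by linarith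
  thus ?thesis
  proof cases
    case 1
    thus ?thesis using that[of 0 0] w low[of k] by (auto simp: zero_prod_def)
  next
    case 2
    have eq: "coeff f d * coeff G k = coeff F k * coeff g d"
      using mlog_lead_det[OF J(1) u(1) w] 2 J(2) by fastforce
    show ?thesis
    proof (cases "coeff f d = 0")
      case True
      thus ?thesis using eq u(2) 2
        by (intro that[of "coeff G k / coeff g d" 0]) (auto simp: zero_prod_def)
    next
      case False
      thus ?thesis using eq 2
        by (intro that[of "coeff F k / coeff f d" 0]) (auto simp: field_simps)
    qed
  next
    case 3
    define \<delta> where "\<delta> = coeff f d * coeff g' d' - coeff f' d' * coeff g d"
    have "\<delta> \<noteq> 0" using v(2) by (simp add: \<delta>_def)
    thus ?thesis using 3 J(3)
      by (intro that[of "(coeff F k * coeff g' d' - coeff f' d' * coeff G k) / \<delta>"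
            "(coeff f d * coeff G k - coeff F k * coeff g d) / \<delta>"])
        (auto simp: field_simps, auto simp: \<delta>_def algebra_simps)
  qed
qed

lemma lincomb_deg_monom:
  "s = 0 \<or> d \<le> k \<Longrightarrow> t = 0 \<or> d' \<le> k \<Longrightarrow>
    lincomb_deg d d' k (lift0 (monom s (k - d))) (lift0 (monom t (k - d')))"
  by (auto simp: lincomb_deg_def bideg_le_lift0 degree_monom_le)

lemma mlog_diff: "(f, g) \<in> mlog J k \<Longrightarrow> (f', g') \<in> mlog J k \<Longrightarrow> (f - f', g - g') \<in> mlog J k"
  using vs1.subspace_diff[OF subspace_mlog, of "(f, g)" J k "(f', g')"] by simp

text \<open>Multiples of the two generators by monomials cancel the leading pair, and the remainder
  has a smaller degree bound. \<open>lift0\<close> moves the coefficients to the ring of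
  \<open>lincomb_deg\<close>.\<close>

lemma mlog_generated:
  assumes low: "\<And>k. k < d \<Longrightarrow> mlog J k \<subseteq> {0}"
    and J: "finite J" "card J = d + d'" "d \<le> d'"
    and u: "(f, g) \<in> mlog J d" "(coeff f d, coeff g d) \<noteq> 0"
    and v: "(f', g') \<in> mlog J d'" "coeff f d * coeff g' d' - coeff f' d' * coeff g d \<noteq> 0"
    and w: "(F, G) \<in> mlog J k"
  shows "\<exists>a b. lincomb_deg d d' k (lift0 a) (lift0 b) \<and> F = a * f + b * f' \<and> G = a * g + b * g'"
  using w
proof (induction k arbitrary: F G rule: less_induct)
  fix k F G
  assume IH: "\<And>l F G. l < k \<Longrightarrow> (F, G) \<in> mlog J l \<Longrightarrow>
      \<exists>a b. lincomb_deg d d' l (lift0 a) (lift0 b) \<and> F = a * f + b * f' \<and> G = a * g + b * g'"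
    and FG: "(F, G) \<in> mlog J k"
  obtain s t where st: "s = 0 \<or> d \<le> k" "t = 0 \<or> d' \<le> k"
    "coeff F k = s * coeff f d + t * coeff f' d'" "coeff G k = s * coeff g d + t * coeff g' d'"
    using mlog_reduce_lead[OF low J u v FG] by metis
  have deg: "degree f \<le> d" "degree g \<le> d" "degree f' \<le> d'" "degree g' \<le> d'"
    using u(1) v(1) by (auto simp: mlog_def)
  define F1 G1 where "F1 = F - monom s (k - d) * f - monom t (k - d') * f'"
    and "G1 = G - monom s (k - d) * g - monom t (k - d') * g'"
  have mem: "(F1, G1) \<in> mlog J k"
    unfolding F1_def G1_def by (intro mlog_diff FG mlog_monom_mult u(1) v(1) st)
  have lead: "lead_pair k (F1, G1) = 0"
    using deg st by (simp add: lead_pair_def F1_def G1_def coeff_monom_mult_top zero_prod_def)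
  have "\<exists>a b. lincomb_deg d d' k (lift0 a) (lift0 b) \<and> F1 = a * f + b * f' \<and> G1 = a * g + b * g'"
  proof (cases k)
    case 0
    hence "(F1, G1) = 0" using mlog_0_lead_0 mem lead by metis
    thus ?thesis by (intro exI[of _ 0]) (simp add: lincomb_deg_def zero_prod_def)
  next
    case (Suc l)
    thus ?thesis using IH[of l F1 G1] mlog_lead_0[of _ J l] mem lead
      by (metis le_SucI lessI lincomb_deg_mono order_refl)
  qed
  then obtain a b where ab: "lincomb_deg d d' k (lift0 a) (lift0 b)"
    "F1 = a * f + b * f'" "G1 = a * g + b * g'" by blast
  have "F = (a + monom s (k - d)) * f + (b + monom t (k - d')) * f'"
    "G = (a + monom s (k - d)) * g + (b + monom t (k - d')) * g'"
    using ab(2,3) by (simp_all add: F1_def G1_def algebra_simps)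
  moreover have "lincomb_deg d d' k (lift0 (a + monom s (k - d))) (lift0 (b + monom t (k - d')))"
    unfolding lift0_add by (intro lincomb_deg_add ab(1) lincomb_deg_monom st)
  ultimately show "\<exists>a b. lincomb_deg d d' k (lift0 a) (lift0 b)
      \<and> F = a * f + b * f' \<and> G = a * g + b * g'" by blast
qed

text \<open>A graded Nakayama argument: subtracting a lift of the combination found at
  \<open>z = 0\<close> leaves a multiple of \<open>z\<close>, whose quotient has lower
  degree.\<close>

lemma dlog_generated:
  assumes low: "\<And>k. k < d \<Longrightarrow> mlog J k \<subseteq> {0}"
    and J: "finite J" "inj_on c J" "card J = d + d'" "d \<le> d'"
    and u: "(f, g) \<in> dlog J d" "(coeff (at0 f) d, coeff (at0 g) d) \<noteq> 0"
    and v: "(f', g') \<in> dlog J d'"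
      "coeff (at0 f) d * coeff (at0 g') d' - coeff (at0 f') d' * coeff (at0 g) d \<noteq> 0"
    and w: "(F, G) \<in> dlog J k"
  shows "\<exists>a b. lincomb_deg d d' k a b \<and> F = a * f + b * f' \<and> G = a * g + b * g'"
  using w
proof (induction k arbitrary: F G rule: less_induct)
  fix k F G
  assume IH: "\<And>l F G. l < k \<Longrightarrow> (F, G) \<in> dlog J l \<Longrightarrow>
      \<exists>a b. lincomb_deg d d' l a b \<and> F = a * f + b * f' \<and> G = a * g + b * g'"
    and FG: "(F, G) \<in> dlog J k"
  have at0_mem: "(at0 x, at0 y) \<in> mlog J l" if "(x, y) \<in> dlog J l" for x y l
    using at0_pair_dlog[OF J(1,2), of l] that by (force simp: at0_pair_def)
  obtain a b where ab: "lincomb_deg d d' k (lift0 a) (lift0 b)"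
    "at0 F = a * at0 f + b * at0 f'" "at0 G = a * at0 g + b * at0 g'"
    using mlog_generated[OF low J(1,3,4) at0_mem[OF u(1)] u(2) at0_mem[OF v(1)] v(2) at0_mem[OF FG]]
    by blast
  define F1 G1 where "F1 = F - lift0 a * f - lift0 b * f'" and "G1 = G - lift0 a * g - lift0 b * g'"
  have mem: "(F1, G1) \<in> dlog J k"
    unfolding F1_def G1_def using ab(1) u(1) v(1)
    by (intro dlog_diff FG dlog_mult) (auto simp: lincomb_deg_def)
  have at0: "at0 F1 = 0" "at0 G1 = 0" by (simp_all add: F1_def G1_def ab)
  have "\<exists>a b. lincomb_deg d d' k a b \<and> F1 = a * f + b * f' \<and> G1 = a * g + b * g'"
  proof (cases k)
    case 0
    hence "F1 = 0" "G1 = 0" using dlog_0_at0_0 mem at0 by blast+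
    thus ?thesis by (intro exI[of _ 0]) (simp add: lincomb_deg_def)
  next
    case (Suc l)
    obtain F2 G2 where 2: "(F2, G2) \<in> dlog J l" "F1 = smult [:0, 1:] F2" "G1 = smult [:0, 1:] G2"
      using dlog_at0_0 mem at0 Suc by blast
    obtain a b where ab: "lincomb_deg d d' l a b" "F2 = a * f + b * f'" "G2 = a * g + b * g'"
      using IH[OF _ 2(1)] Suc by blast
    have "F1 = smult [:0, 1:] a * f + smult [:0, 1:] b * f'"
      "G1 = smult [:0, 1:] a * g + smult [:0, 1:] b * g'"
      unfolding 2(2,3) ab(2,3) by (simp_all only: smult_add_right mult_smult_left)
    thus ?thesis using lincomb_deg_smult_var[OF ab(1)] Suc by blast
  qed
  then obtain a' b' where ab': "lincomb_deg d d' k a' b'"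
    "F1 = a' * f + b' * f'" "G1 = a' * g + b' * g'" by blast
  have "F = (a' + lift0 a) * f + (b' + lift0 b) * f'" "G = (a' + lift0 a) * g + (b' + lift0 b) * g'"
    using ab'(2,3) by (simp_all add: F1_def G1_def algebra_simps)
  moreover have "lincomb_deg d d' k (a' + lift0 a) (b' + lift0 b)"
    by (intro lincomb_deg_add ab'(1) ab(1))
  ultimately show "\<exists>a b. lincomb_deg d d' k a b \<and> F = a * f + b * f' \<and> G = a * g + b * g'"
    by blast
qed

theorem dlog_basis:
  assumes I: "finite I" "inj_on c I" "card I = d + d'" "d \<le> d'"
    and bal: "\<And>\<xi>. \<xi> \<in> p ` I \<Longrightarrow> 2 * mult_at I \<xi> \<le> card I"
    and few: "card (p ` I) \<le> d' - d + 3"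
    and k: "d' \<le> k" "(\<Sum>j\<le>k. rank2_hilb d d' j) \<le> vs2.dim (dlog I k)"
  obtains f g f' g' where "(f, g) \<in> dlog I d" "(f', g') \<in> dlog I d'" "f * g' - f' * g \<noteq> 0"
    "\<And>F G k. (F, G) \<in> dlog I k \<Longrightarrow>
      \<exists>a b. lincomb_deg d d' k a b \<and> F = a * f + b * f' \<and> G = a * g + b * g'"
proof -
  have low: "mlog I k \<subseteq> {0}" if "k < d" for k
  proof
    fix w assume w: "w \<in> mlog I k"
    show "w \<in> {0}"
    proof (rule ccontr)
      assume "w \<notin> {0}"
      hence "card I + 2 \<le> 2 * k + card (p ` I) \<or> card I \<le> 2 * k"
        using w mlog_degree_bound[OF I(1) _ _ bal, of "fst w" "snd w" k] by (cases w) auto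
      \<comment> \<open>The first alternative gives \<open>2 * d - 1 \<le> 2 * k\<close>, hence
        \<open>d \<le> k\<close> by integrality.\<close>
      thus False using I(3,4) few that by linarith
    qed
  qed
  have le1: "vs1.dim (at0_pair ` dlog I j) \<le> vs1.dim (mlog I j)" for j
    using at0_pair_dlog[OF I(1,2)] mlog_span finite_mons1 by (rule vs1.dim_subspace_le)
  have le2: "vs1.dim (mlog I j) \<le> rank2_hilb d d' j" for j
    using I low by (intro dim_mlog_le)
  have le: "vs1.dim (at0_pair ` dlog I j) \<le> rank2_hilb d d' j" for j
    using le1 le2 by (rule order_trans)
  \<comment> \<open>The termwise upper bounds add up to at most the actual total, so each of them is
    attained.\<close>
  have "(\<Sum>j\<le>k. vs1.dim (at0_pair ` dlog I j)) = (\<Sum>j\<le>k. rank2_hilb d d' j)"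
    using k(2) unfolding dim_dlog by (rule antisym[OF sum_mono[OF le]])
  hence eq: "vs1.dim (at0_pair ` dlog I j) = rank2_hilb d d' j" if "j \<le> k" for j
    by (rule sum_mono_inv) (use that le in auto)
  have dim: "vs1.dim (mlog I j) = rank2_hilb d d' j" if "j \<le> k" for j
    using eq[OF that] le1[of j] le2[of j] by linarith
  have surj: "at0_pair ` dlog I j = mlog I j" if "j \<le> k" for j
    using vs21.linear_subspace_image[OF linear_at0_pair subspace_dlog] at0_pair_dlog[OF I(1,2)]
      mlog_span finite_mons1
    by (rule vs1.subspace_eq_if_dim_le) (simp add: eq dim that)
  have "\<not> mlog I d \<subseteq> {0}"
  proof
    assume "mlog I d \<subseteq> {0}"
    hence "vs1.dim (mlog I d) \<le> card ({} :: ('k poly \<times> 'k poly) set)"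
      by (intro vs1.dim_le_card) auto
    thus False using dim[of d] I(4) k(1) by (simp add: rank2_hilb_def)
  qed
  then obtain f0 g0 where u0: "(f0, g0) \<in> mlog I d" "(f0, g0) \<noteq> 0" by auto
  have lead: "(coeff f0 d, coeff g0 d) \<noteq> 0"
    using lead_pair_ne_0[OF u0 low] by (simp add: lead_pair_def)
  \<comment> \<open>From degree \<open>d' - 1\<close> to \<open>d'\<close> the function
    \<open>rank2_hilb d d'\<close> grows by 2, one for each exponent. So some leading pair is not
    proportional to that of \<open>(f0, g0)\<close>.\<close>
  have "vs0.dim (lead_pair d' ` mlog I d') = 2"
  proof (cases d')
    case 0
    thus ?thesis using dim[of 0] I(4) by (simp add: dim_mlog rank2_hilb_def)
  next
    case (Suc m)
    have "vs1.dim (mlog I d') = vs1.dim (mlog I m) + vs0.dim (lead_pair d' ` mlog I d')"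
      by (simp add: dim_mlog Suc)
    thus ?thesis using dim[of d'] dim[of m] Suc k(1) I(4) by (simp add: rank2_hilb_def)
  qed
  then obtain x y where xy: "(x, y) \<in> lead_pair d' ` mlog I d'" "coeff f0 d * y \<noteq> x * coeff g0 d"
    using dim_lead_le_1[OF lead, of "lead_pair d' ` mlog I d'"] by fastforce
  then obtain f0' g0' where v0: "(f0', g0') \<in> mlog I d'"
    "coeff f0 d * coeff g0' d' - coeff f0' d' * coeff g0 d \<noteq> 0"
    by (auto simp: lead_pair_def)
  \<comment> \<open>Both generators lift, as the restriction is surjective in degrees up to
    \<open>k\<close>.\<close>
  obtain f g where u: "(f, g) \<in> dlog I d" "at0 f = f0" "at0 g = g0"
    using u0(1) surj[of d] I(4) k(1) by (force simp: at0_pair_def)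
  obtain f' g' where v: "(f', g') \<in> dlog I d'" "at0 f' = f0'" "at0 g' = g0'"
    using v0(1) surj[of d'] k(1) by (force simp: at0_pair_def)
  have deg: "degree f0 \<le> d" "degree g0 \<le> d" "degree f0' \<le> d'" "degree g0' \<le> d'"
    using u0(1) v0(1) by (auto simp: mlog_def)
  have "coeff (at0 (f * g' - f' * g)) (d + d') \<noteq> 0"
    using v0(2) coeff_mult_top[OF deg(1,4)] coeff_mult_top[OF deg(3,2)]
    by (simp add: u v add.commute del: coeff_at0)
  hence "f * g' - f' * g \<noteq> 0" by (metis at0_0 coeff_0)
  moreover have "\<exists>a b. lincomb_deg d d' k a b \<and> F = a * f + b * f' \<and> G = a * g + b * g'"
    if "(F, G) \<in> dlog I k" for F G k
    by (rule dlog_generated[OF low I u(1) _ v(1) _ that])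
      (use lead v0(2) in \<open>simp_all add: u v del: coeff_at0\<close>)
  ultimately show ?thesis by (rule that[OF u(1) v(1)])
qed

end

subsection \<open>Derivations of the polynomial ring in three variables\<close>

lemma poly_mapping_sum_singles:
  "f = (\<Sum>e\<in>Poly_Mapping.keys f. Poly_Mapping.single e (Poly_Mapping.lookup f e))"
  by (rule poly_mapping_eqI)
    (auto simp: lookup_sum lookup_single when_def in_keys_iff if_distrib sum.delta' cong: if_cong)

lemma Var3_power: "Var3 i ^ n = Poly_Mapping.single (Poly_Mapping.single i n) (1 :: 'k::field)"
  by (induction n) (simp_all add: Var3_def mult_single flip: single_add)

lemma single_eq_Const3_Var3:
  "Poly_Mapping.single e (c :: 'k::field) = Const3 c * (\<Prod>i\<in>UNIV. Var3 i ^ Poly_Mapping.lookup e i)"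
proof -
  have "(\<Prod>i\<in>A. Var3 i ^ Poly_Mapping.lookup e i) =
      Poly_Mapping.single (\<Sum>i\<in>A. Poly_Mapping.single i (Poly_Mapping.lookup e i)) (1 :: 'k)"
    if "finite A" for A
    using that by (induction A) (simp_all add: Var3_power mult_single)
  moreover have "(\<Sum>i\<in>UNIV. Poly_Mapping.single i (Poly_Mapping.lookup e i)) = e"
    by (rule poly_mapping_eqI)
      (simp add: lookup_sum lookup_single when_def if_distrib sum.delta' cong: if_cong)
  ultimately show ?thesis by (simp add: Const3_def mult_single)
qed

text \<open>Reduces identities between homomorphisms or between derivations to constants and
  variables.\<close>

lemma poly3_induct [case_names Const Var add mult]:
  assumes C: "\<And>c. P (Const3 c)" and V: "\<And>i. P (Var3 i)"
    and A: "\<And>f g. P f \<Longrightarrow> P g \<Longrightarrow> P (f + g)" and M: "\<And>f g. P f \<Longrightarrow> P g \<Longrightarrow> P (f * g)"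
  shows "P (f :: 'k::field poly3)"
proof -
  have 1: "P 1" using C[of 1] by (simp add: Const3_def)
  have 0: "P 0" using C[of 0] by (simp add: Const3_def)
  have pow: "P (Var3 i ^ n)" for i n by (induction n) (auto intro: 1 V M)
  have prod: "P (\<Prod>i\<in>A. Var3 i ^ e i)" if "finite A" for A e
    using that by (induction A) (auto intro: 1 pow M)
  have "P (Poly_Mapping.single e c)" for e c
    by (subst single_eq_Const3_Var3) (intro M C prod finite)
  note single = this
  have "P (\<Sum>e\<in>B. Poly_Mapping.single e (Poly_Mapping.lookup f e))" if "finite B" for B
    using that by (induction B) (auto intro: 0 A single)
  thus ?thesis by (subst poly_mapping_sum_singles) simp
qed

lemma Const3_add: "Const3 (a + b) = Const3 a + Const3 b"
  by (simp add: Const3_def single_add)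

lemma Const3_mult: "Const3 (a * b) = Const3 a * Const3 b"
  by (simp add: Const3_def mult_single)

lemma Const3_0 [simp]: "Const3 0 = 0" and Const3_1 [simp]: "Const3 1 = 1"
  by (simp_all add: Const3_def)

lemma Const3_sum: "Const3 (\<Sum>j\<in>A. f j) = (\<Sum>j\<in>A. Const3 (f j))"
  by (induction A rule: infinite_finite_induct) (auto simp: Const3_add)

text \<open>The universal property of \<open>S\<close>, used with targets
  \<open>S[\<epsilon>]\<close>, \<open>K[z][x][t]\<close> and \<open>S\<close> itself.\<close>

locale poly3_eval =
  fixes \<iota> :: "'k::field \<Rightarrow> 'r::comm_ring_1" and v :: "3 \<Rightarrow> 'r"
  assumes \<iota>_0: "\<iota> 0 = 0" and \<iota>_1: "\<iota> 1 = 1"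
    and \<iota>_add: "\<iota> (a + b) = \<iota> a + \<iota> b" and \<iota>_mult: "\<iota> (a * b) = \<iota> a * \<iota> b"
begin

definition mon :: "(3 \<Rightarrow>\<^sub>0 nat) \<Rightarrow> 'r" where
  "mon e = (\<Prod>i\<in>UNIV. v i ^ Poly_Mapping.lookup e i)"

definition ev :: "'k poly3 \<Rightarrow> 'r" where
  "ev f = (\<Sum>e\<in>Poly_Mapping.keys f. \<iota> (Poly_Mapping.lookup f e) * mon e)"

lemma ev_superset:
  assumes "finite A" "Poly_Mapping.keys f \<subseteq> A"
  shows "ev f = (\<Sum>e\<in>A. \<iota> (Poly_Mapping.lookup f e) * mon e)"
  unfolding ev_def using assms
  by (intro sum.mono_neutral_left) (auto simp: in_keys_iff \<iota>_0)

lemma ev_add: "ev (f + g) = ev f + ev g"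
proof -
  define A where "A = Poly_Mapping.keys f \<union> Poly_Mapping.keys g"
  have "ev h = (\<Sum>e\<in>A. \<iota> (Poly_Mapping.lookup h e) * mon e)" if "h \<in> {f, g, f + g}" for h
    using that keys_add[of f g] by (intro ev_superset) (auto simp: A_def)
  thus ?thesis by (simp add: lookup_add \<iota>_add algebra_simps sum.distrib)
qed

lemma ev_0 [simp]: "ev 0 = 0"
  by (simp add: ev_def)

lemma ev_sum: "ev (\<Sum>i\<in>A. f i) = (\<Sum>i\<in>A. ev (f i))"
  by (induction A rule: infinite_finite_induct) (auto simp: ev_add)

lemma ev_single: "ev (Poly_Mapping.single e c) = \<iota> c * mon e"
  by (simp add: ev_def \<iota>_0)

lemma mon_add: "mon (e + e') = mon e * mon e'"
  by (simp add: mon_def lookup_add power_add prod.distrib)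

lemma ev_mult: "ev (f * g) = ev f * ev g"
proof -
  define F where "F e = Poly_Mapping.single e (Poly_Mapping.lookup f e)" for e
  define G where "G e = Poly_Mapping.single e (Poly_Mapping.lookup g e)" for e
  have f: "f = (\<Sum>e\<in>Poly_Mapping.keys f. F e)" unfolding F_def by (rule poly_mapping_sum_singles)
  have g: "g = (\<Sum>e\<in>Poly_Mapping.keys g. G e)" unfolding G_def by (rule poly_mapping_sum_singles)
  have "ev (F e * G e') = ev (F e) * ev (G e')" for e e'
    by (simp add: F_def G_def mult_single ev_single mon_add \<iota>_mult)
  thus ?thesis
    by (subst (1 2) f, subst (1 2) g) (simp add: sum_product ev_sum)
qed

lemma mon_0 [simp]: "mon 0 = 1"
  by (simp add: mon_def)

lemma ev_Const3 [simp]: "ev (Const3 c) = \<iota> c"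
  by (simp add: Const3_def ev_single)

lemma ev_Var3 [simp]: "ev (Var3 i) = v i"
proof -
  have "mon (Poly_Mapping.single i 1) = (\<Prod>j\<in>UNIV. if j = i then v j else 1)"
    unfolding mon_def by (intro prod.cong) (auto simp: lookup_single when_def)
  thus ?thesis by (simp add: Var3_def ev_single \<iota>_1)
qed

lemma ev_linear_form: "ev (linear_form a) = (\<Sum>i\<in>UNIV. \<iota> (a $ i) * v i)"
  by (simp add: linear_form_def ev_sum ev_mult)

end

text \<open>A derivation with prescribed values \<open>F\<close> is the \<open>\<epsilon>\<close>-part of the substitution
  \<open>x\<^sub>i \<mapsto> x\<^sub>i + F\<^sub>i \<epsilon>\<close> into \<open>S[\<epsilon>]\<close>.\<close>

lemma derivation_exists:
  fixes F :: "3 \<Rightarrow> 'k::field poly3"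
  obtains \<theta> where "\<theta> \<in> derivations" "\<And>i. \<theta> (Var3 i) = F i"
proof -
  interpret E: poly3_eval "\<lambda>c :: 'k. [:Const3 c:]" "\<lambda>i. [:Var3 i, F i:]"
    by unfold_locales (simp_all add: Const3_add Const3_mult)
  have 0: "coeff (E.ev f) 0 = f" for f
    by (induction f rule: poly3_induct) (simp_all add: E.ev_add E.ev_mult coeff_mult)
  \<comment> \<open>Higher coefficients never enter the coefficient of \<open>\<epsilon>\<close> in
    a product, so \<open>S[\<epsilon>]\<close> can stand for the dual numbers.\<close>
  define \<theta> where "\<theta> f = coeff (E.ev f) 1" for f
  have mult: "\<theta> (f * g) = f * \<theta> g + g * \<theta> f" for f g
    by (simp add: \<theta>_def E.ev_mult coeff_mult 0 mult.commute)
  have "\<theta> (Const3 c) = 0" for c by (simp add: \<theta>_def)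
  hence "\<theta> (Const3 c * f) = Const3 c * \<theta> f" for c f by (simp add: mult)
  hence "\<theta> \<in> derivations" by (auto simp: derivations_def mult) (simp add: \<theta>_def E.ev_add)
  moreover have "\<theta> (Var3 i) = F i" for i by (simp add: \<theta>_def)
  ultimately show ?thesis by (rule that)
qed

lemma derivation_Const3:
  assumes "\<theta> \<in> derivations"
  shows "\<theta> (Const3 c) = 0"
proof -
  have "\<theta> (1 * 1) = 1 * \<theta> 1 + 1 * \<theta> 1"
    using assms unfolding derivations_def by blast
  hence "\<theta> 1 = \<theta> 1 + \<theta> 1" by (simp only: mult_1)
  hence "\<theta> 1 = 0" by (rule add_cancel_right_right[THEN iffD1])
  moreover have "\<theta> (Const3 c * 1) = Const3 c * \<theta> 1"
    using assms unfolding derivations_def by blast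
  ultimately show ?thesis by simp
qed

lemma derivation_eqI:
  assumes "\<theta> \<in> derivations" "\<eta> \<in> derivations" "\<And>i. \<theta> (Var3 i) = \<eta> (Var3 i)"
  shows "\<theta> = \<eta>"
proof
  fix f
  have add: "\<theta> (f + g) = \<theta> f + \<theta> g" "\<eta> (f + g) = \<eta> f + \<eta> g" for f g
    using assms unfolding derivations_def by blast+
  have mult: "\<theta> (f * g) = f * \<theta> g + g * \<theta> f" "\<eta> (f * g) = f * \<eta> g + g * \<eta> f" for f g
    using assms unfolding derivations_def by blast+
  show "\<theta> f = \<eta> f"
    by (induction f rule: poly3_induct)
      (simp_all add: derivation_Const3 assms add mult)
qed

lemma derivation_0: "\<theta> \<in> derivations \<Longrightarrow> \<theta> 0 = 0"
  using derivation_Const3[of \<theta> 0] by simp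

lemma derivation_linear_form:
  assumes "\<theta> \<in> derivations"
  shows "\<theta> (linear_form a) = (\<Sum>i\<in>UNIV. Const3 (a $ i) * \<theta> (Var3 i))"
proof -
  have add: "\<theta> (f + g) = \<theta> f + \<theta> g" and scale: "\<theta> (Const3 c * f) = Const3 c * \<theta> f" for f g c
    using assms unfolding derivations_def by blast+
  have "\<theta> (\<Sum>i\<in>A. Const3 (a $ i) * Var3 i) = (\<Sum>i\<in>A. Const3 (a $ i) * \<theta> (Var3 i))"
    if "finite A" for A
    using that by (induction A) (simp_all add: derivation_0 assms add scale)
  thus ?thesis by (simp add: linear_form_def)
qed

lemma linear_form_axis: "linear_form (axis i 1) = Var3 i"
  by (simp add: linear_form_def axis_def if_distrib[of Const3] if_distrib[of "\<lambda>c. c * _"]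
      cong: if_cong)

lemma linear_form_matrix:
  "linear_form (a v* M) = (\<Sum>j\<in>UNIV. Const3 (a $ j) * linear_form (M $ j))"
proof -
  have "linear_form (a v* M) = (\<Sum>l\<in>UNIV. \<Sum>j\<in>UNIV. Const3 (a $ j) * (Const3 (M $ j $ l) * Var3 l))"
    by (simp add: linear_form_def vector_matrix_mult_def Const3_sum Const3_mult
        sum_distrib_right sum_distrib_left mult_ac)
  also have "\<dots> = (\<Sum>j\<in>UNIV. Const3 (a $ j) * linear_form (M $ j))"
    by (subst sum.swap) (simp add: linear_form_def sum_distrib_left)
  finally show ?thesis .
qed

lemma derivation_linear_form_matrix:
  assumes "\<theta> \<in> derivations"
  shows "\<theta> (linear_form (a v* M)) = (\<Sum>j\<in>UNIV. Const3 (a $ j) * \<theta> (linear_form (M $ j)))"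
proof -
  have "\<theta> (linear_form (a v* M)) =
      (\<Sum>l\<in>UNIV. \<Sum>j\<in>UNIV. Const3 (a $ j) * (Const3 (M $ j $ l) * \<theta> (Var3 l)))"
    by (simp add: derivation_linear_form assms vector_matrix_mult_def Const3_sum Const3_mult
        sum_distrib_right sum_distrib_left mult_ac)
  also have "\<dots> = (\<Sum>j\<in>UNIV. Const3 (a $ j) * \<theta> (linear_form (M $ j)))"
    by (subst sum.swap) (simp add: derivation_linear_form assms sum_distrib_left)
  finally show ?thesis .
qed

text \<open>
  The map \<open>rees\<close> sends \<open>x\<^sub>1, x\<^sub>2, x\<^sub>3\<close> to \<open>x t, t, z t\<close> in \<open>K[z][x][t]\<close>: the coefficient of \<open>t\<^sup>k\<close> is the degree
  \<open>k\<close> component dehomogenized at \<open>x\<^sub>2 = 1\<close>, and the image is the Rees algebra of the total degree filtration.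
\<close>

global_interpretation rees: poly3_eval "\<lambda>c :: 'k::field_char_0. [:[:[:c:]:]:]"
    "\<lambda>i. if i = 1 then monom (monom 1 1) 1 else if i = 2 then monom 1 1
      else monom (monom (monom 1 1) 0) 1"
  defines rees = rees.ev
  by unfold_locales (simp_all add: pCons_one)

lemma rees_mon:
  "rees.mon e = (monom (monom (monom 1 (Poly_Mapping.lookup e 3)) (Poly_Mapping.lookup e 1))
     (Poly_Mapping.lookup e 1 + Poly_Mapping.lookup e 2 + Poly_Mapping.lookup e 3)
     :: 'k::field_char_0 poly poly poly)"
proof -
  have "(\<Prod>i\<in>UNIV. F i) = F 1 * F 2 * F 3" for F :: "3 \<Rightarrow> 'k poly poly poly"
    unfolding UNIV_3 by (simp add: mult.assoc)
  moreover have "(1 :: 3) \<noteq> 3" "(2 :: 3) \<noteq> 3" "(2 :: 3) \<noteq> 1" "(3 :: 3) \<noteq> 1" "(3 :: 3) \<noteq> 2" by simp_all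
  ultimately show ?thesis
    unfolding rees.mon_def by (simp add: monom_power mult_monom add.commute)
qed

lemma coeff_rees:
  "coeff (coeff (coeff (rees f) k) i) j =
     (\<Sum>e\<in>Poly_Mapping.keys f. if Poly_Mapping.lookup e 3 = j \<and> Poly_Mapping.lookup e 1 = i \<and>
       Poly_Mapping.lookup e 1 + Poly_Mapping.lookup e 2 + Poly_Mapping.lookup e 3 = k
       then Poly_Mapping.lookup f e else 0)"
  unfolding rees.ev_def rees_mon coeff_sum
  by (intro sum.cong) (auto simp: smult_monom)

text \<open>The exponents of \<open>x\<close>, \<open>z\<close> and \<open>t\<close> in an image
  determine the monomial, the exponent of \<open>x_2\<close> being the difference from the
  degree.\<close>

lemma rees_inj:
  assumes "rees f = 0"
  shows "f = 0"
proof (rule poly_mapping_eqI)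
  fix e :: "3 \<Rightarrow>\<^sub>0 nat"
  have eq: "e' = e" if "Poly_Mapping.lookup e' 3 = Poly_Mapping.lookup e 3"
    "Poly_Mapping.lookup e' 1 = Poly_Mapping.lookup e 1"
    "Poly_Mapping.lookup e' 2 = Poly_Mapping.lookup e 2" for e' :: "3 \<Rightarrow>\<^sub>0 nat"
    by (rule poly_mapping_eqI) (metis exhaust_3 that)
  have iff: "Poly_Mapping.lookup e' 3 = Poly_Mapping.lookup e 3 \<and>
      Poly_Mapping.lookup e' 1 = Poly_Mapping.lookup e 1 \<and>
      Poly_Mapping.lookup e' 1 + Poly_Mapping.lookup e' 2 + Poly_Mapping.lookup e' 3 =
      Poly_Mapping.lookup e 1 + Poly_Mapping.lookup e 2 + Poly_Mapping.lookup e 3 \<longleftrightarrow> e' = e" for e'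
    using eq[of e'] by auto
  have "0 = (\<Sum>e'\<in>Poly_Mapping.keys f. if e' = e then Poly_Mapping.lookup f e' else 0)"
    using coeff_rees[of f "Poly_Mapping.lookup e 1 + Poly_Mapping.lookup e 2 + Poly_Mapping.lookup e 3"
        "Poly_Mapping.lookup e 1" "Poly_Mapping.lookup e 3"]
    unfolding assms iff by (simp only: coeff_0)
  also have "\<dots> = Poly_Mapping.lookup f e" by (auto simp: in_keys_iff)
  finally show "Poly_Mapping.lookup f e = Poly_Mapping.lookup 0 e" by simp
qed

lemma bideg_le_coeff_rees: "bideg_le k (coeff (rees f) k)"
  unfolding bideg_le_def coeff_rees by (auto intro!: sum.neutral)

lemma rees_surj:
  assumes "bideg_le k f"
  obtains s where "rees s = monom f k"
proof -
  \<comment> \<open>The second variable receives the missing exponent. For \<open>i + j > k\<close>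
    the subtraction is truncated, but then the coefficient is 0.\<close>
  define e where "e i j = Poly_Mapping.single (1 :: 3) i + Poly_Mapping.single 2 (k - i - j)
      + Poly_Mapping.single 3 j" for i j
  define s where "s = (\<Sum>i\<le>k. \<Sum>j\<le>k. Poly_Mapping.single (e i j) (coeff (coeff f i) j))"
  have "rees s = (\<Sum>i\<le>k. \<Sum>j\<le>k. monom (smult [:coeff (coeff f i) j:] (monom (monom 1 j) i)) k)"
    unfolding s_def rees.ev_sum rees.ev_single rees_mon
  proof (intro sum.cong refl)
    fix i j
    show "[:[:[:coeff (coeff f i) j:]:]:] * monom (monom (monom 1 (Poly_Mapping.lookup (e i j) 3))
        (Poly_Mapping.lookup (e i j) 1)) (Poly_Mapping.lookup (e i j) 1
        + Poly_Mapping.lookup (e i j) 2 + Poly_Mapping.lookup (e i j) 3)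
      = monom (smult [:coeff (coeff f i) j:] (monom (monom 1 j) i)) k"
    proof (cases "i + j \<le> k")
      case True
      thus ?thesis by (simp add: e_def lookup_add lookup_single when_def smult_monom)
    next
      case False
      thus ?thesis using assms by (simp add: bideg_le_def)
    qed
  qed
  also have "\<dots> = monom f k"
    by (subst (2) bideg_le_sum_monoms[OF assms]) (simp flip: monom_sum)
  finally show ?thesis by (rule that)
qed

section \<open>Linear changes of coordinates\<close>

definition subst3 :: "'k::field ^ 3 ^ 3 \<Rightarrow> 'k poly3 \<Rightarrow> 'k poly3" where
  "subst3 M = poly3_eval.ev Const3 (\<lambda>j. linear_form (M $ j))"

lemma poly3_eval_subst3: "poly3_eval (Const3 :: 'k::field \<Rightarrow> _)"
  by unfold_locales (simp_all add: Const3_add Const3_mult)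

lemmas subst3_simps =
  poly3_eval.ev_add[OF poly3_eval_subst3, where v = "\<lambda>j. linear_form (M $ j)" for M, folded subst3_def]
  poly3_eval.ev_mult[OF poly3_eval_subst3, where v = "\<lambda>j. linear_form (M $ j)" for M, folded subst3_def]
  poly3_eval.ev_Const3[OF poly3_eval_subst3, where v = "\<lambda>j. linear_form (M $ j)" for M, folded subst3_def]
  poly3_eval.ev_Var3[OF poly3_eval_subst3, where v = "\<lambda>j. linear_form (M $ j)" for M, folded subst3_def]

lemma subst3_linear_form: "subst3 M (linear_form a) = linear_form (a v* M)"
  unfolding subst3_def
  by (simp add: poly3_eval.ev_linear_form[OF poly3_eval_subst3] linear_form_matrix)

lemma matrix_row_mult: "(N ** M) $ i = (N $ i) v* M" for M :: "'k::field ^ 'm ^ 'n"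
  by (simp add: vec_eq_iff matrix_matrix_mult_def vector_matrix_mult_def mult.commute)

lemma subst3_subst3: "subst3 M (subst3 N f) = subst3 (N ** M) f"
  by (induction f rule: poly3_induct)
    (simp_all add: subst3_simps subst3_linear_form matrix_row_mult)

lemma subst3_mat_1: "subst3 (mat 1) f = f"
proof (induction f rule: poly3_induct)
  case (Var i)
  have "mat 1 $ i = (axis i 1 :: 'a ^ 3)" by (simp add: vec_eq_iff mat_def axis_def)
  thus ?case by (simp add: subst3_simps linear_form_axis)
qed (simp_all add: subst3_simps)

text \<open>As \<open>rees\<close>, for the coordinates \<open>x, y, z\<close> given by the rows of the inverse of \<open>B\<close>.\<close>

definition dehom :: "'k::field_char_0 ^ 3 ^ 3 \<Rightarrow> 'k poly3 \<Rightarrow> 'k poly poly poly" where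
  "dehom B f = rees (subst3 B f)"

lemma dehom_add: "dehom B (f + g) = dehom B f + dehom B g"
  by (simp add: dehom_def subst3_simps rees.ev_add)

lemma dehom_mult: "dehom B (f * g) = dehom B f * dehom B g"
  by (simp add: dehom_def subst3_simps rees.ev_mult)

lemma dehom_Const3: "dehom B (Const3 a) = [:[:[:a:]:]:]"
  by (simp add: dehom_def subst3_simps)

lemma dehom_0 [simp]: "dehom B 0 = 0"
  using dehom_Const3[of B 0] by simp

lemma dehom_diff: "dehom B (f - g) = dehom B f - dehom B g"
  using dehom_add[of B "f - g" g] by (simp add: algebra_simps)

lemma dehom_sum: "dehom B (\<Sum>i\<in>A. f i) = (\<Sum>i\<in>A. dehom B (f i))"
  by (induction A rule: infinite_finite_induct) (auto simp: dehom_add)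

lemma dehom_linear_form:
  assumes "a v* B = vector [\<alpha>, \<beta>, \<gamma>]"
  shows "dehom B (linear_form a) = monom [:[:\<beta>, \<gamma>:], [:\<alpha>:]:] 1"
proof -
  have ne: "(2 :: 3) \<noteq> 3" "(2 :: 3) \<noteq> 1" "(3 :: 3) \<noteq> 1" "(3 :: 3) \<noteq> 2" by simp_all
  have "dehom B (linear_form a) = rees (linear_form (vector [\<alpha>, \<beta>, \<gamma>]))"
    by (simp add: dehom_def subst3_linear_form assms)
  also have "\<dots> = monom [:[:\<beta>, \<gamma>:], [:\<alpha>:]:] 1"
    using ne unfolding rees.ev_linear_form sum_3
    by (simp add: vector_3 smult_monom add_monom) (simp add: monom_altdef)
  finally show ?thesis .
qed

lemma bideg_le_coeff_dehom: "bideg_le k (coeff (dehom B f) k)"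
  by (simp add: dehom_def bideg_le_coeff_rees)

text \<open>The rows of \<open>A\<close> are the new coordinate forms, and \<open>a v* B\<close>
  lists the coefficients of the form \<open>a\<close> in them.\<close>

locale linear_coords =
  fixes A B :: "'k::field_char_0 ^ 3 ^ 3"
  assumes AB: "A ** B = mat 1" and BA: "B ** A = mat 1"
begin

lemma dehom_inj: "dehom B f = dehom B g \<Longrightarrow> f = g"
proof -
  assume "dehom B f = dehom B g"
  hence "rees (subst3 B (f - g)) = 0" using dehom_diff[of B f g] by (simp add: dehom_def)
  hence "subst3 B (f - g) = 0" by (rule rees_inj)
  hence "subst3 (B ** A) (f - g) = subst3 A 0" by (simp flip: subst3_subst3)
  moreover have "subst3 A 0 = 0" using subst3_simps(3)[of A 0] by simp
  ultimately show "f = g" by (simp add: BA subst3_mat_1)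
qed

lemma dehom_surj:
  assumes "bideg_le k f"
  obtains s where "dehom B s = monom f k"
proof -
  obtain s where "rees s = monom f k" using rees_surj[OF assms] .
  hence "dehom B (subst3 A s) = monom f k"
    by (simp add: dehom_def subst3_subst3 AB subst3_mat_1)
  thus ?thesis by (rule that)
qed

lemma coords_twice: "(a v* B) v* A = a" "(a v* A) v* B = a"
  by (simp_all add: vector_matrix_mul_assoc AB BA)

definition coord_value :: "('k poly3 \<Rightarrow> 'k poly3) \<Rightarrow> 3 \<Rightarrow> 'k poly3" where
  "coord_value \<theta> i = \<theta> (linear_form (A $ i))"

lemma derivation_coords:
  assumes "\<theta> \<in> derivations"
  shows "\<theta> (linear_form a) = (\<Sum>i\<in>UNIV. Const3 ((a v* B) $ i) * coord_value \<theta> i)"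
  using derivation_linear_form_matrix[OF assms, of "a v* B" A]
  by (simp add: coords_twice coord_value_def)

lemma derivation_coords_eqI:
  assumes "\<theta> \<in> derivations" "\<eta> \<in> derivations" "\<And>i. coord_value \<theta> i = coord_value \<eta> i"
  shows "\<theta> = \<eta>"
proof (rule derivation_eqI[OF assms(1,2)])
  show "\<theta> (Var3 i) = \<eta> (Var3 i)" for i
    using derivation_coords[OF assms(1), of "axis i 1"] derivation_coords[OF assms(2), of "axis i 1"]
    by (simp add: linear_form_axis assms(3))
qed

lemma derivation_with_coords:
  obtains \<theta> where "\<theta> \<in> derivations" "\<And>i. coord_value \<theta> i = F i"
proof -
  obtain \<theta> where \<theta>: "\<theta> \<in> derivations"
    "\<And>i. \<theta> (Var3 i) = (\<Sum>l\<in>UNIV. Const3 (B $ i $ l) * F l)"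
    using derivation_exists[of "\<lambda>i. \<Sum>l\<in>UNIV. Const3 (B $ i $ l) * F l"] by metis
  have "coord_value \<theta> j = F j" for j
  proof -
    have "coord_value \<theta> j = (\<Sum>i\<in>UNIV. \<Sum>l\<in>UNIV. Const3 (A $ j $ i) * (Const3 (B $ i $ l) * F l))"
      by (simp add: coord_value_def derivation_linear_form \<theta> sum_distrib_left)
    also have "\<dots> = (\<Sum>l\<in>UNIV. Const3 ((A ** B) $ j $ l) * F l)"
      by (subst sum.swap)
        (simp add: matrix_matrix_mult_def Const3_sum Const3_mult sum_distrib_right mult.assoc)
    also have "\<dots> = (\<Sum>l\<in>UNIV. if j = l then F l else 0)"
      unfolding AB by (intro sum.cong) (auto simp: mat_def)
    finally show ?thesis by simp
  qed
  thus ?thesis using that \<theta>(1) by blast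
qed

end

section \<open>Logarithmic derivations in adapted coordinates\<close>

definition normal_vector :: "('k::field ^ 3) set \<Rightarrow> 'k ^ 3" where
  "normal_vector H = (SOME a. form_kernel a = H)"

lemma defining_form_eq: "defining_form H = linear_form (normal_vector H)"
  by (simp add: defining_form_def normal_vector_def)

text \<open>A defining form is a chosen one, so \<open>s\<close> records its factor relative to
  \<open>x - p y + c z\<close>. The form of \<open>H0\<close> is the coordinate \<open>z\<close>
  itself.\<close>

locale arrangement_coords = affine_lines p c + linear_coords A B
  for p c :: "('k::field_char_0 ^ 3) set \<Rightarrow> 'k" and A B :: "'k ^ 3 ^ 3" +
  fixes \<A> :: "('k ^ 3) set set" and H0 :: "('k ^ 3) set" and s :: "('k ^ 3) set \<Rightarrow> 'k"
  assumes H0: "H0 \<in> \<A>" and normal_H0: "normal_vector H0 v* B = vector [0, 0, 1]"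
    and normal: "H \<in> \<A> - {H0} \<Longrightarrow> normal_vector H v* B = vector [s H, - s H * p H, s H * c H]"
    and s: "H \<in> \<A> - {H0} \<Longrightarrow> s H \<noteq> 0"
begin

lemma derivation_H0:
  assumes "\<theta> \<in> derivations"
  shows "\<theta> (defining_form H0) = coord_value \<theta> 3"
  by (simp add: defining_form_eq derivation_coords[OF assms] normal_H0 sum_3 vector_3)

lemma derivation_line:
  assumes "\<theta> \<in> derivations" "H \<in> \<A> - {H0}"
  shows "\<theta> (defining_form H) = Const3 (s H) *
     (coord_value \<theta> 1 - Const3 (p H) * coord_value \<theta> 2 + Const3 (c H) * coord_value \<theta> 3)"
proof -
  have "Const3 (- a) = - Const3 a" for a :: 'k
    using Const3_add[of "- a" a] by (simp add: eq_neg_iff_add_eq_0)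
  thus ?thesis
    by (simp add: defining_form_eq derivation_coords[OF assms(1)] normal[OF assms(2)] sum_3 vector_3
      Const3_mult algebra_simps)
qed

lemma dehom_H0: "dehom B (defining_form H0) = monom [:[:0, 1:]:] 1"
  by (simp add: defining_form_eq dehom_linear_form[OF normal_H0])

lemma dehom_line:
  assumes "H \<in> \<A> - {H0}"
  shows "dehom B (defining_form H) = monom (smult [:s H:] [:- [:p H, - c H:], 1:]) 1"
  by (simp add: defining_form_eq dehom_linear_form[OF normal[OF assms]])

text \<open>The forms have degree one in \<open>t\<close>, so divisibility can be read off in each
  degree, and a multiple of a form vanishes on its line.\<close>

lemma dlog_coeff:
  assumes \<theta>: "\<theta> \<in> log_derivations \<A>" and Z: "coord_value \<theta> 3 = 0"
  shows "(coeff (dehom B (coord_value \<theta> 1)) k, coeff (dehom B (coord_value \<theta> 2)) k)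
    \<in> dlog (\<A> - {H0}) k"
  unfolding dlog_def mem_Collect_eq split
proof (intro conjI ballI bideg_le_coeff_dehom)
  fix H assume H: "H \<in> \<A> - {H0}"
  define F where "F = dehom B (coord_value \<theta> 1)"
  define G where "G = dehom B (coord_value \<theta> 2)"
  have der: "\<theta> \<in> derivations" using \<theta> by (simp add: log_derivations_def)
  obtain q where "\<theta> (defining_form H) = defining_form H * q"
    using \<theta> H by (auto simp: log_derivations_def)
  hence "dehom B (\<theta> (defining_form H)) = dehom B (defining_form H) * dehom B q"
    by (simp add: dehom_mult)
  hence "smult [:[:s H:]:] (F - smult [:[:p H:]:] G)
      = monom (smult [:s H:] [:- [:p H, - c H:], 1:]) 1 * dehom B q"
    unfolding derivation_line[OF der H] dehom_line[OF H]
    by (simp add: Z dehom_mult dehom_diff dehom_Const3 F_def G_def)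
  hence "coeff (smult [:[:s H:]:] (F - smult [:[:p H:]:] G)) k
      = coeff (monom (smult [:s H:] [:- [:p H, - c H:], 1:]) 1 * dehom B q) k" by simp
  hence "[:[:s H:]:] * (coeff F k - [:[:p H:]:] * coeff G k)
      = (if k < 1 then 0 else smult [:s H:] [:- [:p H, - c H:], 1:] * coeff (dehom B q) (k - 1))"
    by (simp only: coeff_smult coeff_diff coeff_monom_mult)
  hence "poly ([:[:s H:]:] * (coeff F k - [:[:p H:]:] * coeff G k)) [:p H, - c H:] = 0"
    by (auto split: if_splits simp del: mult_pCons_left)
  hence "[:s H:] * (poly (coeff F k) [:p H, - c H:] - [:p H:] * poly (coeff G k) [:p H, - c H:]) = 0"
    by simp
  thus "poly (coeff (dehom B (coord_value \<theta> 1)) k) [:p H, - c H:]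
      = [:p H:] * poly (coeff (dehom B (coord_value \<theta> 2)) k) [:p H, - c H:]"
    using s[OF H] by (simp add: F_def G_def)
qed

text \<open>Vanishing on a line gives a quotient \<open>q\<close> of total degree below
  \<open>d\<close>, which comes from an element of \<open>S\<close>. Injectivity of
  \<open>dehom\<close> carries the divisibility back.\<close>

lemma log_derivation_of_dlog:
  assumes fg: "(f, g) \<in> dlog (\<A> - {H0}) d"
  obtains \<theta> where "\<theta> \<in> log_derivations \<A>" "coord_value \<theta> 3 = 0"
    "dehom B (coord_value \<theta> 1) = monom f d" "dehom B (coord_value \<theta> 2) = monom g d"
proof -
  obtain sf where sf: "dehom B sf = monom f d"
    using fg dehom_surj[of d f] by (auto simp: dlog_def)
  obtain sg where sg: "dehom B sg = monom g d"
    using fg dehom_surj[of d g] by (auto simp: dlog_def)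
  obtain \<theta> where \<theta>: "\<theta> \<in> derivations"
    "\<And>i. coord_value \<theta> i = (if i = 1 then sf else if i = 2 then sg else 0)"
    using derivation_with_coords[of "\<lambda>i. if i = 1 then sf else if i = 2 then sg else 0"] by metis
  have "(2 :: 3) \<noteq> 1" "(3 :: 3) \<noteq> 1" "(3 :: 3) \<noteq> 2" by simp_all
  hence val: "coord_value \<theta> 1 = sf" "coord_value \<theta> 2 = sg" "coord_value \<theta> 3 = 0"
    by (simp_all add: \<theta>(2))
  have "defining_form H dvd \<theta> (defining_form H)" if "H \<in> \<A>" for H
  proof (cases "H = H0")
    case True
    thus ?thesis by (simp add: derivation_H0 \<theta>(1) val)
  next
    case False
    hence H: "H \<in> \<A> - {H0}" using that by simp
    have "poly (f - smult [:p H:] g) [:p H, - c H:] = 0"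
      using fg H by (auto simp: dlog_def)
    then obtain q where q: "f - smult [:p H:] g = [:- [:p H, - c H:], 1:] * q"
      by (auto simp only: poly_eq_0_iff_dvd dvd_def)
    have "bideg_le d (f - smult [:p H:] g)"
      using fg by (auto simp: dlog_def intro: bideg_le_diff bideg_le_smult_const)
    hence co: "coeff (coeff q i) j = 0" if "d \<le> i + j" for i j
      unfolding q using that by (rule bideg_le_quotient)
    have "\<exists>q'. monom [:- [:p H, - c H:], 1:] 1 * dehom B q' = monom (f - smult [:p H:] g) d"
    proof (cases d)
      case 0
      hence "q = 0" using co by (simp add: poly_eq_iff)
      hence "monom [:- [:p H, - c H:], 1:] 1 * dehom B 0 = monom (f - smult [:p H:] g) d"
        unfolding q by simp
      thus ?thesis ..
    next
      case (Suc e)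
      have "bideg_le e q" unfolding bideg_le_def using co Suc by auto
      then obtain q' where "dehom B q' = monom q e" using dehom_surj by blast
      hence "monom [:- [:p H, - c H:], 1:] 1 * dehom B q' = monom (f - smult [:p H:] g) d"
        unfolding q Suc by (simp only: mult_monom) simp
      thus ?thesis ..
    qed
    then obtain q' where q': "monom [:- [:p H, - c H:], 1:] 1 * dehom B q' = monom (f - smult [:p H:] g) d"
      ..
    have "dehom B (defining_form H * q') = smult [:[:s H:]:] (monom [:- [:p H, - c H:], 1:] 1 * dehom B q')"
      unfolding dehom_mult dehom_line[OF H] mult_smult_left[symmetric] smult_monom by simp
    also have "\<dots> = smult [:[:s H:]:] (monom f d - smult [:[:p H:]:] (monom g d))"
      unfolding q' by (simp add: diff_monom smult_monom)
    also have "\<dots> = dehom B (\<theta> (defining_form H))"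
      unfolding derivation_line[OF \<theta>(1) H] val
      by (simp add: dehom_mult dehom_diff dehom_Const3 sf sg)
    finally have "defining_form H * q' = \<theta> (defining_form H)" by (rule dehom_inj)
    thus ?thesis by (metis dvd_triv_left)
  qed
  hence "\<theta> \<in> log_derivations \<A>" using \<theta>(1) by (simp add: log_derivations_def)
  thus ?thesis using that val sf sg by simp
qed

text \<open>The Euler derivation fixes every linear form.\<close>

lemma euler_derivation:
  obtains \<theta> where "\<theta> \<in> log_derivations \<A>" "coord_value \<theta> 3 = defining_form H0"
proof -
  obtain \<theta> where \<theta>: "\<theta> \<in> derivations" "\<And>i. coord_value \<theta> i = linear_form (A $ i)"
    using derivation_with_coords[of "\<lambda>i. linear_form (A $ i)"] by metis
  have "\<theta> (linear_form a) = linear_form a" for a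
    using derivation_coords[OF \<theta>(1), of a] linear_form_matrix[of "a v* B" A]
    by (simp add: \<theta>(2) coords_twice)
  hence "\<theta> \<in> log_derivations \<A>" "\<theta> (defining_form H0) = defining_form H0"
    using \<theta>(1) by (simp_all add: log_derivations_def defining_form_eq)
  thus ?thesis using that derivation_H0[OF \<theta>(1)] by simp
qed

lemma log_derivationsD: "\<theta> \<in> log_derivations \<A> \<Longrightarrow> \<theta> \<in> derivations"
  by (simp add: log_derivations_def)

lemma log_derivations_map_scale:
  "\<theta> \<in> log_derivations \<A> \<Longrightarrow> map_scale q \<theta> \<in> log_derivations \<A>"
  by (rule S_maps.subspace_scale[OF subspace_log_derivations])

lemma log_derivations_add:
  "\<theta> \<in> log_derivations \<A> \<Longrightarrow> \<eta> \<in> log_derivations \<A> \<Longrightarrow> \<theta> + \<eta> \<in> log_derivations \<A>"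
  by (rule S_maps.subspace_add[OF subspace_log_derivations])

lemma coord_value_map_scale [simp]: "coord_value (map_scale q \<theta>) i = q * coord_value \<theta> i"
  by (simp add: coord_value_def map_scale_def)

lemma coord_value_add [simp]: "coord_value (\<theta> + \<eta>) i = coord_value \<theta> i + coord_value \<eta> i"
  by (simp add: coord_value_def)

lemma coord_value_diff [simp]: "coord_value (\<theta> - \<eta>) i = coord_value \<theta> i - coord_value \<eta> i"
  by (simp add: coord_value_def)

lemma coord_value_0 [simp]: "coord_value 0 i = 0"
  by (simp add: coord_value_def)

text \<open>A multiple of the Euler derivation absorbs the value on \<open>z\<close>. The rest kills
  \<open>z\<close> and is written by \<open>gen\<close> in each degree; the coefficients of the
  finitely many degrees are then added.\<close>

theorem free_if_dlog_basis:
  assumes u: "(f, g) \<in> dlog (\<A> - {H0}) d" and v: "(f', g') \<in> dlog (\<A> - {H0}) d'"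
    and det: "f * g' - f' * g \<noteq> 0"
    and gen: "\<And>F G k. (F, G) \<in> dlog (\<A> - {H0}) k \<Longrightarrow>
      \<exists>a b. lincomb_deg d d' k a b \<and> F = a * f + b * f' \<and> G = a * g + b * g'"
  shows "free_arrangement \<A>"
proof -
  obtain \<theta>0 where \<theta>0: "\<theta>0 \<in> log_derivations \<A>" "coord_value \<theta>0 3 = defining_form H0"
    by (rule euler_derivation)
  obtain \<theta>1 where \<theta>1: "\<theta>1 \<in> log_derivations \<A>" "coord_value \<theta>1 3 = 0"
    "dehom B (coord_value \<theta>1 1) = monom f d" "dehom B (coord_value \<theta>1 2) = monom g d"
    by (rule log_derivation_of_dlog[OF u])
  obtain \<theta>2 where \<theta>2: "\<theta>2 \<in> log_derivations \<A>" "coord_value \<theta>2 3 = 0"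
    "dehom B (coord_value \<theta>2 1) = monom f' d'" "dehom B (coord_value \<theta>2 2) = monom g' d'"
    by (rule log_derivation_of_dlog[OF v])
  have nz: "q = 0" if "dehom B q * monom r k = 0" "r \<noteq> 0" for q k r
  proof -
    have "dehom B q = dehom B 0" using that by simp
    thus ?thesis by (rule dehom_inj)
  qed
  have indep: "q0 = 0 \<and> q1 = 0 \<and> q2 = 0"
    if zero: "map_scale q0 \<theta>0 + map_scale q1 \<theta>1 + map_scale q2 \<theta>2 = 0" for q0 q1 q2
  proof -
    have z: "q0 * coord_value \<theta>0 i + q1 * coord_value \<theta>1 i + q2 * coord_value \<theta>2 i = 0" for i
      using arg_cong[OF zero, of "\<lambda>\<theta>. coord_value \<theta> i"] by simp
    have "q0 * defining_form H0 = 0"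
      using z[of 3] unfolding \<theta>0(2) \<theta>1(2) \<theta>2(2) mult_zero_right add_0_right .
    hence "dehom B (q0 * defining_form H0) = 0" by (simp only: dehom_0)
    hence q0: "q0 = 0" unfolding dehom_mult dehom_H0 by (rule nz) simp
    have "dehom B (q1 * coord_value \<theta>1 i + q2 * coord_value \<theta>2 i) = dehom B 0" for i
      using z[of i] by (simp add: q0)
    from this[of 1] this[of 2]
    have e1: "dehom B q1 * monom f d + dehom B q2 * monom f' d' = 0"
      and e2: "dehom B q1 * monom g d + dehom B q2 * monom g' d' = 0"
      by (simp_all add: dehom_add dehom_mult \<theta>1 \<theta>2)
    \<comment> \<open>Cramer's rule: eliminating the other coefficient leaves a multiple of the
      nonzero determinant.\<close>
    have "dehom B q1 * (monom f d * monom g' d' - monom f' d' * monom g d)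
        = (dehom B q1 * monom f d + dehom B q2 * monom f' d') * monom g' d'
          - (dehom B q1 * monom g d + dehom B q2 * monom g' d') * monom f' d'"
      by (simp only: algebra_simps)
    hence "dehom B q1 * monom (f * g' - f' * g) (d + d') = 0"
      by (simp add: e1 e2 mult_monom add.commute[of d' d] flip: diff_monom)
    hence q1: "q1 = 0" using det by (rule nz)
    have "dehom B q2 * (monom f d * monom g' d' - monom f' d' * monom g d)
        = (dehom B q1 * monom g d + dehom B q2 * monom g' d') * monom f d
          - (dehom B q1 * monom f d + dehom B q2 * monom f' d') * monom g d"
      by (simp only: algebra_simps)
    hence "dehom B q2 * monom (f * g' - f' * g) (d + d') = 0"
      by (simp add: e1 e2 mult_monom add.commute[of d' d] flip: diff_monom)
    hence q2: "q2 = 0" using det by (rule nz)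
    show ?thesis using q0 q1 q2 by simp
  qed
  have scale: "map_scale 1 \<theta> = \<theta>" "map_scale 0 \<theta> = 0" "map_scale (- 1) \<theta> = - \<theta>"
    for \<theta> :: "'k poly3 \<Rightarrow> 'k poly3"
    by (simp_all add: map_scale_def fun_eq_iff)
  \<comment> \<open>A coincidence would be a relation with coefficients 1 and -1.\<close>
  have ne: "\<theta>0 \<noteq> \<theta>1" "\<theta>0 \<noteq> \<theta>2" "\<theta>1 \<noteq> \<theta>2"
    using indep[of 1 "- 1" 0] indep[of 1 0 "- 1"] indep[of 0 1 "- 1"] by (auto simp: scale)
  have "S_maps.independent {\<theta>0, \<theta>1, \<theta>2}"
    using ne indep by (auto simp: S_maps.dependent_finite add.assoc)
  moreover have "S_maps.span {\<theta>0, \<theta>1, \<theta>2} = log_derivations \<A>"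
  proof
    show "S_maps.span {\<theta>0, \<theta>1, \<theta>2} \<subseteq> log_derivations \<A>"
      using \<theta>0 \<theta>1 \<theta>2 by (intro S_maps.span_minimal subspace_log_derivations) auto
    show "log_derivations \<A> \<subseteq> S_maps.span {\<theta>0, \<theta>1, \<theta>2}"
    proof
      fix \<theta> assume \<theta>: "\<theta> \<in> log_derivations \<A>"
      have "defining_form H0 dvd \<theta> (defining_form H0)"
        using \<theta> H0 by (simp add: log_derivations_def)
      then obtain q where q: "coord_value \<theta> 3 = defining_form H0 * q"
        unfolding derivation_H0[OF log_derivationsD[OF \<theta>]] by (elim dvdE)
      define \<eta> where "\<eta> = \<theta> - map_scale q \<theta>0"
      have \<eta>: "\<eta> \<in> log_derivations \<A>"
        unfolding \<eta>_def using \<theta>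
        by (intro S_maps.subspace_diff subspace_log_derivations log_derivations_map_scale \<theta>0)
      have \<eta>3: "coord_value \<eta> 3 = 0" by (simp add: \<eta>_def q \<theta>0 algebra_simps)
      define F where "F = dehom B (coord_value \<eta> 1)"
      define G where "G = dehom B (coord_value \<eta> 2)"
      have "\<exists>a b. lincomb_deg d d' k a b \<and> coeff F k = a * f + b * f' \<and> coeff G k = a * g + b * g'" for k
        unfolding F_def G_def by (rule gen[OF dlog_coeff[OF \<eta> \<eta>3]])
      then obtain a b where ab: "\<And>k. lincomb_deg d d' k (a k) (b k)"
        "\<And>k. coeff F k = a k * f + b k * f'" "\<And>k. coeff G k = a k * g + b k * g'"
        by metis
      have "\<exists>qa. dehom B qa = monom (a k) (k - d)" "\<exists>qb. dehom B qb = monom (b k) (k - d')" for k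
      proof -
        have "bideg_le (k - d) (a k)" "bideg_le (k - d') (b k)"
          using ab(1)[of k] by (auto simp: lincomb_deg_def)
        thus "\<exists>qa. dehom B qa = monom (a k) (k - d)" "\<exists>qb. dehom B qb = monom (b k) (k - d')"
          using dehom_surj by metis+
      qed
      then obtain qa qb where qab: "\<And>k. dehom B (qa k) = monom (a k) (k - d)"
        "\<And>k. dehom B (qb k) = monom (b k) (k - d')" by metis
      define N where "N = max (degree F) (degree G)"
      define Qa where "Qa = (\<Sum>k\<le>N. qa k)"
      define Qb where "Qb = (\<Sum>k\<le>N. qb k)"
      have sum: "dehom B Qa * monom x d + dehom B Qb * monom y d'
          = (\<Sum>k\<le>N. monom (a k * x + b k * y) k)" for x y
      proof -
        \<comment> \<open>For \<open>k < d\<close> or \<open>k < d'\<close> the respective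
          coefficient is 0; otherwise the exponents add up to \<open>k\<close>.\<close>
        have "monom (a k) (k - d) * monom x d = monom (a k * x) k"
          "monom (b k) (k - d') * monom y d' = monom (b k * y) k" for k
          using ab(1)[of k] by (auto simp: lincomb_deg_def mult_monom)
        thus ?thesis
          by (simp add: Qa_def Qb_def dehom_sum qab sum_distrib_right sum.distrib flip: add_monom)
      qed
      have F: "F = (\<Sum>k\<le>N. monom (coeff F k) k)" and G: "G = (\<Sum>k\<le>N. monom (coeff G k) k)"
        by (simp_all add: poly_as_sum_of_monoms' N_def)
      have "dehom B (coord_value \<eta> 1) = dehom B (Qa * coord_value \<theta>1 1 + Qb * coord_value \<theta>2 1)"
        using F by (simp add: dehom_add dehom_mult \<theta>1 \<theta>2 sum ab(2) flip: F_def)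
      hence 1: "coord_value \<eta> 1 = Qa * coord_value \<theta>1 1 + Qb * coord_value \<theta>2 1"
        by (rule dehom_inj)
      have "dehom B (coord_value \<eta> 2) = dehom B (Qa * coord_value \<theta>1 2 + Qb * coord_value \<theta>2 2)"
        using G by (simp add: dehom_add dehom_mult \<theta>1 \<theta>2 sum ab(3) flip: G_def)
      hence 2: "coord_value \<eta> 2 = Qa * coord_value \<theta>1 2 + Qb * coord_value \<theta>2 2"
        by (rule dehom_inj)
      have "\<eta> = map_scale Qa \<theta>1 + map_scale Qb \<theta>2"
      proof (rule derivation_coords_eqI)
        show "\<eta> \<in> derivations" using \<eta> by (rule log_derivationsD)
        show "map_scale Qa \<theta>1 + map_scale Qb \<theta>2 \<in> derivations"
          by (intro log_derivationsD log_derivations_add log_derivations_map_scale \<theta>1 \<theta>2)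
        show "coord_value \<eta> i = coord_value (map_scale Qa \<theta>1 + map_scale Qb \<theta>2) i" for i
          using exhaust_3[of i] 1 2 by (auto simp: \<eta>3 \<theta>1 \<theta>2)
      qed
      moreover have "\<theta> = \<eta> + map_scale q \<theta>0"
        by (simp add: \<eta>_def fun_eq_iff map_scale_def)
      ultimately have "\<theta> = map_scale Qa \<theta>1 + map_scale Qb \<theta>2 + map_scale q \<theta>0" by simp
      also have "\<dots> \<in> S_maps.span {\<theta>0, \<theta>1, \<theta>2}"
        by (intro S_maps.span_add S_maps.span_scale S_maps.span_base) auto
      finally show "\<theta> \<in> S_maps.span {\<theta>0, \<theta>1, \<theta>2}" .
    qed
  qed
  ultimately show ?thesis unfolding free_arrangement_def by blast
qed

end

subsection \<open>Intersection points and the characteristic polynomial\<close>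

definition pairing :: "'k::field ^ 3 \<Rightarrow> 'k ^ 3 \<Rightarrow> 'k" where
  "pairing a x = a $ 1 * x $ 1 + a $ 2 * x $ 2 + a $ 3 * x $ 3"

definition cross :: "'k::field ^ 3 \<Rightarrow> 'k ^ 3 \<Rightarrow> 'k ^ 3" where
  "cross a b = vector [a $ 2 * b $ 3 - a $ 3 * b $ 2, a $ 3 * b $ 1 - a $ 1 * b $ 3,
     a $ 1 * b $ 2 - a $ 2 * b $ 1]"

lemma cross_nth [simp]:
  "cross a b $ 1 = a $ 2 * b $ 3 - a $ 3 * b $ 2"
  "cross a b $ 2 = a $ 3 * b $ 1 - a $ 1 * b $ 3"
  "cross a b $ 3 = a $ 1 * b $ 2 - a $ 2 * b $ 1"
  by (simp_all add: cross_def vector_3)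

lemma form_kernel_pairing: "form_kernel a = {x. pairing a x = 0}"
  by (simp add: form_kernel_def pairing_def sum_3)

lemma vec3_ne_0: "n \<noteq> 0 \<longleftrightarrow> n $ 1 \<noteq> 0 \<or> n $ 2 \<noteq> 0 \<or> n $ 3 \<noteq> 0" for n :: "'k::field ^ 3"
  by (auto simp: vec_eq_iff forall_3)

lemma proportional_if_cross_0:
  assumes "cross a b = 0" "a \<noteq> 0"
  obtains l where "b = l *s a"
proof -
  have e: "a $ 2 * b $ 3 = a $ 3 * b $ 2" "a $ 3 * b $ 1 = a $ 1 * b $ 3" "a $ 1 * b $ 2 = a $ 2 * b $ 1"
    using assms(1) cross_nth[of a b] by simp_all
  consider "a $ 1 \<noteq> 0" | "a $ 2 \<noteq> 0" | "a $ 3 \<noteq> 0" using assms(2) vec3_ne_0 by blast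
  thus ?thesis
  proof cases
    case 1
    thus ?thesis using e
      by (intro that[of "b $ 1 / a $ 1"]) (auto simp: vec_eq_iff forall_3 field_simps)
  next
    case 2
    thus ?thesis using e
      by (intro that[of "b $ 2 / a $ 2"]) (auto simp: vec_eq_iff forall_3 field_simps)
  next
    case 3
    thus ?thesis using e
      by (intro that[of "b $ 3 / a $ 3"]) (auto simp: vec_eq_iff forall_3 field_simps)
  qed
qed

lemma kernel_inter:
  assumes "cross a b \<noteq> 0"
  shows "form_kernel a \<inter> form_kernel b = vec.span {cross a b}"
proof
  show "vec.span {cross a b} \<subseteq> form_kernel a \<inter> form_kernel b"
    by (auto simp: vec.span_singleton form_kernel_pairing)
      (simp_all add: pairing_def algebra_simps)
  show "form_kernel a \<inter> form_kernel b \<subseteq> vec.span {cross a b}"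
  proof
    fix x assume "x \<in> form_kernel a \<inter> form_kernel b"
    hence e: "a $ 1 * x $ 1 + a $ 2 * x $ 2 + a $ 3 * x $ 3 = 0"
      "b $ 1 * x $ 1 + b $ 2 * x $ 2 + b $ 3 * x $ 3 = 0"
      by (simp_all add: form_kernel_pairing pairing_def)
    \<comment> \<open>By the triple product identity it equals
      \<open>pairing a x *s b - pairing b x *s a\<close>.\<close>
    have "cross (cross a b) x = 0"
      unfolding vec_eq_iff forall_3 cross_nth zero_index using e by (intro conjI) algebra+
    then obtain l where "x = l *s cross a b"
      using proportional_if_cross_0 assms by blast
    thus "x \<in> vec.span {cross a b}" by (auto simp: vec.span_singleton)
  qed
qed

text \<open>On the curve \<open>(1, t, t^2)\<close> each pairing is a nonzero polynomial in
  \<open>t\<close>, and the field is infinite.\<close>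

lemma generic_vector:
  fixes N :: "('k::field_char_0 ^ 3) set"
  assumes "finite N" "0 \<notin> N"
  obtains w where "\<And>n. n \<in> N \<Longrightarrow> pairing n w \<noteq> 0"
proof -
  define P where "P = (\<Prod>n\<in>N. [:n $ 1, n $ 2, n $ 3:])"
  have "P \<noteq> 0"
    using assms vec3_ne_0 by (auto simp: P_def)
  hence "finite {t. poly P t = 0}" by (rule poly_roots_finite)
  then obtain t where t: "poly P t \<noteq> 0"
    using ex_new_if_finite[OF infinite_UNIV_char_0] by blast
  have "pairing n (vector [1, t, t ^ 2]) \<noteq> 0" if "n \<in> N" for n
    using t that assms(1) by (auto simp: P_def poly_prod pairing_def vector_3 algebra_simps power2_eq_square)
  thus ?thesis using that by blast
qed

lemma hyperplane_normal:
  assumes "hyperplane H"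
  shows "form_kernel (normal_vector H) = H" "normal_vector H \<noteq> 0"
proof -
  show *: "form_kernel (normal_vector H) = H"
    using form_kernel_defining_vector[OF assms] by (simp add: normal_vector_def)
  show "normal_vector H \<noteq> 0"
  proof
    assume "normal_vector H = 0"
    hence "H = UNIV" using * by (auto simp: form_kernel_pairing pairing_def)
    thus False using assms by (simp add: hyperplane_def vec.dim_UNIV card_cart_basis)
  qed
qed

lemma cross_normal_ne_0:
  assumes "hyperplane H" "hyperplane K" "H \<noteq> K"
  shows "cross (normal_vector H) (normal_vector K) \<noteq> 0"
proof
  assume "cross (normal_vector H) (normal_vector K) = 0"
  then obtain l where l: "normal_vector K = l *s normal_vector H"
    using proportional_if_cross_0 hyperplane_normal(2)[OF assms(1)] by blast
  moreover have "l \<noteq> 0" using l hyperplane_normal(2)[OF assms(2)] by auto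
  ultimately have "pairing (normal_vector K) x = 0 \<longleftrightarrow> pairing (normal_vector H) x = 0" for x
    by (simp add: pairing_def mult.assoc flip: distrib_left)
  hence "form_kernel (normal_vector H) = form_kernel (normal_vector K)"
    by (simp add: form_kernel_pairing)
  thus False using assms by (simp add: hyperplane_normal)
qed

lemma dim_hyperplane_inter:
  assumes "hyperplane H" "hyperplane K" "H \<noteq> K"
  shows "vec.dim (H \<inter> K) = 1"
proof -
  have "H \<inter> K = vec.span {cross (normal_vector H) (normal_vector K)}"
    using kernel_inter[OF cross_normal_ne_0[OF assms]] assms by (simp add: hyperplane_normal)
  thus ?thesis using cross_normal_ne_0[OF assms] by simp
qed

declare card_cart_basis [simp]

lemma dim_UNIV3: "vec.dim (UNIV :: ('k::field ^ 3) set) = 3"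
  by simp

locale central_arrangement =
  fixes \<A> :: "('k::field_char_0 ^ 3) set set"
  assumes arr: "arrangement \<A>"
begin

lemma finite_\<A>: "finite \<A>" and hyp: "H \<in> \<A> \<Longrightarrow> hyperplane H"
  using arr by (auto simp: arrangement_def)

lemma lattice_subspace: "X \<in> intersection_lattice \<A> \<Longrightarrow> vec.subspace X"
  using hyp by (auto simp: intersection_lattice_def hyperplane_def intro!: vec.subspace_Inter)

lemma in_lattice: "H \<in> \<A> \<Longrightarrow> H \<in> intersection_lattice \<A>" "UNIV \<in> intersection_lattice \<A>"
  "H \<in> \<A> \<Longrightarrow> K \<in> \<A> \<Longrightarrow> H \<inter> K \<in> intersection_lattice \<A>"
  unfolding intersection_lattice_def
  by (auto intro: exI[of _ "{H}"] exI[of _ "{}"] exI[of _ "{H, K}"])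

text \<open>Two distinct hyperplanes already bound the dimension by 1, so the third case collects
  all lower elements.\<close>

lemma lattice_cases:
  assumes "X \<in> intersection_lattice \<A>"
  obtains "X = UNIV" | "X \<in> \<A>" | H K where "H \<in> \<A>" "K \<in> \<A>" "H \<noteq> K" "X \<subseteq> H \<inter> K"
proof -
  obtain \<B> where B: "\<B> \<subseteq> \<A>" "X = \<Inter>\<B>" using assms by (auto simp: intersection_lattice_def)
  show ?thesis
  proof (cases "\<exists>H\<in>\<B>. \<exists>K\<in>\<B>. H \<noteq> K")
    case True
    then obtain H K where "H \<in> \<B>" "K \<in> \<B>" "H \<noteq> K" by blast
    thus ?thesis using that(3)[of H K] B by blast
  next
    case False
    hence "\<B> = {} \<or> (\<exists>H. \<B> = {H})" by blast
    thus ?thesis using that(1,2) B by auto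
  qed
qed

lemma dim_le_1: "H \<in> \<A> \<Longrightarrow> K \<in> \<A> \<Longrightarrow> H \<noteq> K \<Longrightarrow> X \<subseteq> H \<inter> K \<Longrightarrow> vec.dim X \<le> 1"
  using dim_hyperplane_inter[of H K] vec.dim_subset[of X "H \<inter> K"] hyp by simp

lemma lattice_dim_2: "{X \<in> intersection_lattice \<A>. vec.dim X = 2} = \<A>"
proof (intro equalityI subsetI)
  fix X assume "X \<in> {X \<in> intersection_lattice \<A>. vec.dim X = 2}"
  hence X: "X \<in> intersection_lattice \<A>" "vec.dim X = 2" by auto
  from X(1) show "X \<in> \<A>"
  proof (cases rule: lattice_cases)
    case (3 H K)
    thus ?thesis using dim_le_1[of H K X] X(2) by simp
  qed (use X(2) in auto)
qed (use hyp in \<open>auto simp: in_lattice hyperplane_def\<close>)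

definition points :: "('k ^ 3) set set" where
  "points = {X \<in> intersection_lattice \<A>. vec.dim X = 1}"

definition point_mult :: "('k ^ 3) set \<Rightarrow> nat" where
  "point_mult X = card {H \<in> \<A>. X \<subseteq> H}"

text \<open>The linear coefficient of the characteristic polynomial, as
  \<open>point_mult X - 1\<close> is the Moebius value at \<open>X\<close>.\<close>

definition b2 :: nat where
  "b2 = (\<Sum>X\<in>points. point_mult X - 1)"

lemma finite_points: "finite points"
  unfolding points_def using finite_intersection_lattice[OF finite_\<A>] by simp

lemma inter_in_points: "H \<in> \<A> \<Longrightarrow> K \<in> \<A> \<Longrightarrow> H \<noteq> K \<Longrightarrow> H \<inter> K \<in> points"
  by (simp add: points_def in_lattice dim_hyperplane_inter hyp)

lemma pointsE:
  assumes "X \<in> points"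
  obtains H K where "H \<in> \<A>" "K \<in> \<A>" "H \<noteq> K" "X = H \<inter> K"
proof -
  have X: "X \<in> intersection_lattice \<A>" "vec.dim X = 1" using assms by (auto simp: points_def)
  from X(1) show ?thesis
  proof (cases rule: lattice_cases)
    case (3 H K)
    have "vec.subspace (H \<inter> K)" using 3 in_lattice(3) lattice_subspace by blast
    hence "X = H \<inter> K"
      using vec.subspace_dim_equal[OF lattice_subspace[OF X(1)], of "H \<inter> K"] 3 X(2)
        dim_hyperplane_inter[of H K] hyp by simp
    thus ?thesis using that 3 by blast
  qed (use X(2) hyp in \<open>auto simp: dim_UNIV3 hyperplane_def\<close>)
qed

lemma point_mult_ge_2:
  assumes "H \<in> \<A>" "K \<in> \<A>" "H \<noteq> K" "X \<subseteq> H \<inter> K"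
  shows "point_mult X \<ge> 2"
proof -
  have "card {H, K} \<le> point_mult X"
    unfolding point_mult_def using assms finite_\<A> by (intro card_mono) auto
  thus ?thesis using assms by simp
qed

lemma moebius_UNIV: "moebius \<A> UNIV = 1"
  by (subst moebius.simps) (simp add: finite_\<A>)

lemma moebius_hyperplane:
  assumes "H \<in> \<A>"
  shows "moebius \<A> H = - 1"
proof -
  have ne: "H \<noteq> UNIV" using hyp[OF assms] by (auto simp: hyperplane_def dim_UNIV3)
  have "Y = UNIV" if "Y \<in> intersection_lattice \<A>" "H \<subset> Y" for Y
  proof -
    have "vec.dim Y > 2"
      using vec.dim_psubset[of H Y] that lattice_subspace hyp[OF assms]
      by (simp add: hyperplane_def vec.span_eq_iff[THEN iffD2])
    hence "vec.dim Y = 3" using vec.dim_subset_UNIV[of Y] by (simp add: vec.dimension_def card_cart_basis)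
    thus ?thesis using vec.subspace_dim_equal[OF lattice_subspace[OF that(1)], of UNIV]
      by (simp add: dim_UNIV3)
  qed
  hence "{Y \<in> intersection_lattice \<A>. H \<subset> Y} = {UNIV}"
    using ne in_lattice(2) by auto
  thus ?thesis using ne by (subst moebius.simps) (simp add: finite_\<A> moebius_UNIV)
qed

text \<open>Strictly above \<open>X\<close> lie only \<open>V\<close> and the hyperplanes through
  \<open>X\<close>, with values 1 and -1.\<close>

lemma moebius_point:
  assumes "X \<in> points"
  shows "moebius \<A> X = int (point_mult X - 1)"
proof -
  have X: "X \<in> intersection_lattice \<A>" "vec.dim X = 1" using assms by (auto simp: points_def)
  have ne: "X \<noteq> UNIV" using X(2) by (auto simp: dim_UNIV3)
  have dimA: "vec.dim H = 2" if "H \<in> \<A>" for H using hyp[OF that] by (simp add: hyperplane_def)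
  have "Y = UNIV \<or> Y \<in> \<A>" if Y: "Y \<in> intersection_lattice \<A>" "X \<subset> Y" for Y
    using Y(1)
  proof (cases rule: lattice_cases)
    case (3 H K)
    hence "vec.dim Y \<le> 1" by (intro dim_le_1)
    moreover have "vec.dim X < vec.dim Y"
      using vec.dim_psubset[of X Y] Y lattice_subspace X(1) by (simp add: vec.span_eq_iff[THEN iffD2])
    ultimately show ?thesis using X(2) by simp
  qed auto
  moreover have "X \<noteq> H" if "H \<in> \<A>" for H using dimA[OF that] X(2) by auto
  ultimately have "{Y \<in> intersection_lattice \<A>. X \<subset> Y} = insert UNIV {H \<in> \<A>. X \<subseteq> H}"
    using ne in_lattice(1,2) by blast
  moreover have "UNIV \<notin> \<A>" using dimA[of UNIV] by (auto simp: dim_UNIV3)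
  moreover have "(\<Sum>H | H \<in> \<A> \<and> X \<subseteq> H. moebius \<A> H) = - int (point_mult X)"
    by (simp add: moebius_hyperplane point_mult_def)
  moreover have "point_mult X \<ge> 2"
    using assms by (elim pointsE) (auto intro: point_mult_ge_2)
  ultimately show ?thesis
    using ne by (subst moebius.simps) (simp add: finite_\<A> moebius_UNIV)
qed

lemma coeff_characteristic_poly:
  "coeff (characteristic_poly \<A>) i = (\<Sum>X | X \<in> intersection_lattice \<A> \<and> vec.dim X = i. moebius \<A> X)"
  unfolding characteristic_poly_def coeff_sum coeff_monom
  using finite_intersection_lattice[OF finite_\<A>] by (simp add: sum.If_cases Int_def)

lemma coeff_characteristic_poly_2: "coeff (characteristic_poly \<A>) 2 = - int (card \<A>)"
  unfolding coeff_characteristic_poly lattice_dim_2 by (simp add: moebius_hyperplane)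

lemma coeff_characteristic_poly_1: "coeff (characteristic_poly \<A>) 1 = int b2"
  unfolding coeff_characteristic_poly points_def[symmetric] b2_def
  by (simp add: moebius_point)

end

text \<open>Each point of \<open>H\<close> on an old hyperplane contributes one more than before: an
  old point gains a hyperplane, and a new point counts 1 instead of 0. No contribution
  drops.\<close>

lemma b2_insert:
  assumes "central_arrangement \<A>" "hyperplane H" "H \<notin> \<A>"
  shows "central_arrangement.b2 \<A> + card ((\<inter>) H ` \<A>) \<le> central_arrangement.b2 (insert H \<A>)"
proof -
  interpret O: central_arrangement \<A> by (rule assms)
  interpret N: central_arrangement "insert H \<A>"
    using O.arr assms(2) by unfold_locales (auto simp: arrangement_def)
  have sub: "O.points \<subseteq> N.points"
    by (auto elim!: O.pointsE intro: N.inter_in_points)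
  have img: "(\<inter>) H ` \<A> \<subseteq> N.points"
    using assms(3) by (auto intro: N.inter_in_points)
  have mono: "O.point_mult X \<le> N.point_mult X" for X
    unfolding O.point_mult_def N.point_mult_def
    using N.finite_\<A> by (intro card_mono) auto
  have "(if X \<in> O.points then O.point_mult X - 1 else 0) + (if X \<in> (\<inter>) H ` \<A> then 1 else 0)
      \<le> N.point_mult X - 1" for X
  proof (cases "X \<in> (\<inter>) H ` \<A>")
    case True
    then obtain K where K: "K \<in> \<A>" "X = H \<inter> K" by auto
    have "N.point_mult X \<ge> 2"
      using K assms(3) by (intro N.point_mult_ge_2[of H K]) auto
    moreover have "{K \<in> insert H \<A>. X \<subseteq> K} = insert H {K \<in> \<A>. X \<subseteq> K}" using K by auto
    hence "N.point_mult X = Suc (O.point_mult X)"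
      unfolding O.point_mult_def N.point_mult_def using assms(3) O.finite_\<A> by simp
    moreover have "O.point_mult X \<ge> 2" if "X \<in> O.points"
      using that by (elim O.pointsE) (auto intro: O.point_mult_ge_2)
    ultimately show ?thesis using True by auto
  next
    case False
    thus ?thesis using mono[of X] by auto
  qed
  hence "(\<Sum>X\<in>N.points. (if X \<in> O.points then O.point_mult X - 1 else 0)
      + (if X \<in> (\<inter>) H ` \<A> then 1 else 0)) \<le> N.b2"
    unfolding N.b2_def by (intro sum_mono)
  moreover have "(\<Sum>X\<in>N.points. if X \<in> O.points then O.point_mult X - 1 else 0) = O.b2"
    unfolding O.b2_def using sub N.finite_points
    by (simp add: sum.If_cases Int_absorb1)
  moreover have "(\<Sum>X\<in>N.points. if X \<in> (\<inter>) H ` \<A> then 1 else 0) = card ((\<inter>) H ` \<A>)"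
    using img N.finite_points by (simp add: sum.If_cases Int_absorb1)
  ultimately show ?thesis by (simp add: sum.distrib)
qed

section \<open>Choice of coordinates\<close>

lemma det_pairing_cross: "det M = pairing (cross (M $ 2) (M $ 3)) (M $ 1)"
  for M :: "'k::field ^ 3 ^ 3"
  by (simp add: det_3 pairing_def algebra_simps)

lemma (in central_arrangement) coords_exist:
  assumes H0: "H0 \<in> \<A>"
  obtains A B p c s where "arrangement_coords p c A B \<A> H0 s" "inj_on c (\<A> - {H0})"
proof -
  define a where "a = normal_vector H0"
  have a0: "a \<noteq> 0" and kera: "form_kernel a = H0"
    using hyperplane_normal[OF hyp[OF H0]] by (simp_all add: a_def)
  \<comment> \<open>Asking that \<open>w\<close> be nonzero on some \<open>n\<close> in
    \<open>H0\<close> keeps \<open>w\<close> from being a multiple of \<open>a\<close>.\<close>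
  have "vec.dim H0 = 2" using hyp[OF H0] by (simp add: hyperplane_def)
  then obtain n where n: "n \<in> H0" "n \<noteq> 0"
    using vec.dim_eq_0[of H0] by fastforce
  \<comment> \<open>The line \<open>w = 0\<close> avoids all intersection points, which makes the \<open>c\<close> distinct.\<close>
  define N where "N = insert n ((\<lambda>(H, K). cross (normal_vector H) (normal_vector K)) `
    {(H, K) \<in> \<A> \<times> \<A>. H \<noteq> K})"
  have "finite N"
    using finite_\<A> by (auto simp: N_def intro: finite_subset[OF _ finite_cartesian_product[of \<A> \<A>]])
  moreover have "m \<noteq> 0" if "m \<in> N" for m
    using that unfolding N_def
  proof (elim insertE imageE)
    fix x assume x: "m = (case x of (H, K) \<Rightarrow> cross (normal_vector H) (normal_vector K))"
      "x \<in> {(H, K). (H, K) \<in> \<A> \<times> \<A> \<and> H \<noteq> K}"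
    obtain H K where HK: "x = (H, K)" by (cases x)
    show "m \<noteq> 0" using x unfolding HK by (simp add: cross_normal_ne_0 hyp)
  qed (use n(2) in simp)
  hence "0 \<notin> N" by blast
  ultimately obtain w where w: "\<And>n. n \<in> N \<Longrightarrow> pairing n w \<noteq> 0" by (rule generic_vector) blast
  have wn: "pairing n w \<noteq> 0" using w by (simp add: N_def)
  have wHK: "pairing (cross (normal_vector H) (normal_vector K)) w \<noteq> 0"
    if "H \<in> \<A>" "K \<in> \<A>" "H \<noteq> K" for H K
    using that by (intro w) (auto simp: N_def)
  have "cross a w \<noteq> 0"
  proof
    assume "cross a w = 0"
    then obtain l where l: "w = l *s a" using proportional_if_cross_0 a0 by blast
    have "pairing a n = 0" using n(1) kera by (auto simp: form_kernel_pairing)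
    moreover have "pairing n w = l * pairing a n" by (simp add: l pairing_def algebra_simps)
    ultimately have "pairing n w = 0" by simp
    thus False using wn by simp
  qed
  moreover have "cross w a = - cross a w" by (simp add: vec_eq_iff forall_3)
  ultimately have "cross w a \<noteq> 0" by simp
  then obtain b where b: "pairing (cross w a) b \<noteq> 0"
    by (auto intro: generic_vector[of "{cross w a}"])
  define A :: "'k ^ 3 ^ 3" where "A = vector [b, w, a]"
  have A: "A $ 1 = b" "A $ 2 = w" "A $ 3 = a" by (simp_all add: A_def vector_3)
  have "det A \<noteq> 0" using b by (simp add: det_pairing_cross A)
  hence "invertible A" by (simp add: invertible_det_nz)
  then obtain B where AB: "A ** B = mat 1" "B ** A = mat 1" by (auto simp: invertible_def)
  define v where "v H = normal_vector H v* B" for H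
  have vA: "v H v* A = normal_vector H" for H
    by (simp add: v_def vector_matrix_mul_assoc AB)
  have comp: "normal_vector H $ i = v H $ 1 * b $ i + v H $ 2 * w $ i + v H $ 3 * a $ i" for H i
    using arg_cong[OF vA[of H], of "\<lambda>x. x $ i"]
    by (simp add: vector_matrix_mult_def sum_3 A algebra_simps)
  have v0: "v H0 = vector [0, 0, 1]"
  proof -
    have "v H0 = (A ** B) $ 3" by (simp add: v_def matrix_row_mult A a_def)
    thus ?thesis by (simp add: AB vec_eq_iff forall_3 vector_3 mat_def)
  qed
  \<comment> \<open>Otherwise the normals of \<open>H\<close> and \<open>H0\<close> would be
    dependent with \<open>w\<close>, and \<open>w\<close> would vanish on
    \<open>H \<inter> H0\<close>.\<close>
  have v1: "v H $ 1 \<noteq> 0" if H: "H \<in> \<A> - {H0}" for H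
  proof
    assume 0: "v H $ 1 = 0"
    have "pairing (cross (normal_vector H) a) w = 0"
      by (simp add: pairing_def comp 0 algebra_simps)
    thus False using wHK[of H H0] H H0 by (simp add: a_def)
  qed
  define s where "s H = v H $ 1" for H
  define p where "p H = - v H $ 2 / v H $ 1" for H
  define c where "c H = v H $ 3 / v H $ 1" for H
  have "inj_on c (\<A> - {H0})"
  proof (rule inj_onI, rule ccontr)
    fix H K assume HK: "H \<in> \<A> - {H0}" "K \<in> \<A> - {H0}" "c H = c K" "H \<noteq> K"
    have eq: "v H $ 3 * v K $ 1 = v K $ 3 * v H $ 1"
      using HK(3) v1[OF HK(1)] v1[OF HK(2)] by (simp add: c_def field_simps)
    \<comment> \<open>The determinant of both normals and \<open>w\<close> is, up to a constant, the
      minor that vanishes when \<open>c H = c K\<close>.\<close>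
    have "pairing (cross (normal_vector H) (normal_vector K)) w =
        (v H $ 3 * v K $ 1 - v K $ 3 * v H $ 1) * pairing (cross a b) w"
      by (simp add: pairing_def comp algebra_simps)
    hence "pairing (cross (normal_vector H) (normal_vector K)) w = 0" by (simp add: eq)
    thus False using wHK[of H K] HK by simp
  qed
  moreover have "arrangement_coords p c A B \<A> H0 s"
  proof unfold_locales
    show "normal_vector H0 v* B = vector [0, 0, 1]" using v0 by (simp add: v_def)
    fix H assume H: "H \<in> \<A> - {H0}"
    show "s H \<noteq> 0" using v1[OF H] by (simp add: s_def)
    have "v H = vector [s H, - s H * p H, s H * c H]"
      using v1[OF H] by (simp add: vec_eq_iff forall_3 vector_3 s_def p_def c_def)
    thus "normal_vector H v* B = vector [s H, - s H * p H, s H * c H]" by (simp add: v_def)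
  qed (use AB H0 in auto)
  ultimately show ?thesis using that by blast
qed

locale central_arrangement_coords = arrangement_coords p c A B \<A> H0 s + central_arrangement \<A>
  for p c :: "('k::field_char_0 ^ 3) set \<Rightarrow> 'k" and A B and \<A> and H0 and s +
  assumes inj_c: "inj_on c (\<A> - {H0})"
begin

lemma pairing_coords: "pairing a (B *v y) = pairing (a v* B) y"
  by (simp add: pairing_def matrix_vector_mult_def vector_matrix_mult_def sum_3 algebra_simps)

lemma mem_H0: "B *v vector [x, y, z] \<in> H0 \<longleftrightarrow> z = 0"
proof -
  have "B *v vector [x, y, z] \<in> form_kernel (normal_vector H0) \<longleftrightarrow> z = 0"
    by (simp add: form_kernel_pairing pairing_coords normal_H0) (simp add: pairing_def vector_3)
  thus ?thesis using hyperplane_normal(1)[OF hyp[OF H0]] by simp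
qed

lemma mem_line:
  assumes "H \<in> \<A> - {H0}"
  shows "B *v vector [x, y, z] \<in> H \<longleftrightarrow> x - p H * y + c H * z = 0"
proof -
  have "pairing (vector [s H, - s H * p H, s H * c H]) (vector [x, y, z]) = s H * (x - p H * y + c H * z)"
    by (simp add: pairing_def vector_3 algebra_simps)
  hence "B *v vector [x, y, z] \<in> form_kernel (normal_vector H) \<longleftrightarrow> x - p H * y + c H * z = 0"
    using s[OF assms] by (simp add: form_kernel_pairing pairing_coords normal[OF assms])
  thus ?thesis using hyperplane_normal(1)[OF hyp] assms by simp
qed

lemma coords_obtain: obtains y1 y2 y3 where "x = B *v vector [y1, y2, y3]"
proof -
  have "x = B *v (A *v x)" by (simp add: matrix_vector_mul_assoc BA)
  moreover have "A *v x = vector [(A *v x) $ 1, (A *v x) $ 2, (A *v x) $ 3]"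
    by (simp add: vec_eq_iff forall_3 vector_3)
  ultimately show ?thesis using that by metis
qed

text \<open>In projective coordinates, \<open>H\<close> meets \<open>H0\<close> in the point
  \<open>(p H : 1 : 0)\<close>.\<close>

lemma inter_H0_eq_iff:
  assumes "H \<in> \<A> - {H0}" "K \<in> \<A> - {H0}"
  shows "H \<inter> H0 = K \<inter> H0 \<longleftrightarrow> p H = p K"
proof
  assume "H \<inter> H0 = K \<inter> H0"
  moreover have "B *v vector [p H, 1, 0] \<in> H \<inter> H0" by (simp add: mem_line[OF assms(1)] mem_H0)
  ultimately have "B *v vector [p H, 1, 0] \<in> K" by blast
  thus "p H = p K" by (simp add: mem_line[OF assms(2)])
next
  assume "p H = p K"
  hence "x \<in> H \<inter> H0 \<longleftrightarrow> x \<in> K \<inter> H0" for x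
    by (rule_tac x = x in coords_obtain) (auto simp: mem_line[OF assms(1)] mem_line[OF assms(2)] mem_H0)
  thus "H \<inter> H0 = K \<inter> H0" by blast
qed

lemma restriction_image: "restriction \<A> H0 = (\<lambda>H. H \<inter> H0) ` (\<A> - {H0})"
  by (auto simp: restriction_def)

lemma card_restriction: "card (restriction \<A> H0) = card (p ` (\<A> - {H0}))"
proof -
  define g where "g X = p (SOME H. H \<in> \<A> - {H0} \<and> H \<inter> H0 = X)" for X
  have g: "g (H \<inter> H0) = p H" if H: "H \<in> \<A> - {H0}" for H
  proof -
    have "(SOME K. K \<in> \<A> - {H0} \<and> K \<inter> H0 = H \<inter> H0) \<in> \<A> - {H0} \<and>
        (SOME K. K \<in> \<A> - {H0} \<and> K \<inter> H0 = H \<inter> H0) \<inter> H0 = H \<inter> H0"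
      by (rule someI[of _ H]) (use H in blast)
    thus ?thesis unfolding g_def using inter_H0_eq_iff[OF _ H] by blast
  qed
  have "bij_betw g (restriction \<A> H0) (p ` (\<A> - {H0}))"
    unfolding bij_betw_def restriction_image
    by (auto simp: inj_on_def image_image g inter_H0_eq_iff cong: image_cong_simp)
  thus ?thesis by (rule bij_betw_same_card)
qed

lemma ziegler_mult_eq:
  assumes "H \<in> \<A> - {H0}"
  shows "ziegler_mult \<A> H0 (H \<inter> H0) = mult_at (\<A> - {H0}) (p H)"
  unfolding ziegler_mult_def mult_at_def
  using inter_H0_eq_iff[OF _ assms] by (intro arg_cong[of _ _ card]) blast

lemma sum_ziegler_mult: "(\<Sum>K\<in>restriction \<A> H0. ziegler_mult \<A> H0 K) = card (\<A> - {H0})"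
proof -
  have "(\<Sum>K\<in>restriction \<A> H0. \<Sum>H\<in>{H \<in> \<A> - {H0}. H \<inter> H0 = K}. 1) = (\<Sum>H\<in>\<A> - {H0}. 1 :: nat)"
    unfolding restriction_image using finite_\<A> by (intro sum.group) auto
  thus ?thesis by (simp add: ziegler_mult_def)
qed

text \<open>All multiplicities add up to the number of lines other than \<open>H0\<close>, so being
  at most the sum of the others means at most half.\<close>

lemma balanced_mult_at:
  assumes "balanced_restriction \<A> H0" "\<xi> \<in> p ` (\<A> - {H0})"
  shows "2 * mult_at (\<A> - {H0}) \<xi> \<le> card (\<A> - {H0})"
proof -
  obtain H where H: "H \<in> \<A> - {H0}" "\<xi> = p H" using assms(2) by auto
  have mem: "H \<inter> H0 \<in> restriction \<A> H0" using H by (auto simp: restriction_image)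
  have "finite (restriction \<A> H0)" using finite_\<A> by (simp add: restriction_image)
  hence "ziegler_mult \<A> H0 (H \<inter> H0)
      + (\<Sum>K\<in>restriction \<A> H0 - {H \<inter> H0}. ziegler_mult \<A> H0 K) = card (\<A> - {H0})"
    using mem by (simp add: sum_ziegler_mult flip: sum.remove)
  moreover have "ziegler_mult \<A> H0 (H \<inter> H0)
      \<le> (\<Sum>K\<in>restriction \<A> H0 - {H \<inter> H0}. ziegler_mult \<A> H0 K)"
    using assms(1) mem by (auto simp: balanced_restriction_def)
  ultimately show ?thesis using ziegler_mult_eq[OF H(1)] by (simp add: H(2))
qed

text \<open>\<open>H0\<close> is always included, matching the value 0 in
  \<open>line_points\<close>.\<close>

definition sub_b2 :: "('k ^ 3) set set \<Rightarrow> nat" where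
  "sub_b2 J = central_arrangement.b2 (insert H0 J)"

lemma sub_central: "J \<subseteq> \<A> \<Longrightarrow> central_arrangement (insert H0 J)"
  using arr H0 by unfold_locales (auto simp: arrangement_def intro: finite_subset)

text \<open>\<open>pt\<close> parametrizes the points of \<open>H\<close> with \<open>y = 1\<close>.
  For each value in \<open>line_points\<close> some \<open>K\<close> contains \<open>pt\<close> of
  that value only, so \<open>g\<close> recovers it from \<open>H \<inter> K\<close>.\<close>

lemma card_line_points_le:
  assumes "J \<subseteq> \<A> - {H0}" "H \<in> \<A> - {H0}" "H \<notin> J"
  shows "card (line_points H J) \<le> card ((\<inter>) H ` insert H0 J)"
proof -
  define pt where "pt z = B *v vector [p H - c H * z, 1, z]" for z
  have ptH: "pt z \<in> H" for z by (simp add: pt_def mem_line[OF assms(2)])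
  define g where "g X = (SOME z. pt z \<in> X)" for X
  have ne: "c H - c K \<noteq> 0" if "K \<in> J" for K
    using inj_c that assms by (auto simp: inj_on_def)
  have "line_points H J \<subseteq> g ` ((\<inter>) H ` insert H0 J)"
  proof
    fix z assume "z \<in> line_points H J"
    hence "\<exists>K\<in>insert H0 J. \<forall>t. pt t \<in> K \<longleftrightarrow> t = z"
    proof (cases "z = 0")
      case True
      thus ?thesis by (intro bexI[of _ H0]) (auto simp: pt_def mem_H0)
    next
      case False
      then obtain K where K: "K \<in> J" "z = (p H - p K) / (c H - c K)"
        using \<open>z \<in> _\<close> by (auto simp: line_points_def)
      have KA: "K \<in> \<A> - {H0}" using K(1) assms(1) by blast
      have "pt t \<in> K \<longleftrightarrow> t = z" for t
        unfolding pt_def mem_line[OF KA] K(2) using ne[OF K(1)] by (auto simp: field_simps)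
      thus ?thesis using K(1) by blast
    qed
    then obtain K where K: "K \<in> insert H0 J" "\<And>t. pt t \<in> K \<longleftrightarrow> t = z" by blast
    have "g (H \<inter> K) = z" using K(2) ptH by (simp add: g_def)
    thus "z \<in> g ` ((\<inter>) H ` insert H0 J)" using K(1) by blast
  qed
  moreover have fin: "finite ((\<inter>) H ` insert H0 J)"
    using assms(1) finite_\<A> by (auto intro: finite_subset)
  ultimately have "card (line_points H J) \<le> card (g ` ((\<inter>) H ` insert H0 J))"
    by (intro card_mono) auto
  also have "\<dots> \<le> card ((\<inter>) H ` insert H0 J)" using fin by (rule card_image_le)
  finally show ?thesis .
qed

lemma sub_b2_insert:
  assumes "J \<subseteq> \<A> - {H0}" "H \<in> \<A> - {H0}" "H \<notin> J"
  shows "sub_b2 J + card (line_points H J) \<le> sub_b2 (insert H J)"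
proof -
  have "sub_b2 J + card ((\<inter>) H ` insert H0 J) \<le> sub_b2 (insert H J)"
    unfolding sub_b2_def insert_commute[of H0 H]
    using assms hyp by (intro b2_insert sub_central) auto
  thus ?thesis using card_line_points_le[OF assms] by linarith
qed

lemma sub_b2_empty: "sub_b2 {} = 0"
proof -
  interpret E: central_arrangement "{H0}" using sub_central[of "{}"] by simp
  have "E.points = {}" by (auto elim!: E.pointsE)
  thus ?thesis by (simp add: sub_b2_def E.b2_def)
qed

text \<open>Every new line meets \<open>H0\<close>, so each step adds at least one. This gives the
  nonnegativity of the roots in \<open>PB3_free\<close>.\<close>

lemma sub_b2_ge_card: "J \<subseteq> \<A> - {H0} \<Longrightarrow> card J \<le> sub_b2 J"
proof -
  assume J: "J \<subseteq> \<A> - {H0}"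
  hence "finite J" using finite_\<A> by (auto intro: finite_subset)
  thus ?thesis using J
  proof (induction J)
    case (insert H J)
    have "card (line_points H J) \<ge> 1"
      using insert.hyps(1) by (auto simp: line_points_def Suc_le_eq card_gt_0_iff)
    thus ?case using insert sub_b2_insert[of J H] by simp
  qed simp
qed

lemma sub_b2_all: "sub_b2 (\<A> - {H0}) = b2"
  using H0 by (simp add: sub_b2_def insert_absorb)

end

section \<open>Comparison of the bounds and conclusion\<close>

lemma sum_rank2_hilb_aux: "d \<le> k + 1 \<Longrightarrow> 2 * (\<Sum>j\<le>k. j + 1 - d) = (k + 1 - d) * (k + 2 - d)"
  for d k :: nat
proof (induction k)
  case (Suc k)
  show ?case
  proof (cases "d = Suc k + 1")
    case True
    have "(\<Sum>j\<le>Suc k. j + 1 - d) = 0" using True by (intro sum.neutral) auto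
    thus ?thesis using True by simp
  next
    case False
    then obtain r where r: "k + 1 = d + r" using Suc.prems le_Suc_ex[of d "k + 1"] by auto
    have eqs: "k + 1 - d = r" "k + 2 - d = Suc r" "Suc k + 1 - d = Suc r" "Suc k + 2 - d = Suc (Suc r)"
      and le: "d \<le> k + 1"
      using r by auto
    show ?thesis unfolding sum.atMost_Suc distrib_left Suc.IH[OF le] eqs by simp
  qed
qed auto

text \<open>Identifies the lower bound of \<open>dim_dlog_ge\<close>, for \<open>d + d'\<close>
  lines and \<open>e I = d + d' + d * d'\<close>, with the dimension for exponents
  \<open>d, d'\<close>.\<close>

lemma sum_rank2_hilb:
  assumes "d \<le> k + 1" "d' \<le> k + 1"
  shows "(\<Sum>j\<le>k. rank2_hilb d d' j) + (d + d') * k + (d + d') + d * d'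
    = (k + 1) * (k + 2) + (\<Sum>j<d + d'. j)"
proof -
  define K where "K = int k"
  define D where "D = int d"
  define D' where "D' = int d'"
  have gauss: "2 * (\<Sum>j<n. int j) = int n * (int n - 1)" for n
    by (induction n) (auto simp: algebra_simps)
  have aux: "2 * (\<Sum>j\<le>k. int (j + 1 - e)) = (int k + 1 - int e) * (int k + 2 - int e)" if "e \<le> k + 1" for e
  proof -
    have "int (k + 1 - e) = int k + 1 - int e" "int (k + 2 - e) = int k + 2 - int e" using that by auto
    thus ?thesis using arg_cong[OF sum_rank2_hilb_aux[OF that], of int] by simp
  qed
  have "2 * int (\<Sum>j\<le>k. rank2_hilb d d' j) = (K + 1 - D) * (K + 2 - D) + (K + 1 - D') * (K + 2 - D')"
    using aux[OF assms(1)] aux[OF assms(2)]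
    by (simp add: rank2_hilb_def sum.distrib K_def D_def D'_def)
  moreover have "2 * int (\<Sum>j<d + d'. j) = (D + D') * (D + D' - 1)"
    using gauss[of "d + d'"] by (simp add: D_def D'_def)
  ultimately have "2 * (int (\<Sum>j\<le>k. rank2_hilb d d' j) + (D + D') * K + (D + D') + D * D')
      = 2 * ((K + 1) * (K + 2) + int (\<Sum>j<d + d'. j))"
    by (simp add: algebra_simps)
  hence "int (\<Sum>j\<le>k. rank2_hilb d d' j) + (D + D') * K + (D + D') + D * D'
      = (K + 1) * (K + 2) + int (\<Sum>j<d + d'. j)"
    by (metis mult_left_cancel zero_neq_numeral)
  hence "int ((\<Sum>j\<le>k. rank2_hilb d d' j) + (d + d') * k + (d + d') + d * d')
      = int ((k + 1) * (k + 2) + (\<Sum>j<d + d'. j))"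
    unfolding K_def D_def D'_def by (simp only: of_nat_add of_nat_mult of_nat_1 of_nat_numeral)
  thus ?thesis by (simp only: of_nat_eq_iff)
qed

theorem PB3_free:
  fixes \<A> :: "('k::field_char_0 ^ 3) set set"
  assumes "\<A> \<in> PB3"
  shows "free_arrangement \<A>"
proof -
  interpret central_arrangement \<A>
    using assms by unfold_locales (simp add: PB3_def)
  obtain H0 e e' where H0: "H0 \<in> \<A>"
    and chi: "characteristic_poly \<A> = [:-1, 1:] * [:-e, 1:] * [:-e', 1:]"
    and gap: "\<bar>e - e'\<bar> \<ge> int (card (restriction \<A> H0)) - 3"
    using assms by (auto simp: PB3_def)
  have bal: "balanced_restriction \<A> H0" using assms H0 by (auto simp: PB3_def)
  obtain A B p c s where co: "arrangement_coords p c A B \<A> H0 s" "inj_on c (\<A> - {H0})"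
    using coords_exist[OF H0] .
  interpret central_arrangement_coords p c A B \<A> H0 s
  proof -
    interpret arrangement_coords p c A B \<A> H0 s by (rule co)
    show "central_arrangement_coords p c A B \<A> H0 s" by unfold_locales (rule co)
  qed
  define I where "I = \<A> - {H0}"
  have finI: "finite I" using finite_\<A> by (simp add: I_def)
  have card: "card \<A> = card I + 1"
    using H0 finite_\<A> card_Suc_Diff1[of \<A> H0] by (simp add: I_def)
  \<comment> \<open>The coefficients of \<open>t^2\<close> and \<open>t\<close> yield the sum and
    the product of \<open>e\<close> and \<open>e'\<close>.\<close>
  have "coeff (characteristic_poly \<A>) 2 = - (1 + e + e')"
    unfolding chi by (simp add: numeral_2_eq_2)
  hence sum: "e + e' = int (card I)" by (simp add: coeff_characteristic_poly_2 card)
  have "coeff (characteristic_poly \<A>) 1 = e + e' + e * e'"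
    unfolding chi by (simp add: algebra_simps)
  hence prod: "e * e' = int b2 - int (card I)" unfolding coeff_characteristic_poly_1 sum by simp
  have "e * e' \<ge> 0"
    using sub_b2_ge_card[of I] unfolding prod by (simp add: I_def sub_b2_all)
  \<comment> \<open>Both the product and the sum are nonnegative.\<close>
  hence nonneg: "e \<ge> 0" "e' \<ge> 0"
    using sum by (auto simp: zero_le_mult_iff)
  define d where "d = nat (min e e')"
  define d' where "d' = nat (max e e')"
  have dd: "int d = min e e'" "int d' = max e e'" using nonneg by (simp_all add: d_def d'_def)
  have "int (d + d') = int (card I)" using sum unfolding of_nat_add dd by simp
  hence cardI: "card I = d + d'" by (simp only: of_nat_eq_iff)
  have "int d * int d' = e * e'" unfolding dd by (simp add: min_def max_def mult.commute)
  hence "int (d * d' + card I) = int b2" using prod by simp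
  hence b2: "b2 = d * d' + card I" by (simp only: of_nat_eq_iff)
  have le: "d \<le> d'" by (simp add: d_def d'_def)
  have "int (card (p ` I)) \<le> int d' - int d + 3"
    using gap unfolding dd card_restriction I_def by (auto simp: min_def max_def abs_if split: if_splits)
  hence few: "card (p ` I) \<le> d' - d + 3" using le by linarith
  \<comment> \<open>This degree is large enough both for the lower bound, which asks for
    \<open>card I \<le> k\<close>, and for \<open>d' \<le> k\<close>.\<close>
  define k where "k = card I"
  have "(k + 1) * (k + 2) + (\<Sum>j<card I. j) \<le> vs2.dim (dlog I k) + card I * k + sub_b2 I"
    using sub_b2_empty sub_b2_insert finI inj_c by (intro dim_dlog_ge) (auto simp: I_def k_def)
  moreover have "(\<Sum>j\<le>k. rank2_hilb d d' j) + (d + d') * k + (d + d') + d * d'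
      = (k + 1) * (k + 2) + (\<Sum>j<d + d'. j)"
    by (rule sum_rank2_hilb) (simp_all add: k_def cardI)
  ultimately have dims: "(\<Sum>j\<le>k. rank2_hilb d d' j) \<le> vs2.dim (dlog I k)"
    unfolding sub_b2_all[folded I_def] b2 cardI by linarith
  have "d' \<le> k" by (simp add: k_def cardI)
  moreover have "inj_on c I" using inj_c by (simp add: I_def)
  moreover have "2 * mult_at I \<xi> \<le> card I" if "\<xi> \<in> p ` I" for \<xi>
    using balanced_mult_at[OF bal] that by (simp add: I_def)
  ultimately obtain f g f' g' where "(f, g) \<in> dlog I d" "(f', g') \<in> dlog I d'" "f * g' - f' * g \<noteq> 0"
    "\<And>F G k. (F, G) \<in> dlog I k \<Longrightarrow>
      \<exists>a b. lincomb_deg d d' k a b \<and> F = a * f + b * f' \<and> G = a * g + b * g'"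
    using dlog_basis[OF finI _ cardI le _ few _ dims] by blast
  thus ?thesis unfolding I_def by (rule free_if_dlog_basis)
qed

theorem corollary0p4:
  fixes \<A> \<B> :: "('k::field_char_0 ^ 3) set set"
  assumes "\<A> \<in> PB3" and "\<B> \<in> PB3"
    and "lattice_isomorphic (intersection_lattice \<A>) (intersection_lattice \<B>)"
  shows "free_arrangement \<A> \<longleftrightarrow> free_arrangement \<B>"
  using assms(1,2) PB3_free by blast

end
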